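(* Let $M^n=I\times\mathbb{R}^{n-1}$, where $I\subset\mathbb{R}$ is an open interval, be endowed with the multiple warped product metric $$d\sigma^2=\rho(t)^2\,dt^2+\eta_1(t)^2\,dx_1^2+\cdots+\eta_{n-1}(t)^2\,dx_{n-1}^2,$$ where $\rho(t),\eta_j(t)$, with $t\in I$ and $j=1,\ldots,n-1$, are positive smooth functions and $dx_1,\ldots,dx_{n-1}$ are the canonical coframes of $\mathbb{R}^{n-1}$. Then, for all $c>0$ and $a\in\{0,\ldots,n-1\}$, the manifold $M^n$ admits: (i) isometric immersions in $\mathbb{R}^{4n-3-2a}_{a}$, $\mathbb{S}^{4n-3-2a}_{a}(c)$, and $\mathbb{H}^{4n-3-a}_{a}(-c)$; (ii) isometric embeddings in $\mathbb{R}^{8n-7-6a}_{a}$, $\mathbb{S}^{8n-5-6a}_{a}(c)$, and $\mathbb{H}^{8n-7-5a}_{a}(-c)$. Moreover, all immersions and embeddings above are smooth and given explicitly.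
   Context: For integers $0\le a\le m$, the semi-Euclidean space $\mathbb{R}^m_a$ is $\mathbb{R}^m$ with the inner product of signature $(a,m-a)$ given by $\langle\,,\rangle=-dx_1^2-\cdots-dx_a^2+dx_{a+1}^2+\cdots+dx_m^2$ (so $\mathbb{R}^m_0=\mathbb{R}^m$ is Euclidean space). For $c>0$ define the quadrics $$\mathbb{S}^m_a(c)=\{x\in\mathbb{R}^{m+1}_a : \langle x,x\rangle=1/c\},\qquad \mathbb{H}^m_a(-c)=\{x\in\mathbb{R}^{m+1}_{a+1} : \langle x,x\rangle=-1/c\},$$ with the semi-Riemannian metrics of signature $(a,m-a)$ (that is, $a$ negative and $m-a$ positive directions) induced from the ambient semi-Euclidean space; they have constant curvatures $c$ and $-c$, respectively. An isometric immersion of a Riemannian manifold $(M,g)$ in a semi-Riemannian manifold $(N,h)$ is an immersion $f:M\to N$ with $f^*h=g$. An isometric embedding is an injective isometric immersion which is a homeomorphism onto its image, the image carrying the topology induced from $N$. "Given explicitly" means that the maps are constructed by explicit formulas, as opposed to being obtained from an abstract existence theorem. *)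

theory Defs
  imports "HOL-Analysis.Analysis"
begin

section \<open>Smooth maps between coordinate spaces\<close>

text \<open>
  The dimensions depend on the natural numbers n and a, so points of m-dimensional real space are
  the points of the topological space \<^const>\<open>Euclidean_space\<close> m: functions on nat that vanish at
  all indices k with m \<le> k.  Coordinates are counted from 0.
\<close>

definition smooth_real_on :: "real set \<Rightarrow> (real \<Rightarrow> real) \<Rightarrow> bool" where
  "smooth_real_on I f \<longleftrightarrow> (\<forall>k. \<forall>t\<in>I. ((deriv ^^ k) f) differentiable (at t))"

definition partial_deriv :: "nat \<Rightarrow> ((nat \<Rightarrow> real) \<Rightarrow> real) \<Rightarrow> (nat \<Rightarrow> real) \<Rightarrow> real" where
  "partial_deriv i f x = deriv (\<lambda>s. f (x(i := s))) (x i)"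

text \<open>
  Used for sets U that are open in \<^const>\<open>Euclidean_space\<close> n: all iterated partial derivatives of all
  components exist and are continuous on U.
\<close>

definition smooth_map_on ::
  "nat \<Rightarrow> (nat \<Rightarrow> real) set \<Rightarrow> nat \<Rightarrow> ((nat \<Rightarrow> real) \<Rightarrow> nat \<Rightarrow> real) \<Rightarrow> bool" where
  "smooth_map_on n U m f \<longleftrightarrow>
    (\<forall>k<m. \<forall>is. set is \<subseteq> {..<n} \<longrightarrow>
      (let g = fold partial_deriv is (\<lambda>x. f x k) in
        continuous_map (subtopology (Euclidean_space n) U) euclideanreal g \<and>
        (\<forall>i<n. \<forall>x\<in>U. (\<lambda>s. g (x(i := s))) differentiable (at (x i)))))"

definition differential ::
  "nat \<Rightarrow> ((nat \<Rightarrow> real) \<Rightarrow> nat \<Rightarrow> real) \<Rightarrow> (nat \<Rightarrow> real) \<Rightarrow> (nat \<Rightarrow> real) \<Rightarrow> nat \<Rightarrow> real" where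
  "differential n f p v = (\<lambda>k. \<Sum>i<n. partial_deriv i (\<lambda>x. f x k) p * v i)"


section \<open>Semi-Euclidean spaces and their quadrics\<close>

definition semi_inner :: "nat \<Rightarrow> nat \<Rightarrow> (nat \<Rightarrow> real) \<Rightarrow> (nat \<Rightarrow> real) \<Rightarrow> real" where
  "semi_inner m a x y = (\<Sum>k<m. (if k < a then - 1 else 1) * x k * y k)"

text \<open>
  A target space is a submanifold of a semi-Euclidean space, with the induced metric; it is recorded
  together with the dimension and the index of that ambient space.
\<close>

record target_space =
  amb_dim :: nat
  amb_index :: nat
  points :: "(nat \<Rightarrow> real) set"

definition semi_Euclidean :: "nat \<Rightarrow> nat \<Rightarrow> target_space" where
  "semi_Euclidean m a = \<lparr>amb_dim = m, amb_index = a, points = topspace (Euclidean_space m)\<rparr>"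

definition semi_sphere :: "nat \<Rightarrow> nat \<Rightarrow> real \<Rightarrow> target_space" where
  "semi_sphere m a c =
    \<lparr>amb_dim = m + 1, amb_index = a,
     points = {x \<in> topspace (Euclidean_space (m + 1)). semi_inner (m + 1) a x x = 1 / c}\<rparr>"

text \<open>In \<open>semi_hyperbolic m a c\<close> the parameter c is positive and the curvature is - c.\<close>

definition semi_hyperbolic :: "nat \<Rightarrow> nat \<Rightarrow> real \<Rightarrow> target_space" where
  "semi_hyperbolic m a c =
    \<lparr>amb_dim = m + 1, amb_index = a + 1,
     points = {x \<in> topspace (Euclidean_space (m + 1)). semi_inner (m + 1) (a + 1) x x = - 1 / c}\<rparr>"


section \<open>Isometric immersions and embeddings\<close>

text \<open>
  The source is a set M open in \<^const>\<open>Euclidean_space\<close> n with a Riemannian metric g, where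
  \<open>g p v w\<close> is the inner product at p of the tangent vectors v and w.  The quadrics are regular level
  sets, so a smooth map into one of them is a smooth map into the ambient space with values in it, and
  the pull-back of the induced metric is the pull-back of the ambient one.
\<close>

definition isometric_immersion ::
  "nat \<Rightarrow> (nat \<Rightarrow> real) set \<Rightarrow> ((nat \<Rightarrow> real) \<Rightarrow> (nat \<Rightarrow> real) \<Rightarrow> (nat \<Rightarrow> real) \<Rightarrow> real) \<Rightarrow>
   target_space \<Rightarrow> ((nat \<Rightarrow> real) \<Rightarrow> nat \<Rightarrow> real) \<Rightarrow> bool" where
  "isometric_immersion n M g N f \<longleftrightarrow>
    f ` M \<subseteq> points N \<and>
    smooth_map_on n M (amb_dim N) f \<and>
    (\<forall>p\<in>M. inj_on (differential n f p) (topspace (Euclidean_space n))) \<and>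
    (\<forall>p\<in>M. \<forall>v\<in>topspace (Euclidean_space n). \<forall>w\<in>topspace (Euclidean_space n).
      semi_inner (amb_dim N) (amb_index N) (differential n f p v) (differential n f p w) = g p v w)"

definition isometric_embedding ::
  "nat \<Rightarrow> (nat \<Rightarrow> real) set \<Rightarrow> ((nat \<Rightarrow> real) \<Rightarrow> (nat \<Rightarrow> real) \<Rightarrow> (nat \<Rightarrow> real) \<Rightarrow> real) \<Rightarrow>
   target_space \<Rightarrow> ((nat \<Rightarrow> real) \<Rightarrow> nat \<Rightarrow> real) \<Rightarrow> bool" where
  "isometric_embedding n M g N f \<longleftrightarrow>
    isometric_immersion n M g N f \<and>
    inj_on f M \<and>
    embedding_map (subtopology (Euclidean_space n) M)
      (subtopology (Euclidean_space (amb_dim N)) (points N)) f"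


section \<open>The multiple warped product\<close>

text \<open>Coordinate 0 is t, and coordinate j is \<open>x\<^sub>j\<close> for j = 1, ..., n - 1.\<close>

definition warped_domain :: "nat \<Rightarrow> real set \<Rightarrow> (nat \<Rightarrow> real) set" where
  "warped_domain n I = {x \<in> topspace (Euclidean_space n). x 0 \<in> I}"

definition warped_metric ::
  "nat \<Rightarrow> (real \<Rightarrow> real) \<Rightarrow> (nat \<Rightarrow> real \<Rightarrow> real) \<Rightarrow>
   (nat \<Rightarrow> real) \<Rightarrow> (nat \<Rightarrow> real) \<Rightarrow> (nat \<Rightarrow> real) \<Rightarrow> real" where
  "warped_metric n \<rho> \<eta> p v w =
    (\<rho> (p 0))\<^sup>2 * v 0 * w 0 + (\<Sum>j\<in>{1..<n}. (\<eta> j (p 0))\<^sup>2 * v j * w j)"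


section \<open>Explicit formulas for the maps\<close>

text \<open>
  The intervals on which the frequencies below are constant are transported to I by the increasing
  diffeomorphism \<open>param I\<close> from I onto the real line; \<open>base I\<close> is a point of I.
\<close>

definition param :: "real set \<Rightarrow> real \<Rightarrow> real" where
  "param I t = (if bdd_above I then 1 / (Sup I - t) else t) +
               (if bdd_below I then 1 / (Inf I - t) else t)"

definition base :: "real set \<Rightarrow> real" where
  "base I =
    (if bdd_below I then (if bdd_above I then (Inf I + Sup I) / 2 else Inf I + 1)
     else (if bdd_above I then Sup I - 1 else 0))"

definition flat_exp :: "real \<Rightarrow> real" where
  "flat_exp s = (if s \<le> 0 then 0 else exp (- 1 / s))"

definition smooth_step :: "real \<Rightarrow> real" where
  "smooth_step s = flat_exp (s - 1/4) / (flat_exp (s - 1/4) + flat_exp (3/4 - s))"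

definition staircase :: "real \<Rightarrow> real" where
  "staircase s = pi / 2 * (of_int \<lfloor>s\<rfloor> + smooth_step (s - of_int \<lfloor>s\<rfloor>))"

text \<open>
  The squares of \<open>cutoff 0\<close> and \<open>cutoff 1\<close> add up to 1, and \<open>cutoff i\<close> vanishes near each
  integer k such that k - i is even.  The second argument of \<open>frequency\<close> below is constant between two
  such integers, so that \<open>amplitude\<close> is smooth.
\<close>

definition cutoff :: "nat \<Rightarrow> real \<Rightarrow> real" where
  "cutoff i s = (if i = 0 then sin (staircase s) else cos (staircase s))"

definition block :: "real set \<Rightarrow> nat \<Rightarrow> real \<Rightarrow> real set" where
  "block I i t = {s \<in> I. \<lfloor>(param I s - real i) / 2\<rfloor> = \<lfloor>(param I t - real i) / 2\<rfloor>}"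

text \<open>
  For \<open>\<kappa>\<close> = 0 the amplitudes A satisfy \<open>\<bar>A'\<bar> \<le> \<rho> / (2 n)\<close>; for \<open>\<kappa>\<close> = c also
  \<open>A\<^sup>2 \<le> 1 / (4 n\<^sup>2 c)\<close>.  This makes the radicands below positive.
\<close>

definition frequency ::
  "nat \<Rightarrow> real set \<Rightarrow> (real \<Rightarrow> real) \<Rightarrow> (nat \<Rightarrow> real \<Rightarrow> real) \<Rightarrow> real \<Rightarrow> nat \<Rightarrow> nat \<Rightarrow> real \<Rightarrow> real" where
  "frequency n I \<rho> \<eta> \<kappa> j i t =
    1 + (SUP s\<in>block I i t.
          2 * real n * (\<bar>deriv (\<lambda>u. \<eta> j u * cutoff i (param I u)) s\<bar> / \<rho> s + sqrt \<kappa> * \<eta> j s))"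

definition amplitude ::
  "nat \<Rightarrow> real set \<Rightarrow> (real \<Rightarrow> real) \<Rightarrow> (nat \<Rightarrow> real \<Rightarrow> real) \<Rightarrow> real \<Rightarrow> nat \<Rightarrow> nat \<Rightarrow> real \<Rightarrow> real" where
  "amplitude n I \<rho> \<eta> \<kappa> j i t = \<eta> j t * cutoff i (param I t) / frequency n I \<rho> \<eta> \<kappa> j i t"

text \<open>
  Two curves, parametrized by arc length, in the unit spheres of the plane and of 4-space.  The first
  is used for the immersions.  The second is an embedding of the real line, since its parameter s
  satisfies \<open>sinh s = (y\<^sub>0 y\<^sub>2 + y\<^sub>1 y\<^sub>3) / (y\<^sub>0\<^sup>2 + y\<^sub>1\<^sup>2)\<close>; it is used for the embeddings.
\<close>

definition circle_curve :: "real \<Rightarrow> real list" where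
  "circle_curve s = [cos s, sin s]"

definition spiral_curve :: "real \<Rightarrow> real list" where
  "spiral_curve s =
    [cos (ln (cosh s)) / cosh s, sin (ln (cosh s)) / cosh s,
     cos (ln (cosh s)) * tanh s, sin (ln (cosh s)) * tanh s]"

definition of_coords :: "real list \<Rightarrow> nat \<Rightarrow> real" where
  "of_coords ys k = (if k < length ys then ys ! k else 0)"

text \<open>
  The coordinates contributed by \<open>x\<^sub>j\<close> for j = a + 1, ..., n - 1; their contribution to the metric is
  \<open>(\<Sum>j i. (A\<^sub>j\<^sub>i')\<^sup>2) dt\<^sup>2 + \<Sum>j. \<eta>\<^sub>j\<^sup>2 dx\<^sub>j\<^sup>2\<close>, where the \<open>A\<^sub>j\<^sub>i\<close> are the amplitudes.
\<close>

definition wound_coords ::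
  "(real \<Rightarrow> real list) \<Rightarrow> nat \<Rightarrow> nat \<Rightarrow> real set \<Rightarrow> (real \<Rightarrow> real) \<Rightarrow> (nat \<Rightarrow> real \<Rightarrow> real) \<Rightarrow> real \<Rightarrow>
   (nat \<Rightarrow> real) \<Rightarrow> real list" where
  "wound_coords \<sigma> n a I \<rho> \<eta> \<kappa> x =
    concat (map (\<lambda>(j, i).
      map (\<lambda>y. amplitude n I \<rho> \<eta> \<kappa> j i (x 0) * y) (\<sigma> (frequency n I \<rho> \<eta> \<kappa> j i (x 0) * x j)))
      (List.product [a+1..<n] [0, 1]))"

definition amplitude_sum ::
  "nat \<Rightarrow> nat \<Rightarrow> real set \<Rightarrow> (real \<Rightarrow> real) \<Rightarrow> (nat \<Rightarrow> real \<Rightarrow> real) \<Rightarrow> real \<Rightarrow> real \<Rightarrow> real" where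
  "amplitude_sum n a I \<rho> \<eta> \<kappa> t =
    (\<Sum>j\<in>{a+1..<n}. \<Sum>i\<in>{0, 1}. (amplitude n I \<rho> \<eta> \<kappa> j i t)\<^sup>2)"

definition amplitude_deriv_sum ::
  "nat \<Rightarrow> nat \<Rightarrow> real set \<Rightarrow> (real \<Rightarrow> real) \<Rightarrow> (nat \<Rightarrow> real \<Rightarrow> real) \<Rightarrow> real \<Rightarrow> real \<Rightarrow> real" where
  "amplitude_deriv_sum n a I \<rho> \<eta> \<kappa> t =
    (\<Sum>j\<in>{a+1..<n}. \<Sum>i\<in>{0, 1}. (deriv (amplitude n I \<rho> \<eta> \<kappa> j i) t)\<^sup>2)"

text \<open>
  In the following maps a coordinate \<open>x\<^sub>j\<close> with \<open>1 \<le> j \<le> a\<close> contributes \<open>\<eta>\<^sub>j (cosh x\<^sub>j, sinh x\<^sub>j)\<close>, with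
  metric \<open>- \<eta>\<^sub>j'\<^sup>2 dt\<^sup>2 + \<eta>\<^sub>j\<^sup>2 dx\<^sub>j\<^sup>2\<close>, or \<open>\<eta>\<^sub>j (cosh x\<^sub>j, sinh x\<^sub>j, 1)\<close>, with metric
  \<open>\<eta>\<^sub>j\<^sup>2 dx\<^sub>j\<^sup>2\<close>; the first entry is timelike.  The functions named angle are
  determined by the requirement that the coefficient of \<open>dt\<^sup>2\<close> be \<open>\<rho>\<^sup>2\<close>, and those named radius by the
  equation of the quadric.
\<close>

definition flat_angle ::
  "nat \<Rightarrow> nat \<Rightarrow> real set \<Rightarrow> (real \<Rightarrow> real) \<Rightarrow> (nat \<Rightarrow> real \<Rightarrow> real) \<Rightarrow> real \<Rightarrow> real" where
  "flat_angle n a I \<rho> \<eta> t =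
    (LBINT s=base I..t.
      sqrt ((\<rho> s)\<^sup>2 + (\<Sum>j\<in>{1..a}. (deriv (\<eta> j) s)\<^sup>2) - amplitude_deriv_sum n a I \<rho> \<eta> 0 s))"

definition flat_map ::
  "(real \<Rightarrow> real list) \<Rightarrow> nat \<Rightarrow> nat \<Rightarrow> real set \<Rightarrow> (real \<Rightarrow> real) \<Rightarrow> (nat \<Rightarrow> real \<Rightarrow> real) \<Rightarrow>
   (nat \<Rightarrow> real) \<Rightarrow> nat \<Rightarrow> real" where
  "flat_map \<sigma> n a I \<rho> \<eta> x = of_coords
    (map (\<lambda>j. \<eta> j (x 0) * cosh (x j)) [1..<a+1] @
     map (\<lambda>j. \<eta> j (x 0) * sinh (x j)) [1..<a+1] @
     [flat_angle n a I \<rho> \<eta> (x 0)] @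
     wound_coords \<sigma> n a I \<rho> \<eta> 0 x)"

definition sphere_radius ::
  "nat \<Rightarrow> nat \<Rightarrow> real set \<Rightarrow> (real \<Rightarrow> real) \<Rightarrow> (nat \<Rightarrow> real \<Rightarrow> real) \<Rightarrow> real \<Rightarrow> real \<Rightarrow> real" where
  "sphere_radius n a I \<rho> \<eta> c t =
    sqrt (1 / c + (\<Sum>j\<in>{1..a}. (\<eta> j t)\<^sup>2) - amplitude_sum n a I \<rho> \<eta> c t)"

definition sphere_angle ::
  "nat \<Rightarrow> nat \<Rightarrow> real set \<Rightarrow> (real \<Rightarrow> real) \<Rightarrow> (nat \<Rightarrow> real \<Rightarrow> real) \<Rightarrow> real \<Rightarrow> real \<Rightarrow> real" where
  "sphere_angle n a I \<rho> \<eta> c t =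
    (LBINT s=base I..t.
      sqrt ((\<rho> s)\<^sup>2 + (\<Sum>j\<in>{1..a}. (deriv (\<eta> j) s)\<^sup>2) - amplitude_deriv_sum n a I \<rho> \<eta> c s
        - (deriv (sphere_radius n a I \<rho> \<eta> c) s)\<^sup>2) / sphere_radius n a I \<rho> \<eta> c s)"

definition sphere_map ::
  "(real \<Rightarrow> real list) \<Rightarrow> nat \<Rightarrow> nat \<Rightarrow> real set \<Rightarrow> (real \<Rightarrow> real) \<Rightarrow> (nat \<Rightarrow> real \<Rightarrow> real) \<Rightarrow> real \<Rightarrow>
   (nat \<Rightarrow> real) \<Rightarrow> nat \<Rightarrow> real" where
  "sphere_map \<sigma> n a I \<rho> \<eta> c x = of_coords
    (map (\<lambda>j. \<eta> j (x 0) * cosh (x j)) [1..<a+1] @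
     map (\<lambda>j. \<eta> j (x 0) * sinh (x j)) [1..<a+1] @
     map (\<lambda>y. sphere_radius n a I \<rho> \<eta> c (x 0) * y) (\<sigma> (sphere_angle n a I \<rho> \<eta> c (x 0))) @
     wound_coords \<sigma> n a I \<rho> \<eta> c x)"

definition hyperbolic_radius ::
  "nat \<Rightarrow> nat \<Rightarrow> real set \<Rightarrow> (real \<Rightarrow> real) \<Rightarrow> (nat \<Rightarrow> real \<Rightarrow> real) \<Rightarrow> real \<Rightarrow> real \<Rightarrow> real" where
  "hyperbolic_radius n a I \<rho> \<eta> c t = sqrt (1 / c + amplitude_sum n a I \<rho> \<eta> 0 t)"

definition hyperbolic_angle ::
  "nat \<Rightarrow> nat \<Rightarrow> real set \<Rightarrow> (real \<Rightarrow> real) \<Rightarrow> (nat \<Rightarrow> real \<Rightarrow> real) \<Rightarrow> real \<Rightarrow> real \<Rightarrow> real" where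
  "hyperbolic_angle n a I \<rho> \<eta> c t =
    (LBINT s=base I..t.
      sqrt ((\<rho> s)\<^sup>2 + (deriv (hyperbolic_radius n a I \<rho> \<eta> c) s)\<^sup>2 - amplitude_deriv_sum n a I \<rho> \<eta> 0 s)
        / hyperbolic_radius n a I \<rho> \<eta> c s)"

definition hyperbolic_map ::
  "(real \<Rightarrow> real list) \<Rightarrow> nat \<Rightarrow> nat \<Rightarrow> real set \<Rightarrow> (real \<Rightarrow> real) \<Rightarrow> (nat \<Rightarrow> real \<Rightarrow> real) \<Rightarrow> real \<Rightarrow>
   (nat \<Rightarrow> real) \<Rightarrow> nat \<Rightarrow> real" where
  "hyperbolic_map \<sigma> n a I \<rho> \<eta> c x = of_coords
    ([hyperbolic_radius n a I \<rho> \<eta> c (x 0) * cosh (hyperbolic_angle n a I \<rho> \<eta> c (x 0))] @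
     map (\<lambda>j. \<eta> j (x 0) * cosh (x j)) [1..<a+1] @
     map (\<lambda>j. \<eta> j (x 0) * sinh (x j)) [1..<a+1] @
     map (\<lambda>j. \<eta> j (x 0)) [1..<a+1] @
     [hyperbolic_radius n a I \<rho> \<eta> c (x 0) * sinh (hyperbolic_angle n a I \<rho> \<eta> c (x 0))] @
     wound_coords \<sigma> n a I \<rho> \<eta> 0 x)"

end

theory Submission
  imports Defs
begin

text \<open>
  Every map is a juxtaposition of blocks of coordinates, and the contributions of the blocks to the
  induced metric and to the quadratic form of the ambient space add up.  So each coordinate \<open>x\<^sub>j\<close> gets
  a block that contributes \<open>\<eta>\<^sub>j\<^sup>2 dx\<^sub>j\<^sup>2\<close> and something controllable times \<open>dt\<^sup>2\<close>, and the remaining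
  one or more coordinates depend on t alone and correct the coefficient of \<open>dt\<^sup>2\<close> to \<open>\<rho>\<^sup>2\<close>.

  For j up to a, the hyperbola \<open>\<eta>\<^sub>j (cosh x\<^sub>j, sinh x\<^sub>j)\<close> with one timelike coordinate does this.  For
  the other j, let \<open>\<sigma>\<close> be a curve of unit speed in a unit sphere.  The block \<open>A(t) \<sigma>(\<omega> x\<^sub>j)\<close> with
  \<open>A \<omega> = \<eta>\<^sub>j\<close> contributes \<open>\<eta>\<^sub>j\<^sup>2 dx\<^sub>j\<^sup>2 + A'\<^sup>2 dt\<^sup>2\<close>, without a mixed term, because \<open>\<sigma>\<close> is orthogonal
  to \<open>\<sigma>'\<close>; and \<open>A'\<^sup>2\<close> is small if \<open>\<omega>\<close> is large.  This needs a constant \<open>\<omega>\<close>, since a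
  derivative of \<open>\<omega>\<close> would enter multiplied by the unbounded \<open>x\<^sub>j\<close>, while a single constant cannot
  control \<open>\<eta>\<^sub>j'\<close> up to the ends of I.  The way out is to use two blocks, with frequencies that are step
  functions with interlaced jumps, and to multiply the amplitudes by cutoffs whose squares add up to 1
  and which vanish near the jumps of the respective frequency.  On each step the amplitude and its
  derivative have to be bounded only on a compact subinterval of I, so a suitable frequency exists
  (\<open>frequency_ge\<close>, \<open>abs_deriv_amplitude_le\<close>, \<open>abs_amplitude_le\<close>), and near every t the
  frequency may be treated as a constant (\<open>amplitude_locally\<close>).

  The part that depends on t alone is a coordinate in the flat case, a curve \<open>r \<sigma>(\<theta>)\<close> in the spherical
  case, and \<open>h (cosh \<theta>, sinh \<theta>)\<close> with the coordinates \<open>\<eta>\<^sub>j\<close> in the hyperbolic case.  The equation of the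
  quadric determines the radius, and the coefficient of \<open>dt\<^sup>2\<close> determines the derivative of the angle as
  a square root.  All that remains for the isometry is that the radicands are positive; this follows from
  the smallness of the amplitudes, and in the spherical case from the Cauchy-Schwarz inequality for the
  derivative of the radius (\<open>sphere_radicand_pos\<close>).

  Since the frequency may be frozen, every component of the maps is near each point a product
  of a function of t and a function of one \<open>x\<^sub>j\<close> (\<open>locally_separated\<close>).  This class is closed under
  partial derivatives, which gives smoothness, and has a simple differential.

  For the embeddings, a point is recovered continuously from its image: t from the
  strictly increasing angle, \<open>x\<^sub>j\<close> from \<open>\<eta>\<^sub>j sinh x\<^sub>j\<close>, or from a block whose amplitude does not
  vanish at t by means of the quotient of quadratic forms that equals the hyperbolic sine of the
  parameter of the spiral and does not see the amplitude (\<open>spiral_tendsto\<close>).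
\<close>

section \<open>Smooth functions of one real variable\<close>

text \<open>
  Differentiability k times, with the derivative as a witness instead of the total function
  \<^const>\<open>deriv\<close>.  In this form the closure properties follow by induction on k, since the derivative of
  a product or of a composition is again made of functions that are k times differentiable.
\<close>

primrec diff_upto :: "nat \<Rightarrow> real set \<Rightarrow> (real \<Rightarrow> real) \<Rightarrow> bool" where
  "diff_upto 0 I f \<longleftrightarrow> True"
| "diff_upto (Suc k) I f \<longleftrightarrow>
    (\<exists>f'. (\<forall>t\<in>I. (f has_real_derivative f' t) (at t)) \<and> diff_upto k I f')"

lemma diff_upto_SucI:
  assumes "\<And>t. t \<in> I \<Longrightarrow> (f has_real_derivative f' t) (at t)" "diff_upto k I f'"
  shows "diff_upto (Suc k) I f"
  using assms by auto

lemma diff_upto_SucD: "diff_upto (Suc k) I f \<Longrightarrow> diff_upto k I f"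
  by (induction k arbitrary: f) auto

lemma diff_upto_cong:
  assumes "open I" "\<And>t. t \<in> I \<Longrightarrow> f t = g t" "diff_upto k I f"
  shows "diff_upto k I g"
proof (cases k)
  case (Suc m)
  then obtain f' where f': "\<forall>t\<in>I. (f has_real_derivative f' t) (at t)" "diff_upto m I f'"
    using assms(3) by auto
  have "(g has_real_derivative f' t) (at t)" if "t \<in> I" for t
    using has_field_derivative_transform_within_open[OF _ assms(1) that] f'(1) that assms(2)
    by blast
  then show ?thesis using f'(2) Suc by auto
qed auto

lemma smooth_real_on_deriv: "smooth_real_on I f \<Longrightarrow> smooth_real_on I (deriv f)"
  unfolding smooth_real_on_def
proof (intro allI ballI)
  fix k t assume "\<forall>k. \<forall>t\<in>I. (deriv ^^ k) f differentiable at t" "t \<in> I"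
  then have "(deriv ^^ Suc k) f differentiable at t" by blast
  then show "(deriv ^^ k) (deriv f) differentiable at t"
    by (simp add: funpow_swap1)
qed

lemma smooth_real_on_subset: "smooth_real_on I f \<Longrightarrow> J \<subseteq> I \<Longrightarrow> smooth_real_on J f"
  by (auto simp: smooth_real_on_def)

lemma smooth_real_on_local:
  assumes "\<And>t. t \<in> I \<Longrightarrow> \<exists>J. t \<in> J \<and> smooth_real_on J f"
  shows "smooth_real_on I f"
  using assms unfolding smooth_real_on_def by blast

lemma smooth_real_on_has_deriv:
  assumes "smooth_real_on I f" "t \<in> I"
  shows "(f has_real_derivative deriv f t) (at t)"
proof -
  have "f differentiable (at t)"
    using assms(2) assms(1)[unfolded smooth_real_on_def, rule_format, of t 0] by simp
  then show ?thesis using DERIV_imp_deriv by (auto simp: real_differentiable_def)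
qed

lemma smooth_real_on_isCont: "smooth_real_on I f \<Longrightarrow> t \<in> I \<Longrightarrow> isCont f t"
  using smooth_real_on_has_deriv DERIV_isCont by blast

lemma smooth_real_on_continuous_on: "smooth_real_on I f \<Longrightarrow> continuous_on I f"
  by (simp add: continuous_at_imp_continuous_on smooth_real_on_isCont)

lemma diff_upto_differentiable:
  assumes "open I" "diff_upto (Suc k) I f" "t \<in> I"
  shows "((deriv ^^ k) f) differentiable (at t)"
  using assms
proof (induction k arbitrary: f)
  case 0
  then show ?case by (auto simp: real_differentiable_def)
next
  case (Suc k)
  from Suc.prems obtain f' where
    f': "\<forall>t\<in>I. (f has_real_derivative f' t) (at t)" "diff_upto (Suc k) I f'"
    by (auto simp del: diff_upto.simps simp: diff_upto.simps(2)[of "Suc k"])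
  have "diff_upto (Suc k) I (deriv f)"
    by (rule diff_upto_cong[OF Suc.prems(1) _ f'(2)]) (use f'(1) in \<open>metis DERIV_imp_deriv\<close>)
  from Suc.IH[OF Suc.prems(1) this Suc.prems(3)] show ?case
    by (simp add: funpow_Suc_right del: funpow.simps)
qed

lemma smooth_real_on_iff_diff_upto:
  assumes "open I"
  shows "smooth_real_on I f \<longleftrightarrow> (\<forall>k. diff_upto k I f)"
proof
  assume "smooth_real_on I f"
  then have "diff_upto k I f" for k
  proof (induction k arbitrary: f)
    case (Suc k)
    then show ?case
      by (intro diff_upto_SucI[of I f "deriv f"] smooth_real_on_has_deriv[of I f]
          smooth_real_on_deriv Suc.IH)
  qed auto
  then show "\<forall>k. diff_upto k I f" by blast
next
  assume "\<forall>k. diff_upto k I f"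
  then show "smooth_real_on I f"
    using diff_upto_differentiable[OF assms] unfolding smooth_real_on_def by blast
qed

lemma smooth_real_on_cong:
  assumes "open I" "\<And>t. t \<in> I \<Longrightarrow> f t = g t" "smooth_real_on I f"
  shows "smooth_real_on I g"
  using assms(3) diff_upto_cong[of I f g, OF assms(1,2)] unfolding smooth_real_on_iff_diff_upto[OF assms(1)]
  by blast

text \<open>
  For the angles, which are given as integrals, and for the logarithm of the hyperbolic cosine.
\<close>

lemma smooth_real_on_antideriv:
  assumes "open I" "\<And>t. t \<in> I \<Longrightarrow> (f has_real_derivative f' t) (at t)" "smooth_real_on I f'"
  shows "smooth_real_on I f"
  unfolding smooth_real_on_iff_diff_upto[OF assms(1)]
proof
  fix k show "diff_upto k I f"
    using assms(2,3) unfolding smooth_real_on_iff_diff_upto[OF assms(1)] by (cases k) auto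
qed

lemma diff_upto_const: "diff_upto k I (\<lambda>_. b)"
proof (induction k arbitrary: b)
  case (Suc k)
  then show ?case by (intro diff_upto_SucI[where f' = "\<lambda>_. 0"]) auto
qed auto

lemma diff_upto_ident: "diff_upto k I (\<lambda>t. t)"
proof (cases k)
  case (Suc m)
  show ?thesis unfolding Suc
    by (rule diff_upto_SucI[where f' = "\<lambda>_. 1"]) (auto intro: diff_upto_const)
qed auto

lemma diff_upto_add: "diff_upto k I f \<Longrightarrow> diff_upto k I g \<Longrightarrow> diff_upto k I (\<lambda>t. f t + g t)"
proof (induction k arbitrary: f g)
  case (Suc k)
  then obtain f' g' where
    "\<forall>t\<in>I. (f has_real_derivative f' t) (at t)" "diff_upto k I f'"
    "\<forall>t\<in>I. (g has_real_derivative g' t) (at t)" "diff_upto k I g'" by auto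
  with Suc.IH[of f' g'] show ?case
    by (intro diff_upto_SucI[where f' = "\<lambda>t. f' t + g' t"]) (auto intro!: derivative_intros)
qed auto

lemma diff_upto_mult: "diff_upto k I f \<Longrightarrow> diff_upto k I g \<Longrightarrow> diff_upto k I (\<lambda>t. f t * g t)"
proof (induction k arbitrary: f g)
  case (Suc k)
  then obtain f' g' where
    fg: "\<forall>t\<in>I. (f has_real_derivative f' t) (at t)" "diff_upto k I f'"
    "\<forall>t\<in>I. (g has_real_derivative g' t) (at t)" "diff_upto k I g'" by auto
  have "diff_upto k I (\<lambda>t. f' t * g t + g' t * f t)"
    using fg Suc.IH diff_upto_SucD[OF Suc.prems(1)] diff_upto_SucD[OF Suc.prems(2)]
    by (intro diff_upto_add) auto
  with fg show ?case
    by (intro diff_upto_SucI[where f' = "\<lambda>t. f' t * g t + g' t * f t"]) (auto intro!: DERIV_mult)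
qed auto

lemma diff_upto_compose:
  "diff_upto k J h \<Longrightarrow> diff_upto k I f \<Longrightarrow> f ` I \<subseteq> J \<Longrightarrow> diff_upto k I (\<lambda>t. h (f t))"
proof (induction k arbitrary: h f)
  case (Suc k)
  then obtain f' h' where
    fh: "\<forall>t\<in>I. (f has_real_derivative f' t) (at t)" "diff_upto k I f'"
    "\<forall>t\<in>J. (h has_real_derivative h' t) (at t)" "diff_upto k J h'" by auto
  have "diff_upto k I (\<lambda>t. h' (f t) * f' t)"
    using fh Suc.IH diff_upto_SucD[OF Suc.prems(2)] Suc.prems(3)
    by (intro diff_upto_mult) auto
  moreover have "((\<lambda>t. h (f t)) has_real_derivative h' (f t) * f' t) (at t)" if "t \<in> I" for t
    using fh Suc.prems(3) that by (intro DERIV_chain2) auto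
  ultimately show ?case by (rule diff_upto_SucI[rotated])
qed auto

lemma smooth_real_on_const: "open I \<Longrightarrow> smooth_real_on I (\<lambda>_. b)"
  and smooth_real_on_ident: "open I \<Longrightarrow> smooth_real_on I (\<lambda>t. t)"
  and smooth_real_on_add:
    "open I \<Longrightarrow> smooth_real_on I f \<Longrightarrow> smooth_real_on I g \<Longrightarrow> smooth_real_on I (\<lambda>t. f t + g t)"
  and smooth_real_on_mult:
    "open I \<Longrightarrow> smooth_real_on I f \<Longrightarrow> smooth_real_on I g \<Longrightarrow> smooth_real_on I (\<lambda>t. f t * g t)"
  by (simp_all add: smooth_real_on_iff_diff_upto diff_upto_const diff_upto_ident diff_upto_add
      diff_upto_mult)

lemma smooth_real_on_compose:
  assumes "smooth_real_on J h" "open J" "open I" "smooth_real_on I f" "\<And>t. t \<in> I \<Longrightarrow> f t \<in> J"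
  shows "smooth_real_on I (\<lambda>t. h (f t))"
  using assms(1,4,5) diff_upto_compose[of _ J h I f]
  unfolding smooth_real_on_iff_diff_upto[OF assms(2)] smooth_real_on_iff_diff_upto[OF assms(3)]
  by blast

lemma smooth_real_on_compose_UNIV:
  "smooth_real_on UNIV h \<Longrightarrow> open I \<Longrightarrow> smooth_real_on I f \<Longrightarrow> smooth_real_on I (\<lambda>t. h (f t))"
  by (rule smooth_real_on_compose[of UNIV]) auto

lemma smooth_real_on_minus:
  assumes "open I" "smooth_real_on I f" shows "smooth_real_on I (\<lambda>t. - f t)"
  using smooth_real_on_mult[OF assms(1) smooth_real_on_const[OF assms(1), of "-1"] assms(2)]
  by simp

lemma smooth_real_on_diff:
  assumes "open I" "smooth_real_on I f" "smooth_real_on I g"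
  shows "smooth_real_on I (\<lambda>t. f t - g t)"
  using smooth_real_on_add[OF assms(1,2) smooth_real_on_minus[OF assms(1,3)]] by simp

lemma smooth_real_on_sum:
  assumes "open I" "\<And>j. j \<in> S \<Longrightarrow> smooth_real_on I (f j)"
  shows "smooth_real_on I (\<lambda>t. \<Sum>j\<in>S. f j t)"
proof (cases "finite S")
  case True
  then show ?thesis using assms(2)
    by (induction S) (auto intro: smooth_real_on_const smooth_real_on_add assms(1))
qed (auto intro: smooth_real_on_const assms(1))

lemma smooth_real_on_power:
  assumes "open I" "smooth_real_on I f" shows "smooth_real_on I (\<lambda>t. f t ^ k)"
  by (induction k) (auto intro: smooth_real_on_const smooth_real_on_mult assms)

lemma diff_upto_inverse: "diff_upto k (- {0}) inverse"
proof (induction k)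
  case (Suc k)
  have "diff_upto k (- {0}) (\<lambda>t. (-1) * (inverse t * inverse t))"
    by (intro diff_upto_mult diff_upto_const Suc)
  then show ?case
    by (rule diff_upto_SucI[rotated]) (auto intro!: derivative_eq_intros simp: power2_eq_square)
qed auto

lemma smooth_real_on_divide:
  assumes "open I" "smooth_real_on I f" "smooth_real_on I g" "\<And>t. t \<in> I \<Longrightarrow> g t \<noteq> 0"
  shows "smooth_real_on I (\<lambda>t. f t / g t)"
proof -
  have "smooth_real_on I (\<lambda>t. inverse (g t))"
    by (rule smooth_real_on_compose[of "- {0}" inverse])
      (use assms in \<open>auto simp: smooth_real_on_iff_diff_upto diff_upto_inverse open_Compl\<close>)
  then show ?thesis using smooth_real_on_mult[OF assms(1,2)] by (simp add: divide_inverse)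
qed

lemma diff_upto_sqrt: "diff_upto k {0<..} sqrt"
proof (induction k)
  case (Suc k)
  have "diff_upto k {0<..} (\<lambda>t. inverse (sqrt t))"
    by (rule diff_upto_compose[OF diff_upto_inverse Suc]) auto
  then have "diff_upto k {0<..} (\<lambda>t. inverse (sqrt t) * (1 / 2))"
    by (intro diff_upto_mult diff_upto_const)
  then show ?case
    by (rule diff_upto_SucI[rotated]) (auto intro!: derivative_eq_intros)
qed auto

lemma smooth_real_on_sqrt:
  assumes "open I" "smooth_real_on I f" "\<And>t. t \<in> I \<Longrightarrow> 0 < f t"
  shows "smooth_real_on I (\<lambda>t. sqrt (f t))"
  by (rule smooth_real_on_compose[of "{0<..}" sqrt])
    (use assms in \<open>auto simp: smooth_real_on_iff_diff_upto diff_upto_sqrt\<close>)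

lemma diff_upto_sin_cos: "diff_upto k I sin \<and> diff_upto k I cos"
proof (induction k)
  case (Suc k)
  have "diff_upto k I (\<lambda>t. (-1) * sin t)"
    by (intro diff_upto_mult diff_upto_const Suc[THEN conjunct1])
  then show ?case using Suc
    by (intro conjI diff_upto_SucI[of I sin cos] diff_upto_SucI[of I cos "\<lambda>t. (-1) * sin t"])
      (auto intro!: derivative_eq_intros)
qed auto

lemma smooth_real_on_sin: "open I \<Longrightarrow> smooth_real_on I sin"
  and smooth_real_on_cos: "open I \<Longrightarrow> smooth_real_on I cos"
  by (simp_all add: smooth_real_on_iff_diff_upto diff_upto_sin_cos)

lemma diff_upto_sinh_cosh: "diff_upto k I (sinh :: real \<Rightarrow> real) \<and> diff_upto k I cosh"
proof (induction k)
  case (Suc k)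
  then show ?case
    by (intro conjI diff_upto_SucI[of I sinh cosh] diff_upto_SucI[of I cosh sinh])
      (auto intro!: derivative_eq_intros)
qed auto

lemma smooth_real_on_sinh: "open I \<Longrightarrow> smooth_real_on I sinh"
  and smooth_real_on_cosh: "open I \<Longrightarrow> smooth_real_on I cosh"
  by (simp_all add: smooth_real_on_iff_diff_upto diff_upto_sinh_cosh)

lemma smooth_real_on_sum_squares:
  assumes "open I" "finite S" "\<And>j. j \<in> S \<Longrightarrow> smooth_real_on I (f j)"
  shows "smooth_real_on I (\<lambda>t. \<Sum>j\<in>S. (f j t)\<^sup>2)"
    and "t \<in> I \<Longrightarrow> ((\<lambda>t. \<Sum>j\<in>S. (f j t)\<^sup>2) has_real_derivative 2 * (\<Sum>j\<in>S. f j t * deriv (f j) t)) (at t)"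
proof -
  show "smooth_real_on I (\<lambda>t. \<Sum>j\<in>S. (f j t)\<^sup>2)"
    by (intro smooth_real_on_sum smooth_real_on_power assms)
  assume t: "t \<in> I"
  have "((\<lambda>t. \<Sum>j\<in>S. (f j t)\<^sup>2) has_real_derivative (\<Sum>j\<in>S. 2 * (f j t * deriv (f j) t))) (at t)"
  proof (rule DERIV_sum)
    fix j assume "j \<in> S"
    from smooth_real_on_has_deriv[OF assms(3)[OF this] t]
    show "((\<lambda>t. (f j t)\<^sup>2) has_real_derivative 2 * (f j t * deriv (f j) t)) (at t)"
      by (auto intro!: derivative_eq_intros)
  qed
  then show "((\<lambda>t. \<Sum>j\<in>S. (f j t)\<^sup>2) has_real_derivative 2 * (\<Sum>j\<in>S. f j t * deriv (f j) t)) (at t)"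
    by (simp add: sum_distrib_left)
qed

section \<open>Cutoffs, frequencies and amplitudes\<close>

text \<open>
  The derivative of each member of this family is a linear combination of members, so that the whole family
  is smooth by one induction on the order; \<^const>\<open>flat_exp\<close> is the member with k = 0.
\<close>

definition flat_exp_pow :: "nat \<Rightarrow> real \<Rightarrow> real" where
  "flat_exp_pow k s = (if s \<le> 0 then 0 else inverse s ^ k * exp (- 1 / s))"

lemma flat_exp_pow_tendsto_0: "(flat_exp_pow k \<longlongrightarrow> 0) (at 0)"
proof -
  have "((\<lambda>s::real. inverse s ^ k / exp (inverse s)) \<longlongrightarrow> 0) (at_right 0)"
    by (rule filterlim_compose[OF tendsto_power_div_exp_0 filterlim_inverse_at_top_right])
  moreover have "eventually (\<lambda>s. inverse s ^ k / exp (inverse s) = flat_exp_pow k s) (at_right 0)"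
    unfolding eventually_at_right_field
    by (auto intro!: exI[of _ 1] simp: flat_exp_pow_def exp_minus field_simps)
  ultimately have "(flat_exp_pow k \<longlongrightarrow> 0) (at_right 0)"
    using tendsto_cong by fastforce
  moreover have "eventually (\<lambda>s. flat_exp_pow k s = 0) (at_left 0)"
    unfolding eventually_at_left_field by (auto intro!: exI[of _ "-1"] simp: flat_exp_pow_def)
  then have "(flat_exp_pow k \<longlongrightarrow> 0) (at_left 0)" by (rule tendsto_eventually)
  ultimately show ?thesis using filterlim_split_at_real by blast
qed

text \<open>
  At 0 the difference quotient of the k-th member is the member k + 1, which tends to 0.
\<close>

lemma flat_exp_pow_has_deriv:
  "(flat_exp_pow k has_real_derivative - real k * flat_exp_pow (k + 1) s + flat_exp_pow (k + 2) s)
    (at s)"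
proof (cases s "0 :: real" rule: linorder_cases)
  case less
  have "((\<lambda>_. 0) has_real_derivative 0) (at s)" by simp
  then have "(flat_exp_pow k has_real_derivative 0) (at s)"
    by (rule has_field_derivative_transform_within_open[where S = "{..<0}"])
      (use less in \<open>auto simp: flat_exp_pow_def\<close>)
  then show ?thesis using less by (simp add: flat_exp_pow_def)
next
  case equal
  have "((\<lambda>h. (flat_exp_pow k (0 + h) - flat_exp_pow k 0) / h) \<longlongrightarrow> 0) (at 0)"
  proof (rule Lim_transform_eventually[OF flat_exp_pow_tendsto_0[of "k + 1"]])
    show "eventually (\<lambda>h. flat_exp_pow (k + 1) h = (flat_exp_pow k (0 + h) - flat_exp_pow k 0) / h) (at 0)"
      by (auto simp: eventually_at flat_exp_pow_def field_simps intro!: exI[of _ 1])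
  qed
  then show ?thesis unfolding equal DERIV_def by (simp add: flat_exp_pow_def)
next
  case greater
  have "real k * inverse s ^ (k - 1) * inverse s = real k * inverse s ^ k"
    by (cases k) auto
  then have "((\<lambda>s. inverse s ^ k * exp (- 1 / s)) has_real_derivative
      - real k * flat_exp_pow (k + 1) s + flat_exp_pow (k + 2) s) (at s)"
    using greater
    by (auto intro!: derivative_eq_intros simp: flat_exp_pow_def power2_eq_square divide_inverse
        algebra_simps)
  then show ?thesis
    by (rule has_field_derivative_transform_within_open[where S = "{0<..}"])
      (use greater in \<open>auto simp: flat_exp_pow_def\<close>)
qed

lemma smooth_flat_exp: "smooth_real_on UNIV flat_exp"
proof -
  have "diff_upto m UNIV (flat_exp_pow k)" for m k
  proof (induction m arbitrary: k)
    case (Suc m)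
    have "diff_upto m UNIV (\<lambda>s. - real k * flat_exp_pow (k + 1) s + flat_exp_pow (k + 2) s)"
      by (intro diff_upto_add diff_upto_mult diff_upto_const Suc)
    then show ?case by (rule diff_upto_SucI[rotated]) (rule flat_exp_pow_has_deriv)
  qed auto
  moreover have "flat_exp = flat_exp_pow 0"
    by (auto simp: flat_exp_def flat_exp_pow_def)
  ultimately show ?thesis using smooth_real_on_iff_diff_upto[OF open_UNIV] by metis
qed

lemma smooth_smooth_step: "smooth_real_on UNIV smooth_step"
proof -
  have pos: "flat_exp (s - 1/4) + flat_exp (3/4 - s) > 0" for s
    by (auto simp: flat_exp_def add_pos_pos)
  have "smooth_real_on UNIV (\<lambda>s. flat_exp (s - 1/4) / (flat_exp (s - 1/4) + flat_exp (3/4 - s)))"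
    by (intro smooth_real_on_divide smooth_real_on_add smooth_real_on_compose_UNIV[OF smooth_flat_exp]
        smooth_real_on_diff smooth_real_on_ident smooth_real_on_const open_UNIV) (metis pos less_irrefl)
  then show ?thesis by (simp add: smooth_step_def[abs_def])
qed

lemma smooth_step_0: "s \<le> 1/4 \<Longrightarrow> smooth_step s = 0"
  and smooth_step_1: "3/4 \<le> s \<Longrightarrow> smooth_step s = 1"
  by (auto simp: smooth_step_def flat_exp_def)

text \<open>
  The formula for one stair remains valid on a margin of length 1/4 beyond its ends, where the step is
  constant.  The enlarged stairs are open and cover the line, so smoothness is clear also at the
  integers.
\<close>

lemma staircase_eq:
  assumes "of_int m - 1/4 < s" "s < of_int m + 5/4"
  shows "staircase s = pi / 2 * (of_int m + smooth_step (s - of_int m))"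
proof -
  consider "s < of_int m" | "of_int m \<le> s" "s < of_int m + 1" | "of_int m + 1 \<le> s" by linarith
  then show ?thesis
  proof cases
    case 1
    then have "\<lfloor>s\<rfloor> = m - 1" using assms by (intro floor_unique) auto
    then show ?thesis using 1 assms by (simp add: staircase_def smooth_step_0 smooth_step_1)
  next
    case 2
    then have "\<lfloor>s\<rfloor> = m" by (intro floor_unique) auto
    then show ?thesis by (simp add: staircase_def)
  next
    case 3
    then have "\<lfloor>s\<rfloor> = m + 1" using assms by (intro floor_unique) auto
    then show ?thesis using 3 assms by (simp add: staircase_def smooth_step_0 smooth_step_1)
  qed
qed

lemma smooth_staircase: "smooth_real_on UNIV staircase"
proof (rule smooth_real_on_local)
  fix s :: real
  define m where "m = \<lfloor>s\<rfloor>"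
  let ?J = "{of_int m - 1/4 <..< of_int m + 5/4 :: real}"
  have "smooth_real_on ?J (\<lambda>s. pi / 2 * (of_int m + smooth_step (s - of_int m)))"
    by (intro smooth_real_on_mult smooth_real_on_add smooth_real_on_const smooth_real_on_diff
        smooth_real_on_compose_UNIV[OF smooth_smooth_step] smooth_real_on_ident open_greaterThanLessThan)
  then have "smooth_real_on ?J staircase"
    by (rule smooth_real_on_cong[rotated 2]) (auto simp: staircase_eq)
  moreover have "s \<in> ?J" unfolding m_def by (auto simp: field_simps) linarith+
  ultimately show "\<exists>J. s \<in> J \<and> smooth_real_on J staircase" by blast
qed

lemma smooth_cutoff: "smooth_real_on UNIV (cutoff i)"
  using smooth_real_on_compose_UNIV[OF smooth_real_on_sin[OF open_UNIV] open_UNIV smooth_staircase]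
    smooth_real_on_compose_UNIV[OF smooth_real_on_cos[OF open_UNIV] open_UNIV smooth_staircase]
  by (cases "i = 0") (simp_all add: cutoff_def[abs_def])

text \<open>
  The points \<open>i + 2 k\<close> are the values of \<^const>\<open>param\<close> where the frequency with index i may jump.
\<close>

lemma cutoff_vanishes:
  assumes "i \<in> {0, 1}" "\<bar>s - (real i + 2 * of_int k)\<bar> < 1/4"
  shows "cutoff i s = 0"
proof -
  have "real_of_int (int i + 2 * k) = real i + 2 * of_int k" by simp
  then have near: "\<bar>s - of_int (int i + 2 * k)\<bar> < 1/4" using assms(2) by simp
  have "staircase s = pi / 2 * (of_int (int i + 2 * k) + smooth_step (s - of_int (int i + 2 * k)))"
    by (rule staircase_eq) (use near in linarith)+
  also have "smooth_step (s - of_int (int i + 2 * k)) = 0"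
    by (rule smooth_step_0) (use near in linarith)
  finally have st: "staircase s = pi / 2 * real i + pi * of_int k" by (simp add: field_simps)
  have "sin (pi * of_int k) = 0" by (metis mult.commute sin_int_times_real sin_npi_int)
  then show ?thesis using assms(1) by (auto simp: cutoff_def st cos_add)
qed

lemma cutoff_sum_squares: "(cutoff 0 s)\<^sup>2 + (cutoff (Suc 0) s)\<^sup>2 = 1"
  by (simp add: cutoff_def)

lemma abs_cutoff_le_1: "\<bar>cutoff i s\<bar> \<le> 1"
  by (simp add: cutoff_def abs_sin_le_one abs_cos_le_one)

locale warped_data =
  fixes n :: nat and I :: "real set" and \<rho> :: "real \<Rightarrow> real" and \<eta> :: "nat \<Rightarrow> real \<Rightarrow> real"
  assumes n: "1 \<le> n"
    and open_I: "open I" and interval_I: "is_interval I" and nonempty_I: "I \<noteq> {}"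
    and smooth_\<rho>: "smooth_real_on I \<rho>" and \<rho>_pos: "\<And>t. t \<in> I \<Longrightarrow> 0 < \<rho> t"
    and smooth_\<eta>: "\<And>j. j \<in> {1..<n} \<Longrightarrow> smooth_real_on I (\<eta> j)"
    and \<eta>_pos: "\<And>j t. j \<in> {1..<n} \<Longrightarrow> t \<in> I \<Longrightarrow> 0 < \<eta> j t"
begin

lemma mem_I_iff: "t \<in> I \<longleftrightarrow> (bdd_below I \<longrightarrow> Inf I < t) \<and> (bdd_above I \<longrightarrow> t < Sup I)"
proof
  assume t: "t \<in> I"
  then obtain e where e: "e > 0" "ball t e \<subseteq> I" using open_I open_contains_ball by blast
  \<comment> \<open>Points of I on both sides of t exclude that t is an end of I.\<close>
  have "t - e/2 \<in> I" "t + e/2 \<in> I" using e by (auto simp: dist_real_def intro!: subsetD[OF e(2)])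
  then show "(bdd_below I \<longrightarrow> Inf I < t) \<and> (bdd_above I \<longrightarrow> t < Sup I)"
    using cInf_lower[of "t - e/2" I] cSup_upper[of "t + e/2" I] e(1) by auto
next
  assume t: "(bdd_below I \<longrightarrow> Inf I < t) \<and> (bdd_above I \<longrightarrow> t < Sup I)"
  have "\<exists>l\<in>I. l < t"
    using t nonempty_I cInf_less_iff[of I t] by (cases "bdd_below I") (auto simp: bdd_below_def not_le)
  moreover have "\<exists>u\<in>I. t < u"
    using t nonempty_I less_cSup_iff[of I t] by (cases "bdd_above I") (auto simp: bdd_above_def not_le)
  ultimately show "t \<in> I" using interval_I mem_is_interval_1_I by (metis less_imp_le)
qed

lemma base_mem: "base I \<in> I"
proof -
  obtain t where "t \<in> I" using nonempty_I by blast
  then show ?thesis unfolding mem_I_iff by (auto simp: base_def)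
qed

lemma smooth_param: "smooth_real_on I (param I)"
proof -
  have "smooth_real_on I (\<lambda>t. if bdd_above I then 1 / (Sup I - t) else t)"
    by (cases "bdd_above I")
      (auto simp: mem_I_iff intro!: smooth_real_on_divide smooth_real_on_diff smooth_real_on_const
        smooth_real_on_ident open_I)
  moreover have "smooth_real_on I (\<lambda>t. if bdd_below I then 1 / (Inf I - t) else t)"
    by (cases "bdd_below I")
      (auto simp: mem_I_iff intro!: smooth_real_on_divide smooth_real_on_diff smooth_real_on_const
        smooth_real_on_ident open_I)
  ultimately show ?thesis
    unfolding param_def[abs_def] by (rule smooth_real_on_add[OF open_I])
qed

lemma param_summands_mono:
  assumes "s \<in> I" "t \<in> I" "s < t"
  shows "(if bdd_above I then 1 / (Sup I - s) else s) < (if bdd_above I then 1 / (Sup I - t) else t)"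
    and "(if bdd_below I then 1 / (Inf I - s) else s) < (if bdd_below I then 1 / (Inf I - t) else t)"
  using assms by (auto simp: mem_I_iff field_simps)

lemma param_less: "s \<in> I \<Longrightarrow> t \<in> I \<Longrightarrow> s < t \<Longrightarrow> param I s < param I t"
  unfolding param_def by (intro add_strict_mono param_summands_mono)

lemma param_le_iff: "s \<in> I \<Longrightarrow> t \<in> I \<Longrightarrow> param I s \<le> param I t \<longleftrightarrow> s \<le> t"
  by (metis linorder_not_le nle_le order_less_le param_less)

text \<open>
  Both summands of \<^const>\<open>param\<close> are increasing, and one of them is unbounded towards the given end of I.
  Beyond the base point the other one is at least as favourable as there, so it suffices that the unbounded
  one passes a large bound d in absolute value.
\<close>

lemma param_unbounded:
  shows "\<exists>t\<in>I. b \<le> param I t" and "\<exists>t\<in>I. param I t \<le> b"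
proof -
  let ?t0 = "base I"
  define P where "P t = (if bdd_above I then 1 / (Sup I - t) else t)" for t
  define Q where "Q t = (if bdd_below I then 1 / (Inf I - t) else t)" for t
  have t0: "bdd_below I \<longrightarrow> Inf I < ?t0" "bdd_above I \<longrightarrow> ?t0 < Sup I"
    using base_mem mem_I_iff by auto
  define d where "d = \<bar>b\<bar> + \<bar>P ?t0\<bar> + \<bar>Q ?t0\<bar> + 1"
  have d: "d > 0" "b \<le> d + Q ?t0" "P ?t0 - d \<le> b" by (auto simp: d_def)
  show "\<exists>t\<in>I. b \<le> param I t"
  proof -
    define t where "t = (if bdd_above I then max ?t0 (Sup I - 1 / d) else max ?t0 d)"
    have "t \<in> I" using t0 d unfolding mem_I_iff t_def by auto
    moreover have "d \<le> P t"
    proof (cases "bdd_above I")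
      case True
      then have "Sup I - t > 0" "Sup I - t \<le> 1 / d" using t0 d by (auto simp: t_def)
      then show ?thesis using True d(1) by (simp add: P_def field_simps)
    qed (simp add: P_def t_def)
    moreover have "?t0 \<le> t" by (simp add: t_def)
    then have "Q ?t0 \<le> Q t"
      using param_summands_mono(2)[OF base_mem \<open>t \<in> I\<close>] unfolding Q_def by (cases "t = ?t0") auto
    ultimately show ?thesis using d by (intro bexI[of _ t]) (auto simp: param_def P_def Q_def)
  qed
  show "\<exists>t\<in>I. param I t \<le> b"
  proof -
    define t where "t = (if bdd_below I then min ?t0 (Inf I + 1 / d) else min ?t0 (- d))"
    have "t \<in> I" using t0 d unfolding mem_I_iff t_def by auto
    moreover have "Q t \<le> - d"
    proof (cases "bdd_below I")
      case True
      then have "t - Inf I > 0" "t - Inf I \<le> 1 / d" using t0 d by (auto simp: t_def)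
      then show ?thesis using True d(1) by (simp add: Q_def field_simps)
    qed (simp add: Q_def t_def)
    moreover have "t \<le> ?t0" by (simp add: t_def)
    then have "P t \<le> P ?t0"
      using param_summands_mono(1)[OF \<open>t \<in> I\<close> base_mem] unfolding P_def by (cases "t = ?t0") auto
    ultimately show ?thesis using d by (intro bexI[of _ t]) (auto simp: param_def P_def Q_def)
  qed
qed

text \<open>
  Because \<^const>\<open>param\<close> is an increasing bijection onto the real line, the bounded interval of its values
  on a block pulls back to a compact subinterval of I.
\<close>

lemma block_subset_compact: "\<exists>l u. {l..u} \<subseteq> I \<and> block I i t \<subseteq> {l..u}"
proof -
  define m where "m = \<lfloor>(param I t - real i) / 2\<rfloor>"
  obtain l u where lu: "l \<in> I" "param I l \<le> real i + 2 * of_int m"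
    "u \<in> I" "real i + 2 * of_int m + 2 \<le> param I u"
    using param_unbounded by metis
  have "{l..u} \<subseteq> I" using lu interval_I mem_is_interval_1_I by (metis atLeastAtMost_iff subsetI)
  moreover have "s \<in> {l..u}" if s: "s \<in> block I i t" for s
  proof -
    have "s \<in> I" "\<lfloor>(param I s - real i) / 2\<rfloor> = m" using s by (auto simp: block_def m_def)
    then have "of_int m \<le> (param I s - real i) / 2" "(param I s - real i) / 2 < of_int m + 1"
      by linarith+
    then have "param I l \<le> param I s" "param I s \<le> param I u" using lu by (simp_all add: field_simps)
    then show ?thesis using param_le_iff lu \<open>s \<in> I\<close> by simp
  qed
  ultimately show ?thesis by blast
qed

lemma smooth_cut_\<eta>: "j \<in> {1..<n} \<Longrightarrow> smooth_real_on I (\<lambda>u. \<eta> j u * cutoff i (param I u))"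
  by (intro smooth_real_on_mult open_I smooth_\<eta> smooth_real_on_compose_UNIV[OF smooth_cutoff] smooth_param)

text \<open>
  The supremum that defines the frequency is that of a continuous function on a subset of a compact
  interval, hence finite, and t lies in its own block.
\<close>

lemma frequency_ge:
  assumes j: "j \<in> {1..<n}" and t: "t \<in> I"
  shows "1 + 2 * real n * (\<bar>deriv (\<lambda>u. \<eta> j u * cutoff i (param I u)) t\<bar> / \<rho> t + sqrt \<kappa> * \<eta> j t)
    \<le> frequency n I \<rho> \<eta> \<kappa> j i t"
proof -
  let ?F = "\<lambda>s. 2 * real n *
    (\<bar>deriv (\<lambda>u. \<eta> j u * cutoff i (param I u)) s\<bar> / \<rho> s + sqrt \<kappa> * \<eta> j s)"
  obtain l u where lu: "{l..u} \<subseteq> I" "block I i t \<subseteq> {l..u}" using block_subset_compact by blast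
  have "continuous_on I ?F"
    by (intro continuous_intros smooth_real_on_continuous_on smooth_real_on_deriv smooth_cut_\<eta> j
        smooth_\<rho> smooth_\<eta>) (use \<rho>_pos in force)
  then have "compact (?F ` {l..u})"
    using lu(1) continuous_on_subset by (intro compact_continuous_image) auto
  then have "bdd_above (?F ` block I i t)"
    using lu(2) by (meson bounded_imp_bdd_above bdd_above_mono compact_imp_bounded image_mono)
  moreover have "t \<in> block I i t" using t by (simp add: block_def)
  ultimately show ?thesis
    unfolding frequency_def using cSUP_upper[of t "block I i t" ?F] by auto
qed

lemma frequency_pos:
  assumes "j \<in> {1..<n}" "t \<in> I" "0 \<le> \<kappa>"
  shows "0 < frequency n I \<rho> \<eta> \<kappa> j i t"
proof -
  have "0 \<le> 2 * real n * (\<bar>deriv (\<lambda>u. \<eta> j u * cutoff i (param I u)) t\<bar> / \<rho> t + sqrt \<kappa> * \<eta> j t)"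
    using assms \<rho>_pos[of t] \<eta>_pos[of j t]
    by (intro mult_nonneg_nonneg add_nonneg_nonneg divide_nonneg_nonneg) auto
  then show ?thesis using frequency_ge[OF assms(1,2), of i \<kappa>] by linarith
qed

text \<open>
  Away from the jumps the floor in the definition of the blocks is constant near t; at a jump the
  cutoff vanishes near t.
\<close>

lemma frequency_locally_constant:
  assumes i: "i \<in> {0, 1}" and t: "t \<in> I"
  obtains J where "open J" "t \<in> J" "J \<subseteq> I"
    "\<And>s. s \<in> J \<Longrightarrow> (\<forall>\<kappa> j. frequency n I \<rho> \<eta> \<kappa> j i s = frequency n I \<rho> \<eta> \<kappa> j i t)
      \<or> cutoff i (param I s) = 0"
proof -
  have openI: "open {s\<in>I. x < param I s \<and> param I s < y}" for x y
    using continuous_open_preimage[OF smooth_real_on_continuous_on[OF smooth_param] open_I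
        open_greaterThanLessThan[of x y]]
    by (simp add: vimage_def Int_def conj_ac)
  define m where "m = \<lfloor>(param I t - real i) / 2\<rfloor>"
  have m: "real i + 2 * of_int m \<le> param I t" "param I t < real i + 2 * of_int m + 2"
    using floor_correct[of "(param I t - real i) / 2"] unfolding m_def by (simp_all add: field_simps)
  show thesis
  proof (cases "param I t = real i + 2 * of_int m")
    case True
    have "cutoff i (param I s) = 0"
      if "param I t - 1/4 < param I s" "param I s < param I t + 1/4" for s
      by (rule cutoff_vanishes[OF i, of _ m]) (use that True in linarith)
    then show thesis
      using openI[of "param I t - 1/4" "param I t + 1/4"] t
      by (intro that[of "{s\<in>I. param I t - 1/4 < param I s \<and> param I s < param I t + 1/4}"]) auto
  next
    case False
    have "frequency n I \<rho> \<eta> \<kappa> j i s = frequency n I \<rho> \<eta> \<kappa> j i t"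
      if "real i + 2 * of_int m < param I s" "param I s < real i + 2 * of_int m + 2" for s \<kappa> j
    proof -
      have "\<lfloor>(param I s - real i) / 2\<rfloor> = m" using that by (intro floor_unique) auto
      then have "block I i s = block I i t" by (simp add: block_def m_def)
      then show ?thesis by (simp add: frequency_def)
    qed
    then have "(\<forall>\<kappa> j. frequency n I \<rho> \<eta> \<kappa> j i s = frequency n I \<rho> \<eta> \<kappa> j i t) \<or> cutoff i (param I s) = 0"
      if "s \<in> {s\<in>I. real i + 2 * of_int m < param I s \<and> param I s < real i + 2 * of_int m + 2}" for s
      using that by blast
    moreover have "t \<in> {s\<in>I. real i + 2 * of_int m < param I s \<and> param I s < real i + 2 * of_int m + 2}"
      using t m False by simp
    ultimately show thesis by (intro that[OF openI]) blast+
  qed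
qed

text \<open>
  Near t the frequency may be frozen at its value in t, both in the amplitude and in any expression
  \<open>h(\<omega>)\<close> multiplied by the amplitude: where the frequency jumps, both sides are 0.
\<close>

lemma amplitude_locally:
  assumes i: "i \<in> {0, 1}" and t: "t \<in> I"
  obtains J where "open J" "t \<in> J" "J \<subseteq> I"
    "\<And>s \<kappa> j. s \<in> J \<Longrightarrow> amplitude n I \<rho> \<eta> \<kappa> j i s =
      \<eta> j s * cutoff i (param I s) / frequency n I \<rho> \<eta> \<kappa> j i t"
    "\<And>s \<kappa> j h. s \<in> J \<Longrightarrow> amplitude n I \<rho> \<eta> \<kappa> j i s * h (frequency n I \<rho> \<eta> \<kappa> j i s) =
      amplitude n I \<rho> \<eta> \<kappa> j i s * (h (frequency n I \<rho> \<eta> \<kappa> j i t) :: real)"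
proof -
  obtain J where "open J" "t \<in> J" "J \<subseteq> I"
    and J: "\<And>s. s \<in> J \<Longrightarrow> (\<forall>\<kappa> j. frequency n I \<rho> \<eta> \<kappa> j i s = frequency n I \<rho> \<eta> \<kappa> j i t)
      \<or> cutoff i (param I s) = 0"
    using frequency_locally_constant[OF assms] by metis
  show thesis
  proof (rule that[of J])
    fix s \<kappa> j and h :: "real \<Rightarrow> real"
    assume "s \<in> J"
    from J[OF this] show "amplitude n I \<rho> \<eta> \<kappa> j i s = \<eta> j s * cutoff i (param I s) / frequency n I \<rho> \<eta> \<kappa> j i t"
      "amplitude n I \<rho> \<eta> \<kappa> j i s * h (frequency n I \<rho> \<eta> \<kappa> j i s) =
        amplitude n I \<rho> \<eta> \<kappa> j i s * h (frequency n I \<rho> \<eta> \<kappa> j i t)"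
      unfolding amplitude_def by force+
  qed fact+
qed

lemma amplitude_smooth_and_deriv:
  assumes i: "i \<in> {0, 1}" and j: "j \<in> {1..<n}" and \<kappa>: "0 \<le> \<kappa>"
  shows smooth_amplitude: "smooth_real_on I (amplitude n I \<rho> \<eta> \<kappa> j i)"
    and deriv_amplitude: "t \<in> I \<Longrightarrow> deriv (amplitude n I \<rho> \<eta> \<kappa> j i) t =
      deriv (\<lambda>u. \<eta> j u * cutoff i (param I u)) t / frequency n I \<rho> \<eta> \<kappa> j i t"
proof -
  have *: "\<exists>J. open J \<and> t \<in> J \<and> smooth_real_on J (amplitude n I \<rho> \<eta> \<kappa> j i) \<and>
      deriv (amplitude n I \<rho> \<eta> \<kappa> j i) t =
        deriv (\<lambda>u. \<eta> j u * cutoff i (param I u)) t / frequency n I \<rho> \<eta> \<kappa> j i t" if t: "t \<in> I" for t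
  proof -
    let ?w = "frequency n I \<rho> \<eta> \<kappa> j i t"
    obtain J where J: "open J" "t \<in> J" "J \<subseteq> I" and eq: "\<And>s. s \<in> J \<Longrightarrow>
        amplitude n I \<rho> \<eta> \<kappa> j i s = \<eta> j s * cutoff i (param I s) / ?w"
      using amplitude_locally[OF i t] by metis
    have sm: "smooth_real_on J (\<lambda>u. \<eta> j u * cutoff i (param I u) / ?w)"
      using frequency_pos[OF j t \<kappa>, of i]
      by (intro smooth_real_on_divide J smooth_real_on_const
          smooth_real_on_subset[OF smooth_cut_\<eta>[OF j] J(3)]) auto
    then have "smooth_real_on J (amplitude n I \<rho> \<eta> \<kappa> j i)"
      by (rule smooth_real_on_cong[rotated 2]) (auto simp: J eq)
    moreover have "((\<lambda>u. \<eta> j u * cutoff i (param I u) / ?w) has_real_derivative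
        deriv (\<lambda>u. \<eta> j u * cutoff i (param I u)) t / ?w) (at t)"
      by (intro DERIV_cdivide smooth_real_on_has_deriv[OF smooth_cut_\<eta>[OF j] t])
    then have "(amplitude n I \<rho> \<eta> \<kappa> j i has_real_derivative
        deriv (\<lambda>u. \<eta> j u * cutoff i (param I u)) t / ?w) (at t)"
      by (rule has_field_derivative_transform_within_open[OF _ J(1,2)]) (simp add: eq)
    ultimately show ?thesis using J DERIV_imp_deriv by blast
  qed
  show "smooth_real_on I (amplitude n I \<rho> \<eta> \<kappa> j i)"
    by (rule smooth_real_on_local) (use * in blast)
  show "t \<in> I \<Longrightarrow> deriv (amplitude n I \<rho> \<eta> \<kappa> j i) t =
      deriv (\<lambda>u. \<eta> j u * cutoff i (param I u)) t / frequency n I \<rho> \<eta> \<kappa> j i t"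
    using * by blast
qed

text \<open>
  This bound and the next one are what the two summands in the definition of the frequency are for.
\<close>

lemma abs_deriv_amplitude_le:
  assumes i: "i \<in> {0, 1}" and j: "j \<in> {1..<n}" and \<kappa>: "0 \<le> \<kappa>" and t: "t \<in> I"
  shows "\<bar>deriv (amplitude n I \<rho> \<eta> \<kappa> j i) t\<bar> \<le> \<rho> t / (2 * n)"
proof -
  let ?D = "\<bar>deriv (\<lambda>u. \<eta> j u * cutoff i (param I u)) t\<bar>" and ?w = "frequency n I \<rho> \<eta> \<kappa> j i t"
  have "2 * real n * (?D / \<rho> t) \<le> 1 + 2 * real n * (?D / \<rho> t + sqrt \<kappa> * \<eta> j t)"
    using \<eta>_pos[OF j t] \<kappa> by (simp add: algebra_simps add_increasing)
  also have "\<dots> \<le> ?w" by (rule frequency_ge[OF j t])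
  finally have "?D * (2 * real n) \<le> \<rho> t * ?w" using \<rho>_pos[OF t] by (simp add: field_simps)
  then have "?D / ?w \<le> \<rho> t / (2 * real n)"
    using frequency_pos[OF j t \<kappa>, of i] n by (simp add: field_simps)
  then show ?thesis
    using frequency_pos[OF j t \<kappa>, of i] by (simp add: deriv_amplitude[OF i j \<kappa> t])
qed

lemma abs_amplitude_le:
  assumes j: "j \<in> {1..<n}" and \<kappa>: "0 \<le> \<kappa>" and t: "t \<in> I"
  shows "sqrt \<kappa> * \<bar>amplitude n I \<rho> \<eta> \<kappa> j i t\<bar> \<le> 1 / (2 * n)"
proof -
  let ?D = "\<bar>deriv (\<lambda>u. \<eta> j u * cutoff i (param I u)) t\<bar>" and ?w = "frequency n I \<rho> \<eta> \<kappa> j i t"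
  have "2 * real n * (sqrt \<kappa> * \<eta> j t) \<le> 1 + 2 * real n * (?D / \<rho> t + sqrt \<kappa> * \<eta> j t)"
    using \<rho>_pos[OF t] by (simp add: algebra_simps add_increasing)
  also have "\<dots> \<le> ?w" by (rule frequency_ge[OF j t])
  finally have "sqrt \<kappa> * \<eta> j t / ?w \<le> 1 / (2 * real n)"
    using frequency_pos[OF j t \<kappa>, of i] n by (simp add: field_simps)
  moreover have "sqrt \<kappa> * \<bar>amplitude n I \<rho> \<eta> \<kappa> j i t\<bar> \<le> sqrt \<kappa> * \<eta> j t / ?w"
    unfolding amplitude_def
    using frequency_pos[OF j t \<kappa>, of i] \<eta>_pos[OF j t] \<kappa> abs_cutoff_le_1[of i "param I t"]
    by (auto simp: abs_mult intro!: divide_right_mono mult_left_mono mult_left_le)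
  ultimately show ?thesis by linarith
qed

text \<open>
  There are at most 2 (n - 1) summands, and \<open>2 (n - 1) / (4 n\<^sup>2) \<le> 1 / 8\<close>, which is \<open>0 \<le> (n - 2)\<^sup>2\<close>.
\<close>

lemma double_sum_le:
  fixes f :: "nat \<Rightarrow> nat \<Rightarrow> real"
  assumes "\<And>j i. j \<in> {a+1..<n} \<Longrightarrow> i \<in> {0, 1} \<Longrightarrow> \<bar>f j i\<bar> \<le> b / (2 * n)" "0 \<le> b"
  shows "(\<Sum>j\<in>{a+1..<n}. \<Sum>i\<in>{0, 1}. (f j i)\<^sup>2) \<le> b\<^sup>2 / 8"
proof -
  have "(\<Sum>j\<in>{a+1..<n}. \<Sum>i\<in>{0, 1}. (f j i)\<^sup>2) \<le>
      (\<Sum>j\<in>{a+1..<n}. \<Sum>i\<in>{0::nat, 1}. (b / (2 * n))\<^sup>2)"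
  proof (intro sum_mono)
    fix j i :: nat assume "j \<in> {a+1..<n}" "i \<in> {0, 1}"
    from assms(1)[OF this] show "(f j i)\<^sup>2 \<le> (b / (2 * n))\<^sup>2"
      by (metis abs_ge_zero power2_abs power_mono)
  qed
  also have "\<dots> = real (n - (a + 1)) * (b\<^sup>2 / (2 * (real n)\<^sup>2))"
    by (simp add: power_divide power_mult_distrib)
  also have "\<dots> \<le> (real n - 1) * (b\<^sup>2 / (2 * (real n)\<^sup>2))"
    using n by (intro mult_right_mono) auto
  also have "\<dots> = (4 * (real n - 1)) * (b\<^sup>2 / (8 * (real n)\<^sup>2))"
    using n by (simp add: field_simps)
  also have "\<dots> \<le> (real n)\<^sup>2 * (b\<^sup>2 / (8 * (real n)\<^sup>2))"
    using zero_le_power2[of "real n - 2"]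
    by (intro mult_right_mono) (auto simp: power2_eq_square algebra_simps)
  also have "\<dots> = b\<^sup>2 / 8" using n by simp
  finally show ?thesis .
qed

lemma amplitude_deriv_sum_le:
  assumes "0 \<le> \<kappa>" "t \<in> I"
  shows "amplitude_deriv_sum n a I \<rho> \<eta> \<kappa> t \<le> (\<rho> t)\<^sup>2 / 8"
  unfolding amplitude_deriv_sum_def
  by (rule double_sum_le) (use assms \<rho>_pos abs_deriv_amplitude_le in \<open>auto simp: less_imp_le\<close>)

lemma amplitude_sum_le:
  assumes "0 < \<kappa>" "t \<in> I"
  shows "amplitude_sum n a I \<rho> \<eta> \<kappa> t \<le> 1 / (8 * \<kappa>)"
proof -
  have "(\<Sum>j\<in>{a+1..<n}. \<Sum>i\<in>{0, 1}. (sqrt \<kappa> * amplitude n I \<rho> \<eta> \<kappa> j i t)\<^sup>2) \<le> 1\<^sup>2 / 8"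
    by (rule double_sum_le) (use assms abs_amplitude_le in \<open>auto simp: abs_mult\<close>)
  moreover have "(\<Sum>j\<in>{a+1..<n}. \<Sum>i\<in>{0, 1}. (sqrt \<kappa> * amplitude n I \<rho> \<eta> \<kappa> j i t)\<^sup>2)
      = \<kappa> * amplitude_sum n a I \<rho> \<eta> \<kappa> t"
    using assms(1) by (simp add: amplitude_sum_def power_mult_distrib sum_distrib_left algebra_simps)
  ultimately show ?thesis using assms(1) by (simp add: field_simps)
qed

end

section \<open>Coordinates that separate the variables locally\<close>

lemma mem_Euclidean_iff: "x \<in> topspace (Euclidean_space n) \<longleftrightarrow> (\<forall>i\<ge>n. x i = 0)"
  by (simp add: topspace_Euclidean_space)

lemma mem_warped_domain_iff: "x \<in> warped_domain n I \<longleftrightarrow> (\<forall>i\<ge>n. x i = 0) \<and> x 0 \<in> I"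
  by (simp add: warped_domain_def mem_Euclidean_iff)

lemma of_coords_in_Euclidean: "m = length ys \<Longrightarrow> of_coords ys \<in> topspace (Euclidean_space m)"
  by (simp add: mem_Euclidean_iff of_coords_def)

lemma warped_domain_subset: "warped_domain n I \<subseteq> topspace (Euclidean_space n)"
  by (auto simp: warped_domain_def)

lemma subtopology_Euclidean_space:
  assumes "S \<subseteq> topspace (Euclidean_space n)"
  shows "subtopology (Euclidean_space n) S = top_of_set S"
proof -
  have "{x. \<forall>i\<ge>n. x i = 0} \<inter> S = S" using assms by (auto simp: mem_Euclidean_iff)
  then show ?thesis
    by (simp add: Euclidean_space_def euclidean_product_topology subtopology_subtopology)
qed

lemma tendsto_coordinate: "((\<lambda>x. x i) \<longlongrightarrow> p i) (at (p :: nat \<Rightarrow> real) within S)"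
proof (rule tendsto_within_subset)
  show "((\<lambda>x. x i) \<longlongrightarrow> p i) (at p within UNIV)"
    using continuous_on_product_coordinates[of i] unfolding continuous_on_def by blast
qed simp

text \<open>
  A function of t alone is the case \<open>v = 1\<close>; in dimension n = 1 this leaves no coordinate for j, so j may
  exceed n.
\<close>

definition separated_on ::
  "nat \<Rightarrow> real set \<Rightarrow> nat \<Rightarrow> (real \<Rightarrow> real) \<Rightarrow> (real \<Rightarrow> real) \<Rightarrow> ((nat \<Rightarrow> real) \<Rightarrow> real) \<Rightarrow> bool" where
  "separated_on n J j u v \<phi> \<longleftrightarrow> open J \<and> 1 \<le> j \<and> smooth_real_on J u \<and> smooth_real_on UNIV v \<and>
    (\<forall>x\<in>warped_domain n J. \<phi> x = u (x 0) * v (x j))"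

definition locally_separated :: "nat \<Rightarrow> real set \<Rightarrow> ((nat \<Rightarrow> real) \<Rightarrow> real) \<Rightarrow> bool" where
  "locally_separated n I \<phi> \<longleftrightarrow> (\<forall>t\<in>I. \<exists>J j u v. t \<in> J \<and> separated_on n J j u v \<phi>)"

text \<open>
  Replacing the coordinate 0 by a nearby number stays in the domain because J is open, and the other
  coordinates are unrestricted.
\<close>

lemma separated_on_has_partial_deriv:
  assumes sep: "separated_on n J j u v \<phi>" and x: "x \<in> warped_domain n J" and i: "i < n"
  shows "((\<lambda>s. \<phi> (x(i := s))) has_real_derivative
    (if i = 0 then deriv u (x 0) * v (x j) else if i = j then u (x 0) * deriv v (x j) else 0)) (at (x i))"
proof (cases "i = 0")
  case True
  have "((\<lambda>s. u s * v (x j)) has_real_derivative deriv u (x 0) * v (x j)) (at (x 0))"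
    using sep x by (intro DERIV_cmult_right smooth_real_on_has_deriv[of J])
      (auto simp: separated_on_def mem_warped_domain_iff)
  moreover have "u s * v (x j) = \<phi> (x(0 := s))" if "s \<in> J" for s
  proof -
    have "x(0 := s) \<in> warped_domain n J" using x that i by (auto simp: mem_warped_domain_iff)
    then show ?thesis using sep by (auto simp: separated_on_def)
  qed
  moreover have "open J" "x 0 \<in> J" using sep x by (auto simp: separated_on_def mem_warped_domain_iff)
  ultimately show ?thesis
    using True has_field_derivative_transform_within_open[where S = J and a = "x 0"
        and f = "\<lambda>s. u s * v (x j)" and g = "\<lambda>s. \<phi> (x(0 := s))"] by simp
next
  case False
  have "\<phi> (x(i := s)) = u (x 0) * v (if i = j then s else x j)" for s
  proof -
    have "x(i := s) \<in> warped_domain n J" using x i False by (auto simp: mem_warped_domain_iff)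
    then show ?thesis using sep False by (auto simp: separated_on_def)
  qed
  moreover have "(v has_real_derivative deriv v (x j)) (at (x j))"
    using sep by (intro smooth_real_on_has_deriv[of UNIV]) (auto simp: separated_on_def)
  ultimately show ?thesis using False by (auto intro!: DERIV_cmult)
qed

lemma partial_deriv_separated_on:
  assumes "separated_on n J j u v \<phi>" "x \<in> warped_domain n J" "i < n"
  shows "partial_deriv i \<phi> x =
    (if i = 0 then deriv u (x 0) * v (x j) else if i = j then u (x 0) * deriv v (x j) else 0)"
  using DERIV_imp_deriv[OF separated_on_has_partial_deriv[OF assms]] by (simp add: partial_deriv_def)

text \<open>
  The class is closed under partial derivatives, so smoothness in the sense of
  \<^const>\<open>smooth_map_on\<close> reduces to differentiability and continuity of its members.
\<close>

lemma separated_on_partial_deriv: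
  assumes "separated_on n J j u v \<phi>" "i < n"
  shows "separated_on n J j (if i = 0 then deriv u else if i = j then u else (\<lambda>_. 0))
    (if i = j then deriv v else v) (partial_deriv i \<phi>)"
  unfolding separated_on_def
proof (intro conjI ballI)
  fix x assume "x \<in> warped_domain n J"
  then show "partial_deriv i \<phi> x = (if i = 0 then deriv u else if i = j then u else (\<lambda>_. 0)) (x 0) *
      (if i = j then deriv v else v) (x j)"
    using assms by (auto simp: partial_deriv_separated_on separated_on_def)
qed (use assms in \<open>auto simp: separated_on_def intro: smooth_real_on_deriv smooth_real_on_const\<close>)

lemma locally_separated_partial_deriv:
  assumes "locally_separated n I \<phi>" "i < n"
  shows "locally_separated n I (partial_deriv i \<phi>)"
  using assms separated_on_partial_deriv unfolding locally_separated_def by meson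

lemma continuous_on_locally_separated:
  assumes "locally_separated n I \<phi>"
  shows "continuous_on (warped_domain n I) \<phi>"
  unfolding continuous_on_def
proof
  let ?M = "warped_domain n I"
  fix p assume p: "p \<in> ?M"
  then obtain J j u v where J: "p 0 \<in> J" and sep: "separated_on n J j u v \<phi>"
    using assms unfolding locally_separated_def by (auto simp: mem_warped_domain_iff)
  have "eventually (\<lambda>x. x 0 \<in> J) (at p within ?M)"
    using sep J by (intro topological_tendstoD[OF tendsto_coordinate]) (auto simp: separated_on_def)
  moreover have "eventually (\<lambda>x. x \<in> ?M) (at p within ?M)"
    by (simp add: eventually_at_filter)
  ultimately have ev: "eventually (\<lambda>x. u (x 0) * v (x j) = \<phi> x) (at p within ?M)"
    by eventually_elim (use sep in \<open>auto simp: separated_on_def mem_warped_domain_iff\<close>)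
  have "isCont u (p 0)" "isCont v (p j)"
    using sep J smooth_real_on_isCont by (auto simp: separated_on_def)
  then have "((\<lambda>x. u (x 0) * v (x j)) \<longlongrightarrow> u (p 0) * v (p j)) (at p within ?M)"
    by (intro tendsto_mult isCont_tendsto_compose[OF _ tendsto_coordinate])
  moreover have "\<phi> p = u (p 0) * v (p j)"
    using sep p J by (auto simp: separated_on_def mem_warped_domain_iff)
  ultimately show "(\<phi> \<longlongrightarrow> \<phi> p) (at p within ?M)"
    using Lim_transform_eventually[OF _ ev] by simp
qed

lemma smooth_map_on_locally_separated:
  assumes "\<And>k. k < m \<Longrightarrow> locally_separated n I (\<lambda>x. f x k)"
  shows "smooth_map_on n (warped_domain n I) m f"
  unfolding smooth_map_on_def Let_def
proof (intro allI impI)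
  fix k js assume "k < m" "set js \<subseteq> {..<n}"
  have "locally_separated n I (fold partial_deriv js \<phi>)" if "locally_separated n I \<phi>" for \<phi>
    using \<open>set js \<subseteq> {..<n}\<close> that
    by (induction js arbitrary: \<phi>) (auto intro: locally_separated_partial_deriv)
  with assms[OF \<open>k < m\<close>] have ls: "locally_separated n I (fold partial_deriv js (\<lambda>x. f x k))" by blast
  let ?g = "fold partial_deriv js (\<lambda>x. f x k)" and ?M = "warped_domain n I"
  show "continuous_map (subtopology (Euclidean_space n) ?M) euclideanreal ?g \<and>
      (\<forall>i<n. \<forall>x\<in>?M. (\<lambda>s. ?g (x(i := s))) differentiable at (x i))"
  proof (intro conjI allI impI ballI)
    have "?M \<subseteq> topspace (Euclidean_space n)" by (auto simp: warped_domain_def)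
    then show "continuous_map (subtopology (Euclidean_space n) ?M) euclideanreal ?g"
      using continuous_on_locally_separated[OF ls] by (simp add: subtopology_Euclidean_space)
    fix i x assume "i < n" "x \<in> ?M"
    then obtain J j u v where "x 0 \<in> J" "separated_on n J j u v ?g"
      using ls unfolding locally_separated_def by (auto simp: mem_warped_domain_iff)
    with \<open>i < n\<close> \<open>x \<in> ?M\<close> show "(\<lambda>s. ?g (x(i := s))) differentiable at (x i)"
      using separated_on_has_partial_deriv[of n J j u v ?g x i]
      by (auto simp: mem_warped_domain_iff real_differentiable_def)
  qed
qed

definition scalar_differential ::
  "nat \<Rightarrow> ((nat \<Rightarrow> real) \<Rightarrow> real) \<Rightarrow> (nat \<Rightarrow> real) \<Rightarrow> (nat \<Rightarrow> real) \<Rightarrow> real" where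
  "scalar_differential n \<phi> p v = (\<Sum>i<n. partial_deriv i \<phi> p * v i)"

lemma scalar_differential_separated_on:
  assumes sep: "separated_on n J j u v \<phi>" and p: "p \<in> warped_domain n J"
    and w: "w \<in> topspace (Euclidean_space n)" and n: "1 \<le> n"
  shows "scalar_differential n \<phi> p w =
    deriv u (p 0) * v (p j) * w 0 + u (p 0) * deriv v (p j) * w j"
proof -
  let ?a = "deriv u (p 0) * v (p j) * w 0" and ?b = "u (p 0) * deriv v (p j) * w j"
  have j: "j \<noteq> 0" using sep by (auto simp: separated_on_def)
  have "scalar_differential n \<phi> p w = (\<Sum>i<n. (if i = 0 then ?a else 0) + (if i = j then ?b else 0))"
    unfolding scalar_differential_def
    by (rule sum.cong) (use j in \<open>auto simp: partial_deriv_separated_on[OF sep p]\<close>)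
  also have "\<dots> = ?a + ?b"
    using n w by (auto simp: sum.distrib mem_Euclidean_iff)
  finally show ?thesis .
qed

lemma separated_on_unary:
  "open I \<Longrightarrow> smooth_real_on I u \<Longrightarrow> separated_on n I 1 u (\<lambda>_. 1) (\<lambda>x. u (x 0))"
  by (simp add: separated_on_def smooth_real_on_const)

lemma separated_on_imp_locally: "separated_on n I j u v \<phi> \<Longrightarrow> locally_separated n I \<phi>"
  by (auto simp: locally_separated_def)

lemma scalar_differential_unary:
  assumes "open I" "smooth_real_on I u" "p \<in> warped_domain n I" "w \<in> topspace (Euclidean_space n)" "1 \<le> n"
  shows "scalar_differential n (\<lambda>x. u (x 0)) p w = deriv u (p 0) * w 0"
  using scalar_differential_separated_on[OF separated_on_unary[OF assms(1,2)] assms(3-5)] by simp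

text \<open>
  The timelike coordinates of all the maps come first, so that the semi-Euclidean product becomes a
  difference of two sums over lists of coordinate functions.
\<close>

lemma semi_inner_append:
  assumes "\<And>k. k < length (T @ S) \<Longrightarrow> X k = F ((T @ S) ! k)"
    "\<And>k. k < length (T @ S) \<Longrightarrow> Y k = G ((T @ S) ! k)"
  shows "semi_inner (length (T @ S)) (length T) X Y =
    - (\<Sum>\<phi>\<leftarrow>T. F \<phi> * G \<phi>) + (\<Sum>\<phi>\<leftarrow>S. F \<phi> * G \<phi>)"
proof -
  let ?h = "\<lambda>k. (if k < length T then - 1 else 1) * X k * Y k"
  have split: "(\<Sum>k<l + m. h k) = (\<Sum>k<l. h k) + (\<Sum>k<m. h (l + k))" for l m and h :: "nat \<Rightarrow> real"
    by (induction m) auto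
  have "(\<Sum>k<length T. ?h k) = (\<Sum>k<length T. - (F (T ! k) * G (T ! k)))"
    by (rule sum.cong) (auto simp: assms nth_append)
  moreover have "(\<Sum>k<length S. ?h (length T + k)) = (\<Sum>k<length S. F (S ! k) * G (S ! k))"
    by (rule sum.cong) (auto simp: assms nth_append)
  ultimately show ?thesis
    by (simp add: semi_inner_def split sum_list_sum_nth sum_negf atLeast0LessThan)
qed

text \<open>
  The differential is injective because the pull-back of the ambient product is the positive definite
  warped metric.
\<close>

lemma isometric_immersion_coordinates:
  assumes n: "1 \<le> n"
    and f: "\<And>x. f x = of_coords (map (\<lambda>\<phi>. \<phi> x) (T @ S))"
    and len: "length T = amb_index N" "length (T @ S) = amb_dim N"
    and sep: "\<And>\<phi>. \<phi> \<in> set (T @ S) \<Longrightarrow> locally_separated n I \<phi>"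
    and points: "\<And>x. x \<in> warped_domain n I \<Longrightarrow> f x \<in> points N"
    and metric: "\<And>p v w. p \<in> warped_domain n I \<Longrightarrow> v \<in> topspace (Euclidean_space n) \<Longrightarrow>
      w \<in> topspace (Euclidean_space n) \<Longrightarrow>
      - (\<Sum>\<phi>\<leftarrow>T. scalar_differential n \<phi> p v * scalar_differential n \<phi> p w) +
      (\<Sum>\<phi>\<leftarrow>S. scalar_differential n \<phi> p v * scalar_differential n \<phi> p w) = warped_metric n \<rho> \<eta> p v w"
    and pos: "\<And>t. t \<in> I \<Longrightarrow> 0 < \<rho> t" "\<And>j t. j \<in> {1..<n} \<Longrightarrow> t \<in> I \<Longrightarrow> 0 < \<eta> j t"
  shows "isometric_immersion n (warped_domain n I) (warped_metric n \<rho> \<eta>) N f"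
proof -
  let ?M = "warped_domain n I" and ?E = "topspace (Euclidean_space n)"
  have comp: "(\<lambda>x. f x k) = (T @ S) ! k" if "k < length (T @ S)" for k
  proof
    show "f x k = ((T @ S) ! k) x" for x
      using that unfolding f of_coords_def length_map by (simp only: if_True nth_map)
  qed
  have smooth: "smooth_map_on n ?M (amb_dim N) f"
  proof (rule smooth_map_on_locally_separated)
    fix k assume "k < amb_dim N"
    then show "locally_separated n I (\<lambda>x. f x k)"
      using len comp sep nth_mem by metis
  qed
  have inner: "semi_inner (amb_dim N) (amb_index N) (differential n f p v) (differential n f p w) =
      warped_metric n \<rho> \<eta> p v w" if "p \<in> ?M" "v \<in> ?E" "w \<in> ?E" for p v w
  proof -
    have "differential n f p v k = scalar_differential n ((T @ S) ! k) p v"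
      if "k < length (T @ S)" for k v
      unfolding differential_def scalar_differential_def comp[OF that] ..
    then show ?thesis
      using semi_inner_append[of T S "differential n f p v" "\<lambda>\<phi>. scalar_differential n \<phi> p v"
        "differential n f p w" "\<lambda>\<phi>. scalar_differential n \<phi> p w"] metric[OF that] len by simp
  qed
  have "inj_on (differential n f p) ?E" if p: "p \<in> ?M" for p
  proof (rule inj_onI)
    fix v w assume vw: "v \<in> ?E" "w \<in> ?E" and eq: "differential n f p v = differential n f p w"
    \<comment> \<open>The warped metric is linear in its first vector, so pairing v and w with their difference suffices.\<close>
    let ?z = "\<lambda>i. v i - w i"
    have z: "?z \<in> ?E" using vw by (simp add: mem_Euclidean_iff)
    have "warped_metric n \<rho> \<eta> p v ?z - warped_metric n \<rho> \<eta> p w ?z = 0"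
      using inner[OF p vw(1) z] inner[OF p vw(2) z] eq by simp
    moreover have "warped_metric n \<rho> \<eta> p v ?z - warped_metric n \<rho> \<eta> p w ?z =
        (\<rho> (p 0) * ?z 0)\<^sup>2 + (\<Sum>j\<in>{1..<n}. (\<eta> j (p 0) * ?z j)\<^sup>2)"
      by (simp add: warped_metric_def sum_subtractf[symmetric] power2_eq_square algebra_simps)
    ultimately have "(\<rho> (p 0) * ?z 0)\<^sup>2 = 0" "(\<Sum>j\<in>{1..<n}. (\<eta> j (p 0) * ?z j)\<^sup>2) = 0"
      by (smt (verit) sum_nonneg zero_le_power2)+
    then have "\<rho> (p 0) * ?z 0 = 0" "\<And>j. j \<in> {1..<n} \<Longrightarrow> \<eta> j (p 0) * ?z j = 0"
      by (auto simp: sum_nonneg_eq_0_iff)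
    moreover have "p 0 \<in> I" using p by (simp add: mem_warped_domain_iff)
    ultimately have "?z 0 = 0" "\<And>j. j \<in> {1..<n} \<Longrightarrow> ?z j = 0" using pos by fastforce+
    moreover have "?z j = 0" if "n \<le> j" for j using z that by (simp add: mem_Euclidean_iff)
    ultimately have "?z i = 0" for i by (cases "i = 0"; cases "i < n") auto
    then show "v = w" by auto
  qed
  then show ?thesis
    using points smooth inner by (auto simp: isometric_immersion_def)
qed

text \<open>
  One condition covers injectivity and continuity of the inverse: if f converges to f p along a filter,
  then its argument converges to p.  The principal filter of a point with the same image as p gives
  injectivity; the neighbourhood filter of f p in the image, transported by the inverse, gives continuity.
\<close>

lemma isometric_embedding_criterion:
  assumes imm: "isometric_immersion n M g N f"
    and M: "M \<subseteq> topspace (Euclidean_space n)"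
    and N: "points N \<subseteq> topspace (Euclidean_space (amb_dim N))"
    and inv: "\<And>p F i. p \<in> M \<Longrightarrow> eventually (\<lambda>x. x \<in> M) F \<Longrightarrow>
      (\<And>k. k < amb_dim N \<Longrightarrow> ((\<lambda>x. f x k) \<longlongrightarrow> f p k) F) \<Longrightarrow> i < n \<Longrightarrow> ((\<lambda>x. x i) \<longlongrightarrow> p i) F"
  shows "isometric_embedding n M g N f"
proof -
  have fM: "f ` M \<subseteq> topspace (Euclidean_space (amb_dim N))" "f ` M \<subseteq> points N"
    using imm N by (auto simp: isometric_immersion_def)
  have inj: "inj_on f M"
  proof (rule inj_onI)
    fix p q assume pq: "p \<in> M" "q \<in> M" and eq: "f p = f q"
    have "p i = q i" if "i < n" for i
    proof -
      have "((\<lambda>x. x i) \<longlongrightarrow> p i) (principal {q})"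
      proof (rule inv[OF pq(1) _ _ that])
        show "((\<lambda>x. f x k) \<longlongrightarrow> f p k) (principal {q})" for k
          unfolding eq by (rule tendsto_principal_singleton)
      qed (simp add: eventually_principal pq)
      then show ?thesis
        using tendsto_unique[OF _ _ tendsto_principal_singleton, of q "\<lambda>x. x i"]
        by (auto simp: principal_eq_bot_iff)
    qed
    moreover have "p i = q i" if "n \<le> i" for i
      using that subsetD[OF M pq(1)] subsetD[OF M pq(2)] by (simp add: mem_Euclidean_iff)
    ultimately show "p = q" by (metis ext not_le)
  qed
  have comp: "continuous_on M (\<lambda>x. f x k)" for k
  proof (cases "k < amb_dim N")
    case True
    have "continuous_map (subtopology (Euclidean_space n) M) euclideanreal (fold partial_deriv [] (\<lambda>x. f x k))"
      using imm True unfolding isometric_immersion_def smooth_map_on_def Let_def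
      by (metis empty_set empty_subsetI)
    then show ?thesis by (simp add: subtopology_Euclidean_space[OF M])
  next
    case False
    then have "f x k = 0" if "x \<in> M" for x using fM(1) that by (auto simp: mem_Euclidean_iff)
    then show ?thesis using continuous_on_cong[of M M "\<lambda>x. f x k" "\<lambda>_. 0"] by simp
  qed
  then have cont: "continuous_on M f" by (rule continuous_on_coordinatewise_then_product)
  let ?g = "inv_into M f"
  have "continuous_on (f ` M) (\<lambda>y. ?g y i)" for i
  proof (cases "i < n")
    case True
    show ?thesis unfolding continuous_on_def
    proof
      fix y assume y: "y \<in> f ` M"
      then obtain p where p: "p \<in> M" "y = f p" by blast
      let ?F = "filtermap ?g (at y within f ` M)"
      have ev: "eventually (\<lambda>y'. y' \<in> f ` M) (at y within f ` M)"
        by (simp add: eventually_at_filter)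
      have "((\<lambda>x. x i) \<longlongrightarrow> p i) ?F"
      proof (rule inv[OF p(1) _ _ True])
        show "eventually (\<lambda>x. x \<in> M) ?F"
          unfolding eventually_filtermap using ev by eventually_elim (auto intro: inv_into_into)
        fix k
        show "((\<lambda>x. f x k) \<longlongrightarrow> f p k) ?F"
          unfolding filterlim_filtermap
        proof (rule Lim_transform_eventually)
          show "((\<lambda>y'. y' k) \<longlongrightarrow> f p k) (at y within f ` M)"
            unfolding p(2) by (rule tendsto_coordinate)
          show "eventually (\<lambda>y'. y' k = f (?g y') k) (at y within f ` M)"
            using ev by eventually_elim (simp add: f_inv_into_f)
        qed
      qed
      then show "((\<lambda>y. ?g y i) \<longlongrightarrow> ?g y i) (at y within f ` M)"
        using p inj by (simp add: filterlim_filtermap)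
    qed
  next
    case False
    then have "?g y i = 0" if "y \<in> f ` M" for y
      using M inv_into_into[OF that] by (auto simp: mem_Euclidean_iff)
    then show ?thesis using continuous_on_cong[of "f ` M" "f ` M" "\<lambda>y. ?g y i" "\<lambda>_. 0"] by simp
  qed
  then have cont_inv: "continuous_on (f ` M) ?g" by (rule continuous_on_coordinatewise_then_product)
  have top: "subtopology (Euclidean_space n) M = top_of_set M"
    "subtopology (subtopology (Euclidean_space (amb_dim N)) (points N)) (f ` M) = top_of_set (f ` M)"
    using fM by (simp_all add: subtopology_Euclidean_space[OF M] subtopology_subtopology
        subtopology_Euclidean_space inf.absorb2)
  have "homeomorphic_maps (top_of_set M) (top_of_set (f ` M)) f ?g"
    using cont cont_inv inj by (auto simp: homeomorphic_maps_def inv_into_into f_inv_into_f)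
  then have "embedding_map (subtopology (Euclidean_space n) M)
      (subtopology (Euclidean_space (amb_dim N)) (points N)) f"
    unfolding embedding_map_def top topspace_euclidean_subtopology homeomorphic_map_maps by blast
  then show ?thesis using imm inj by (simp add: isometric_embedding_def)
qed

lemma isometric_embedding_coordinates:
  assumes imm: "isometric_immersion n M g N f"
    and M: "M \<subseteq> topspace (Euclidean_space n)"
    and N: "points N \<subseteq> topspace (Euclidean_space (amb_dim N))"
    and f: "\<And>x. f x = of_coords (map (\<lambda>\<phi>. \<phi> x) \<Phi>)" and len: "length \<Phi> = amb_dim N"
    and inv: "\<And>p F i. p \<in> M \<Longrightarrow> eventually (\<lambda>x. x \<in> M) F \<Longrightarrow>
      (\<And>\<phi>. \<phi> \<in> set \<Phi> \<Longrightarrow> ((\<lambda>x. \<phi> x) \<longlongrightarrow> \<phi> p) F) \<Longrightarrow> i < n \<Longrightarrow> ((\<lambda>x. x i) \<longlongrightarrow> p i) F"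
  shows "isometric_embedding n M g N f"
proof (rule isometric_embedding_criterion[OF imm M N])
  fix p F i assume *: "p \<in> M" "eventually (\<lambda>x. x \<in> M) F" "i < n"
    and lim: "\<And>k. k < amb_dim N \<Longrightarrow> ((\<lambda>x. f x k) \<longlongrightarrow> f p k) F"
  have "((\<lambda>x. \<phi> x) \<longlongrightarrow> \<phi> p) F" if \<phi>: "\<phi> \<in> set \<Phi>" for \<phi>
  proof -
    obtain k where k: "k < amb_dim N" "\<phi> = \<Phi> ! k" using \<phi> len by (auto simp: in_set_conv_nth)
    then have "f x k = \<phi> x" for x using len by (simp add: f of_coords_def)
    then show ?thesis using lim[OF k(1)] by simp
  qed
  then show "((\<lambda>x. x i) \<longlongrightarrow> p i) F" using inv * by blast
qed

section \<open>Spherical curves of unit speed\<close>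

text \<open>
  The argument is caught between two points of I close to p, at which g takes values on both sides of the
  limit.
\<close>

lemma tendsto_of_strict_mono:
  fixes g :: "real \<Rightarrow> real" and \<theta> :: "'b \<Rightarrow> real"
  assumes "open I" "\<And>s t. s \<in> I \<Longrightarrow> t \<in> I \<Longrightarrow> s < t \<Longrightarrow> g s < g t" "p \<in> I"
    and ev: "eventually (\<lambda>x. \<theta> x \<in> I) F" and lim: "((\<lambda>x. g (\<theta> x)) \<longlongrightarrow> g p) F"
  shows "(\<theta> \<longlongrightarrow> p) F"
proof -
  have less: "s < t" if "g s < g t" "s \<in> I" "t \<in> I" for s t
    using that assms(2)[of t s] by (cases s t rule: linorder_cases) auto
  obtain e where e: "e > 0" "ball p e \<subseteq> I" using assms(1,3) open_contains_ball by blast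
  show ?thesis
  proof (rule order_tendstoI)
    fix y assume "y < p"
    define z where "z = max y (p - e/2)"
    have z: "y \<le> z" "z < p" "z \<in> I"
      using \<open>y < p\<close> e(1) by (auto simp: z_def dist_real_def intro!: subsetD[OF e(2)])
    have "eventually (\<lambda>x. g z < g (\<theta> x)) F"
      by (rule order_tendstoD(1)[OF lim]) (use assms(2,3) z in auto)
    with ev show "eventually (\<lambda>x. y < \<theta> x) F"
      by eventually_elim (use less z in fastforce)
  next
    fix y assume "p < y"
    define z where "z = min y (p + e/2)"
    have z: "z \<le> y" "p < z" "z \<in> I"
      using \<open>p < y\<close> e(1) by (auto simp: z_def dist_real_def intro!: subsetD[OF e(2)])
    have "eventually (\<lambda>x. g (\<theta> x) < g z) F"
      by (rule order_tendstoD(2)[OF lim]) (use assms(2,3) z in auto)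
    with ev show "eventually (\<lambda>x. \<theta> x < y) F"
      by eventually_elim (use less z in fastforce)
  qed
qed

lemma tendsto_of_interval:
  fixes g :: "real \<Rightarrow> real"
  assumes "open I" "p \<in> M" "M = warped_domain n I" "eventually (\<lambda>x. x \<in> M) F"
    "\<And>s t. s \<in> I \<Longrightarrow> t \<in> I \<Longrightarrow> s < t \<Longrightarrow> g s < g t" "((\<lambda>x. g (x 0)) \<longlongrightarrow> g (p 0)) F"
  shows "((\<lambda>x. x 0) \<longlongrightarrow> p 0) F"
proof (rule tendsto_of_strict_mono[where I = I and g = g])
  show "eventually (\<lambda>x. x 0 \<in> I) F"
    using assms(4) by eventually_elim (simp add: assms(3) mem_warped_domain_iff)
qed (use assms in \<open>auto simp: mem_warped_domain_iff\<close>)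

lemma tendsto_of_sinh:
  fixes \<theta> :: "'b \<Rightarrow> real"
  assumes "((\<lambda>x. sinh (\<theta> x)) \<longlongrightarrow> sinh p) F" shows "(\<theta> \<longlongrightarrow> p) F"
  by (rule tendsto_of_strict_mono[where g = sinh and I = UNIV]) (use assms in auto)

text \<open>
  The entries of the list are the components of the curve.
\<close>

definition unit_speed_spherical :: "(real \<Rightarrow> real) list \<Rightarrow> bool" where
  "unit_speed_spherical hs \<longleftrightarrow> (\<forall>h\<in>set hs. smooth_real_on UNIV h) \<and>
    (\<forall>s. (\<Sum>h\<leftarrow>hs. h s * h s) = 1) \<and> (\<forall>s. (\<Sum>h\<leftarrow>hs. deriv h s * deriv h s) = 1)"

text \<open>
  Half the derivative of the constant squared norm.
\<close>

lemma unit_speed_spherical_orthogonal: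
  assumes "unit_speed_spherical hs"
  shows "(\<Sum>h\<leftarrow>hs. h s * deriv h s) = 0"
proof -
  have "((\<lambda>s. \<Sum>h\<leftarrow>gs. h s * h s) has_real_derivative 2 * (\<Sum>h\<leftarrow>gs. h s * deriv h s)) (at s)"
    if "\<forall>h\<in>set gs. smooth_real_on UNIV h" for gs
    using that
  proof (induction gs)
    case (Cons g gs)
    then have "(g has_real_derivative deriv g s) (at s)"
      by (intro smooth_real_on_has_deriv[of UNIV]) auto
    with Cons show ?case by (auto intro!: derivative_eq_intros simp: algebra_simps)
  qed auto
  from this[of hs] have "((\<lambda>s. 1) has_real_derivative 2 * (\<Sum>h\<leftarrow>hs. h s * deriv h s)) (at s)"
    using assms by (simp add: unit_speed_spherical_def)
  then show ?thesis using DERIV_unique[OF DERIV_const] by fastforce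
qed

lemma sum_list_bilinear:
  fixes f g :: "'b \<Rightarrow> real"
  shows "(\<Sum>h\<leftarrow>hs. (\<alpha> * f h + \<beta> * g h) * (\<gamma> * f h + \<delta> * g h)) =
    \<alpha> * \<gamma> * (\<Sum>h\<leftarrow>hs. f h * f h) + (\<alpha> * \<delta> + \<beta> * \<gamma>) * (\<Sum>h\<leftarrow>hs. f h * g h) +
    \<beta> * \<delta> * (\<Sum>h\<leftarrow>hs. g h * g h)"
  by (induction hs) (simp_all add: algebra_simps)

text \<open>
  The curve and its derivative are orthonormal.
\<close>

lemma unit_speed_spherical_inner:
  assumes "unit_speed_spherical hs"
  shows "(\<Sum>h\<leftarrow>hs. (\<alpha> * h s + \<beta> * deriv h s) * (\<gamma> * h s + \<delta> * deriv h s)) = \<alpha> * \<gamma> + \<beta> * \<delta>"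
  using assms unit_speed_spherical_orthogonal[OF assms, of s]
  unfolding sum_list_bilinear[where f = "\<lambda>h. h s" and g = "\<lambda>h. deriv h s"]
  by (simp add: unit_speed_spherical_def)

definition circle_coords :: "(real \<Rightarrow> real) list" where
  "circle_coords = [cos, sin]"

definition spiral_coords :: "(real \<Rightarrow> real) list" where
  "spiral_coords =
    [\<lambda>s. cos (ln (cosh s)) / cosh s, \<lambda>s. sin (ln (cosh s)) / cosh s,
     \<lambda>s. cos (ln (cosh s)) * tanh s, \<lambda>s. sin (ln (cosh s)) * tanh s]"

lemma unit_speed_circle: "unit_speed_spherical circle_coords"
proof -
  have "deriv cos s = - sin s" "deriv sin s = cos s" for s :: real
    by (auto intro!: DERIV_imp_deriv derivative_eq_intros)
  then show ?thesis
    by (auto simp: unit_speed_spherical_def circle_coords_def smooth_real_on_sin smooth_real_on_cos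
        power2_eq_square[symmetric])
qed

lemma smooth_ln_cosh: "smooth_real_on UNIV (\<lambda>s. ln (cosh s))"
  by (rule smooth_real_on_antideriv[where f' = "\<lambda>s. sinh s / cosh s"])
    (auto intro!: derivative_eq_intros smooth_real_on_divide smooth_real_on_sinh smooth_real_on_cosh)

lemma unit_speed_spiral: "unit_speed_spherical spiral_coords"
proof -
  have c: "cosh s \<noteq> 0" for s :: real by simp
  have d: "((\<lambda>s. ln (cosh s)) has_real_derivative sinh s / cosh s) (at s)" for s :: real
    by (auto intro!: derivative_eq_intros)
  have t: "(tanh has_real_derivative 1 / (cosh s)\<^sup>2) (at s)" for s :: real
  proof -
    have "(sinh s)\<^sup>2 = (cosh s)\<^sup>2 - 1" by (simp add: cosh_square_eq)
    then have "1 - (tanh s)\<^sup>2 = 1 / (cosh s)\<^sup>2" by (simp add: tanh_def power_divide field_simps)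
    then show ?thesis by (auto intro!: derivative_eq_intros)
  qed
  have cs: "((\<lambda>s. cos (ln (cosh s))) has_real_derivative - sin (ln (cosh s)) * (sinh s / cosh s)) (at s)"
    and sn: "((\<lambda>s. sin (ln (cosh s))) has_real_derivative cos (ln (cosh s)) * (sinh s / cosh s)) (at s)"
    for s :: real
    by (rule DERIV_chain2[OF DERIV_cos d] DERIV_chain2[OF DERIV_sin d])+
  have ch: "(cosh has_real_derivative sinh s) (at s)" for s :: real
    by (auto intro!: derivative_eq_intros)
  have d0: "deriv (\<lambda>s. cos (ln (cosh s)) / cosh s) s =
      - (sin (ln (cosh s)) + cos (ln (cosh s))) * sinh s / (cosh s)\<^sup>2" for s :: real
    by (rule DERIV_imp_deriv, rule DERIV_cong[OF DERIV_divide[OF cs ch c]])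
      (simp add: field_simps power2_eq_square)
  have d1: "deriv (\<lambda>s. sin (ln (cosh s)) / cosh s) s =
      (cos (ln (cosh s)) - sin (ln (cosh s))) * sinh s / (cosh s)\<^sup>2" for s :: real
    by (rule DERIV_imp_deriv, rule DERIV_cong[OF DERIV_divide[OF sn ch c]])
      (simp add: field_simps power2_eq_square)
  have d2: "deriv (\<lambda>s. cos (ln (cosh s)) * tanh s) s =
      (cos (ln (cosh s)) - sin (ln (cosh s)) * (sinh s)\<^sup>2) / (cosh s)\<^sup>2" for s :: real
    by (rule DERIV_imp_deriv, rule DERIV_cong[OF DERIV_mult[OF cs t]])
      (simp add: tanh_def field_simps power2_eq_square)
  have d3: "deriv (\<lambda>s. sin (ln (cosh s)) * tanh s) s =
      (sin (ln (cosh s)) + cos (ln (cosh s)) * (sinh s)\<^sup>2) / (cosh s)\<^sup>2" for s :: real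
    by (rule DERIV_imp_deriv, rule DERIV_cong[OF DERIV_mult[OF sn t]])
      (simp add: tanh_def field_simps power2_eq_square)
  have smooth: "\<forall>h\<in>set spiral_coords. smooth_real_on UNIV h"
    unfolding spiral_coords_def tanh_def
    by (auto intro!: smooth_real_on_divide smooth_real_on_mult smooth_real_on_sinh smooth_real_on_cosh
        smooth_real_on_compose_UNIV[OF smooth_real_on_sin] smooth_real_on_compose_UNIV[OF smooth_real_on_cos]
        smooth_ln_cosh)
  have "(\<Sum>h\<leftarrow>spiral_coords. h s * h s) = 1" for s
  proof -
    let ?C = "cos (ln (cosh s))" and ?S = "sin (ln (cosh s))"
    have "C / z * (C / z) + (S / z * (S / z) + (C * (x / z) * (C * (x / z)) + S * (x / z) * (S * (x / z)))) =
        (S\<^sup>2 + C\<^sup>2) * (1 + x\<^sup>2) / z\<^sup>2" for S C x z :: real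
      by (simp add: power2_eq_square add_divide_distrib algebra_simps)
    moreover have "1 + (sinh s)\<^sup>2 \<noteq> 0" using zero_le_power2[of "sinh s"] by linarith
    ultimately show ?thesis
      by (simp add: spiral_coords_def tanh_def cosh_square_eq add.commute)
  qed
  moreover have "(\<Sum>h\<leftarrow>spiral_coords. deriv h s * deriv h s) = 1" for s
  proof -
    let ?C = "cos (ln (cosh s))" and ?S = "sin (ln (cosh s))"
    have "(\<Sum>h\<leftarrow>spiral_coords. deriv h s * deriv h s) =
        (?S\<^sup>2 + ?C\<^sup>2) * (1 + (sinh s)\<^sup>2)\<^sup>2 / ((cosh s)\<^sup>2)\<^sup>2"
    proof -
      have "(- (S + C) * x / z) * (- (S + C) * x / z) + ((C - S) * x / z * ((C - S) * x / z) +
          ((C - S * x\<^sup>2) / z * ((C - S * x\<^sup>2) / z) + (S + C * x\<^sup>2) / z * ((S + C * x\<^sup>2) / z))) =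
          (S\<^sup>2 + C\<^sup>2) * (1 + x\<^sup>2)\<^sup>2 / z\<^sup>2" for S C x z :: real
        unfolding times_divide_times_eq add_divide_distrib[symmetric] power2_eq_square
        by (rule arg_cong2[where f = "(/)"]) (simp_all add: algebra_simps)
      then show ?thesis
        unfolding spiral_coords_def by (simp only: list.map sum_list.Cons sum_list.Nil add_0_right d0 d1 d2 d3)
    qed
    moreover have "1 + (sinh s)\<^sup>2 \<noteq> 0" using zero_le_power2[of "sinh s"] by linarith
    ultimately show ?thesis unfolding sin_cos_squared_add by (simp add: cosh_square_eq add.commute)
  qed
  ultimately show ?thesis using smooth by (simp add: unit_speed_spherical_def)
qed

text \<open>
  With components \<open>y\<^sub>0, ..., y\<^sub>3\<close>, the quotient \<open>(y\<^sub>0 y\<^sub>2 + y\<^sub>1 y\<^sub>3) / (y\<^sub>0\<^sup>2 + y\<^sub>1\<^sup>2)\<close> is homogeneous of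
  degree 0 and equals the hyperbolic sine of the parameter on the spiral.  The parameter is thus recovered
  from any multiple by a nonzero factor A, and A is eventually nonzero because the denominator is.
\<close>

lemma spiral_tendsto:
  assumes lim: "\<And>h. h \<in> set spiral_coords \<Longrightarrow> ((\<lambda>x. A x * h (\<theta> x)) \<longlongrightarrow> B * h \<beta>) F" and B: "B \<noteq> 0"
  shows "(\<theta> \<longlongrightarrow> \<beta>) F"
proof -
  let ?y0 = "\<lambda>A s. A * (cos (ln (cosh s)) / cosh s)" and ?y1 = "\<lambda>A s. A * (sin (ln (cosh s)) / cosh s)"
    and ?y2 = "\<lambda>A s. A * (cos (ln (cosh s)) * tanh s)" and ?y3 = "\<lambda>A s. A * (sin (ln (cosh s)) * tanh s)"
  let ?N = "\<lambda>A s :: real. ?y0 A s * ?y2 A s + ?y1 A s * ?y3 A s" and ?D = "\<lambda>A s :: real. (?y0 A s)\<^sup>2 + (?y1 A s)\<^sup>2"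
  have D: "?D A s = A\<^sup>2 / (cosh s)\<^sup>2" for A s
  proof -
    have "(A * (C / z))\<^sup>2 + (A * (S / z))\<^sup>2 = A\<^sup>2 * (S\<^sup>2 + C\<^sup>2) / z\<^sup>2" for S C z :: real
      by (simp add: power_mult_distrib power_divide add_divide_distrib algebra_simps)
    then show ?thesis by (simp only: sin_cos_squared_add mult_1_right)
  qed
  have N: "?N A s = A\<^sup>2 * sinh s / (cosh s)\<^sup>2" for A s
  proof -
    have "A * (C / z) * (A * (C * (x / z))) + A * (S / z) * (A * (S * (x / z))) =
        A\<^sup>2 * x * (S\<^sup>2 + C\<^sup>2) / z\<^sup>2" for S C x z :: real
      by (simp add: power2_eq_square add_divide_distrib algebra_simps)
    then show ?thesis by (simp only: tanh_def sin_cos_squared_add mult_1_right)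
  qed
  have limN: "((\<lambda>x. ?N (A x) (\<theta> x)) \<longlongrightarrow> ?N B \<beta>) F" and limD: "((\<lambda>x. ?D (A x) (\<theta> x)) \<longlongrightarrow> ?D B \<beta>) F"
    by (intro tendsto_add tendsto_mult tendsto_power lim; simp add: spiral_coords_def)+
  have DB: "?D B \<beta> \<noteq> 0" unfolding D using B by simp
  have "((\<lambda>x. ?N (A x) (\<theta> x) / ?D (A x) (\<theta> x)) \<longlongrightarrow> ?N B \<beta> / ?D B \<beta>) F"
    by (rule tendsto_divide[OF limN limD DB])
  moreover have "?N B \<beta> / ?D B \<beta> = sinh \<beta>" unfolding N D using B by simp
  moreover have "eventually (\<lambda>x. ?N (A x) (\<theta> x) / ?D (A x) (\<theta> x) = sinh (\<theta> x)) F"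
    using tendsto_imp_eventually_ne[OF limD DB]
  proof eventually_elim
    case (elim x)
    then show ?case unfolding N D by simp
  qed
  ultimately have "((\<lambda>x. sinh (\<theta> x)) \<longlongrightarrow> sinh \<beta>) F"
    using Lim_transform_eventually by fastforce
  then show ?thesis by (rule tendsto_of_sinh)
qed

lemma sum_list_concat_product:
  "sum_list (map f (concat (map g (List.product xs ys)))) =
    (\<Sum>x\<leftarrow>xs. \<Sum>y\<leftarrow>ys. sum_list (map f (g (x, y))))" for f :: "'c \<Rightarrow> real"
proof -
  have "sum_list (map f (concat (map g zs))) = (\<Sum>z\<leftarrow>zs. sum_list (map f (g z)))" for zs
    by (induction zs) auto
  then have "sum_list (map f (concat (map g (List.product xs ys)))) =
      (\<Sum>z\<leftarrow>List.product xs ys. sum_list (map f (g z)))" .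
  also have "\<dots> = (\<Sum>x\<leftarrow>xs. \<Sum>y\<leftarrow>ys. sum_list (map f (g (x, y))))"
    by (induction xs) (auto simp: o_def)
  finally show ?thesis .
qed

section \<open>The hyperbolas and the windings\<close>

text \<open>
  The curve \<open>\<sigma>\<close> is left open, so that the isometry is proved once for the circle and the spiral.
\<close>

locale wound_data = warped_data +
  fixes a :: nat and \<sigma> :: "real \<Rightarrow> real list" and hs :: "(real \<Rightarrow> real) list"
  assumes a: "a < n" and \<sigma>: "\<And>s. \<sigma> s = map (\<lambda>h. h s) hs" and hs: "unit_speed_spherical hs"
begin

definition cosh_coords :: "((nat \<Rightarrow> real) \<Rightarrow> real) list" where
  "cosh_coords = map (\<lambda>j x. \<eta> j (x 0) * cosh (x j)) [1..<a+1]"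

definition sinh_coords :: "((nat \<Rightarrow> real) \<Rightarrow> real) list" where
  "sinh_coords = map (\<lambda>j x. \<eta> j (x 0) * sinh (x j)) [1..<a+1]"

definition winding_coords :: "real \<Rightarrow> ((nat \<Rightarrow> real) \<Rightarrow> real) list" where
  "winding_coords \<kappa> = concat (map (\<lambda>(j, i). map (\<lambda>h x. amplitude n I \<rho> \<eta> \<kappa> j i (x 0) *
    h (frequency n I \<rho> \<eta> \<kappa> j i (x 0) * x j)) hs) (List.product [a+1..<n] [0, 1]))"

lemma wound_coords_eq: "wound_coords \<sigma> n a I \<rho> \<eta> \<kappa> x = map (\<lambda>\<phi>. \<phi> x) (winding_coords \<kappa>)"
  unfolding wound_coords_def winding_coords_def map_concat
  by (rule arg_cong[where f = concat]) (auto simp: \<sigma> o_def)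

lemma length_winding_coords: "length (winding_coords \<kappa>) = 2 * (n - (a + 1)) * length hs"
proof -
  have "length (concat (map (\<lambda>(j, i). map (f j i) hs) zs)) = length zs * length hs"
    for f :: "nat \<Rightarrow> nat \<Rightarrow> (real \<Rightarrow> real) \<Rightarrow> (nat \<Rightarrow> real) \<Rightarrow> real" and zs
    by (induction zs) auto
  then show ?thesis unfolding winding_coords_def by simp
qed

lemma hs_smooth: "h \<in> set hs \<Longrightarrow> smooth_real_on UNIV h"
  using hs by (simp add: unit_speed_spherical_def)

lemma separated_cosh_sinh:
  assumes "j \<in> {1..a}"
  shows "separated_on n I j (\<eta> j) cosh (\<lambda>x. \<eta> j (x 0) * cosh (x j))"
    and "separated_on n I j (\<eta> j) sinh (\<lambda>x. \<eta> j (x 0) * sinh (x j))"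
  using assms a open_I smooth_\<eta>[of j]
  by (auto simp: separated_on_def smooth_real_on_cosh smooth_real_on_sinh)

text \<open>
  Freezing the frequency at t turns the component into a product, although the frequency depends on t.
\<close>

lemma separated_winding:
  assumes j: "j \<in> {a+1..<n}" and i: "i \<in> {0, 1}" and t: "t \<in> I" and \<kappa>: "0 \<le> \<kappa>" and h: "h \<in> set hs"
  obtains J where "t \<in> J" "separated_on n J j (amplitude n I \<rho> \<eta> \<kappa> j i)
    (\<lambda>y. h (frequency n I \<rho> \<eta> \<kappa> j i t * y))
    (\<lambda>x. amplitude n I \<rho> \<eta> \<kappa> j i (x 0) * h (frequency n I \<rho> \<eta> \<kappa> j i (x 0) * x j))"
proof -
  obtain J where J: "open J" "t \<in> J" "J \<subseteq> I" and frz: "\<And>s \<kappa> j h. s \<in> J \<Longrightarrow>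
      amplitude n I \<rho> \<eta> \<kappa> j i s * h (frequency n I \<rho> \<eta> \<kappa> j i s) =
      amplitude n I \<rho> \<eta> \<kappa> j i s * (h (frequency n I \<rho> \<eta> \<kappa> j i t) :: real)"
    using amplitude_locally[OF i t] by metis
  have j': "j \<in> {1..<n}" using j by auto
  show thesis
  proof (rule that[OF J(2)], unfold separated_on_def, intro conjI ballI)
    show "smooth_real_on J (amplitude n I \<rho> \<eta> \<kappa> j i)"
      using smooth_real_on_subset[OF smooth_amplitude[OF i j' \<kappa>] J(3)] .
    show "smooth_real_on UNIV (\<lambda>y. h (frequency n I \<rho> \<eta> \<kappa> j i t * y))"
      by (intro smooth_real_on_compose_UNIV[OF hs_smooth[OF h]] smooth_real_on_mult smooth_real_on_const
          smooth_real_on_ident open_UNIV)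
    fix x assume "x \<in> warped_domain n J"
    then show "amplitude n I \<rho> \<eta> \<kappa> j i (x 0) * h (frequency n I \<rho> \<eta> \<kappa> j i (x 0) * x j) =
        amplitude n I \<rho> \<eta> \<kappa> j i (x 0) * h (frequency n I \<rho> \<eta> \<kappa> j i t * x j)"
      \<comment> \<open>Here the frozen expression is a function of the frequency with x j as a parameter.\<close>
      using frz[of "x 0" \<kappa> j "\<lambda>w. h (w * x j)"] by (simp add: mem_warped_domain_iff)
  qed (use J j in auto)
qed

lemma set_winding_coords: "set (winding_coords \<kappa>) = (\<Union>j\<in>{a+1..<n}. \<Union>i\<in>{0, 1}. (\<lambda>h x.
    amplitude n I \<rho> \<eta> \<kappa> j i (x 0) * h (frequency n I \<rho> \<eta> \<kappa> j i (x 0) * x j)) ` set hs)"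
proof -
  have "set (concat (map (\<lambda>(j, i). map (f j i) hs) (List.product js is))) =
      (\<Union>j\<in>set js. \<Union>i\<in>set is. f j i ` set hs)"
    for f :: "nat \<Rightarrow> nat \<Rightarrow> (real \<Rightarrow> real) \<Rightarrow> (nat \<Rightarrow> real) \<Rightarrow> real" and js "is"
    by auto
  then show ?thesis unfolding winding_coords_def by (simp only: set_upt list.set)
qed

lemma locally_separated_hyperbola_coords:
  assumes "\<phi> \<in> set cosh_coords \<union> set sinh_coords"
  shows "locally_separated n I \<phi>"
proof -
  have "\<phi> \<in> (\<lambda>j x. \<eta> j (x 0) * cosh (x j)) ` {1..a} \<union> (\<lambda>j x. \<eta> j (x 0) * sinh (x j)) ` {1..a}"
    using assms unfolding cosh_coords_def sinh_coords_def set_map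
    by (simp add: atLeastLessThanSuc_atLeastAtMost del: upt_Suc)
  then show ?thesis
    using separated_on_imp_locally[OF separated_cosh_sinh(1)]
      separated_on_imp_locally[OF separated_cosh_sinh(2)] by (elim UnE imageE) simp_all
qed

lemma locally_separated_winding_coords:
  assumes \<kappa>: "0 \<le> \<kappa>" and "\<phi> \<in> set (winding_coords \<kappa>)"
  shows "locally_separated n I \<phi>"
proof -
  from assms(2) obtain j i h where *: "j \<in> {a+1..<n}" "i \<in> {0, 1}" "h \<in> set hs"
    and \<phi>: "\<phi> = (\<lambda>x. amplitude n I \<rho> \<eta> \<kappa> j i (x 0) * h (frequency n I \<rho> \<eta> \<kappa> j i (x 0) * x j))"
    unfolding set_winding_coords by (elim UN_E imageE)
  have "\<exists>J j u v. t \<in> J \<and> separated_on n J j u v \<phi>" if "t \<in> I" for t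
    unfolding \<phi> by (rule separated_winding[OF *(1,2) that \<kappa> *(3)]) (intro exI conjI)
  then show "locally_separated n I \<phi>" by (simp add: locally_separated_def)
qed

lemma sum_list_winding:
  "(\<Sum>\<phi>\<leftarrow>winding_coords \<kappa>. F \<phi>) = (\<Sum>j\<in>{a+1..<n}. \<Sum>i\<in>{0, 1}. \<Sum>h\<leftarrow>hs.
    F (\<lambda>x. amplitude n I \<rho> \<eta> \<kappa> j i (x 0) * h (frequency n I \<rho> \<eta> \<kappa> j i (x 0) * x j)))"
  for F :: "((nat \<Rightarrow> real) \<Rightarrow> real) \<Rightarrow> real"
  unfolding winding_coords_def sum_list_concat_product
  by (simp add: interv_sum_list_conv_sum_set_nat o_def del: upt_Suc)

lemma winding_norm:
  "(\<Sum>\<phi>\<leftarrow>winding_coords \<kappa>. \<phi> x * \<phi> x) = amplitude_sum n a I \<rho> \<eta> \<kappa> (x 0)"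
  unfolding sum_list_winding amplitude_sum_def
proof (intro sum.cong refl)
  fix j i
  let ?A = "amplitude n I \<rho> \<eta> \<kappa> j i (x 0)" and ?s = "frequency n I \<rho> \<eta> \<kappa> j i (x 0) * x j"
  show "(\<Sum>h\<leftarrow>hs. ?A * h ?s * (?A * h ?s)) = ?A\<^sup>2"
    using unit_speed_spherical_inner[OF hs, of ?A ?s 0 ?A 0] by (simp add: power2_eq_square)
qed

text \<open>
  In each block the product of amplitude and frequency is \<open>\<eta>\<^sub>j\<close> times the cutoff, and the squares of the
  two cutoffs add up to 1.
\<close>

lemma winding_metric:
  assumes p: "p \<in> warped_domain n I" and \<kappa>: "0 \<le> \<kappa>"
    and v: "v \<in> topspace (Euclidean_space n)" and w: "w \<in> topspace (Euclidean_space n)"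
  shows "(\<Sum>\<phi>\<leftarrow>winding_coords \<kappa>. scalar_differential n \<phi> p v * scalar_differential n \<phi> p w) =
    amplitude_deriv_sum n a I \<rho> \<eta> \<kappa> (p 0) * v 0 * w 0 + (\<Sum>j\<in>{a+1..<n}. (\<eta> j (p 0))\<^sup>2 * v j * w j)"
proof -
  have t: "p 0 \<in> I" using p by (simp add: mem_warped_domain_iff)
  let ?A' = "\<lambda>j i. deriv (amplitude n I \<rho> \<eta> \<kappa> j i) (p 0)" and ?A = "\<lambda>j i. amplitude n I \<rho> \<eta> \<kappa> j i (p 0)"
    and ?w = "\<lambda>j i. frequency n I \<rho> \<eta> \<kappa> j i (p 0)"
  have inner: "(\<Sum>h\<leftarrow>hs.
      scalar_differential n (\<lambda>x. amplitude n I \<rho> \<eta> \<kappa> j i (x 0) * h (frequency n I \<rho> \<eta> \<kappa> j i (x 0) * x j)) p v *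
      scalar_differential n (\<lambda>x. amplitude n I \<rho> \<eta> \<kappa> j i (x 0) * h (frequency n I \<rho> \<eta> \<kappa> j i (x 0) * x j)) p w) =
      (?A' j i)\<^sup>2 * (v 0 * w 0) + (\<eta> j (p 0) * cutoff i (param I (p 0)))\<^sup>2 * (v j * w j)"
    if j: "j \<in> {a+1..<n}" and i: "i \<in> {0, 1}" for j i
  proof -
    have sd: "scalar_differential n (\<lambda>x. amplitude n I \<rho> \<eta> \<kappa> j i (x 0) * h (frequency n I \<rho> \<eta> \<kappa> j i (x 0) * x j)) p u =
        ?A' j i * u 0 * h (?w j i * p j) + ?A j i * ?w j i * u j * deriv h (?w j i * p j)"
      if h: "h \<in> set hs" and u: "u \<in> topspace (Euclidean_space n)" for h u
    proof -
      obtain J where J: "p 0 \<in> J" and sep: "separated_on n J j (amplitude n I \<rho> \<eta> \<kappa> j i) (\<lambda>y. h (?w j i * y))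
          (\<lambda>x. amplitude n I \<rho> \<eta> \<kappa> j i (x 0) * h (frequency n I \<rho> \<eta> \<kappa> j i (x 0) * x j))"
        by (rule separated_winding[OF j i t \<kappa> h])
      have "((\<lambda>y. h (?w j i * y)) has_real_derivative deriv h (?w j i * p j) * ?w j i) (at (p j))"
        by (rule DERIV_chain2[OF smooth_real_on_has_deriv[OF hs_smooth[OF h]]])
          (auto intro!: derivative_eq_intros)
      then have "deriv (\<lambda>y. h (?w j i * y)) (p j) = deriv h (?w j i * p j) * ?w j i"
        by (rule DERIV_imp_deriv)
      moreover have "p \<in> warped_domain n J" using p J by (simp add: mem_warped_domain_iff)
      ultimately show ?thesis
        using scalar_differential_separated_on[OF sep _ u n] by simp
    qed
    have "(\<Sum>h\<leftarrow>hs.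
      scalar_differential n (\<lambda>x. amplitude n I \<rho> \<eta> \<kappa> j i (x 0) * h (frequency n I \<rho> \<eta> \<kappa> j i (x 0) * x j)) p v *
      scalar_differential n (\<lambda>x. amplitude n I \<rho> \<eta> \<kappa> j i (x 0) * h (frequency n I \<rho> \<eta> \<kappa> j i (x 0) * x j)) p w) =
      (\<Sum>h\<leftarrow>hs. (?A' j i * v 0 * h (?w j i * p j) + ?A j i * ?w j i * v j * deriv h (?w j i * p j)) *
        (?A' j i * w 0 * h (?w j i * p j) + ?A j i * ?w j i * w j * deriv h (?w j i * p j)))"
      by (intro arg_cong[where f = sum_list] map_cong refl) (simp only: sd v w)
    also have "\<dots> = (?A' j i * v 0) * (?A' j i * w 0) + (?A j i * ?w j i * v j) * (?A j i * ?w j i * w j)"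
      by (rule unit_speed_spherical_inner[OF hs])
    also have "?A j i * ?w j i = \<eta> j (p 0) * cutoff i (param I (p 0))"
      using frequency_pos[of j "p 0" \<kappa> i] j t \<kappa> by (simp add: amplitude_def)
    finally show ?thesis by (simp add: power2_eq_square algebra_simps)
  qed
  have "(\<Sum>\<phi>\<leftarrow>winding_coords \<kappa>. scalar_differential n \<phi> p v * scalar_differential n \<phi> p w) =
      (\<Sum>j\<in>{a+1..<n}. \<Sum>i\<in>{0, 1}. (?A' j i)\<^sup>2 * (v 0 * w 0) + (\<eta> j (p 0) * cutoff i (param I (p 0)))\<^sup>2 * (v j * w j))"
    unfolding sum_list_winding by (intro sum.cong refl inner)
  also have "\<dots> = amplitude_deriv_sum n a I \<rho> \<eta> \<kappa> (p 0) * (v 0 * w 0) +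
      (\<Sum>j\<in>{a+1..<n}. \<Sum>i\<in>{0, 1}. (\<eta> j (p 0) * cutoff i (param I (p 0)))\<^sup>2 * (v j * w j))"
    unfolding amplitude_deriv_sum_def sum.distrib sum_distrib_right ..
  also have "(\<Sum>j\<in>{a+1..<n}. \<Sum>i\<in>{0, 1}. (\<eta> j (p 0) * cutoff i (param I (p 0)))\<^sup>2 * (v j * w j)) =
      (\<Sum>j\<in>{a+1..<n}. (\<eta> j (p 0))\<^sup>2 * v j * w j)"
  proof (intro sum.cong refl)
    fix j
    have "(\<Sum>i\<in>{0, 1}. (\<eta> j (p 0) * cutoff i (param I (p 0)))\<^sup>2 * (v j * w j)) =
      (\<eta> j (p 0))\<^sup>2 * v j * w j * ((cutoff 0 (param I (p 0)))\<^sup>2 + (cutoff (Suc 0) (param I (p 0)))\<^sup>2)"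
      by (simp add: power_mult_distrib algebra_simps)
    then show "(\<Sum>i\<in>{0, 1}. (\<eta> j (p 0) * cutoff i (param I (p 0)))\<^sup>2 * (v j * w j)) =
      (\<eta> j (p 0))\<^sup>2 * v j * w j" by (simp only: cutoff_sum_squares mult_1_right)
  qed
  finally show ?thesis by (simp add: mult.assoc)
qed

lemma hyperbola_norm:
  "- (\<Sum>\<phi>\<leftarrow>cosh_coords. \<phi> x * \<phi> x) + (\<Sum>\<phi>\<leftarrow>sinh_coords. \<phi> x * \<phi> x) = - (\<Sum>j\<in>{1..a}. (\<eta> j (x 0))\<^sup>2)"
proof -
  have set: "set [1..<a+1] = {1..a}" by auto
  have "- (\<eta> j (x 0) * cosh (x j) * (\<eta> j (x 0) * cosh (x j))) + \<eta> j (x 0) * sinh (x j) * (\<eta> j (x 0) * sinh (x j)) =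
      - (\<eta> j (x 0))\<^sup>2" for j
  proof -
    have "- (e * C * (e * C)) + e * S * (e * S) = - (C\<^sup>2 - S\<^sup>2) * e\<^sup>2" for e C S :: real
      by (simp add: power2_eq_square algebra_simps)
    then show ?thesis by (simp add: cosh_square_eq)
  qed
  then show ?thesis
    unfolding cosh_coords_def sinh_coords_def map_map o_def interv_sum_list_conv_sum_set_nat set
      sum_negf[symmetric] sum.distrib[symmetric] by (simp only:)
qed

lemma hyperbola_metric:
  assumes p: "p \<in> warped_domain n I"
    and v: "v \<in> topspace (Euclidean_space n)" and w: "w \<in> topspace (Euclidean_space n)"
  shows "- (\<Sum>\<phi>\<leftarrow>cosh_coords. scalar_differential n \<phi> p v * scalar_differential n \<phi> p w) +
    (\<Sum>\<phi>\<leftarrow>sinh_coords. scalar_differential n \<phi> p v * scalar_differential n \<phi> p w) =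
    - (\<Sum>j\<in>{1..a}. (deriv (\<eta> j) (p 0))\<^sup>2) * v 0 * w 0 + (\<Sum>j\<in>{1..a}. (\<eta> j (p 0))\<^sup>2 * v j * w j)"
proof -
  have set: "set [1..<a+1] = {1..a}" by auto
  have dc: "deriv cosh y = sinh y" "deriv sinh y = cosh y" for y :: real
    by (auto intro!: DERIV_imp_deriv derivative_eq_intros)
  let ?C = "\<lambda>j. scalar_differential n (\<lambda>x. \<eta> j (x 0) * cosh (x j)) p"
    and ?S = "\<lambda>j. scalar_differential n (\<lambda>x. \<eta> j (x 0) * sinh (x j)) p"
  have sd: "?C j u = deriv (\<eta> j) (p 0) * cosh (p j) * u 0 + \<eta> j (p 0) * sinh (p j) * u j"
    "?S j u = deriv (\<eta> j) (p 0) * sinh (p j) * u 0 + \<eta> j (p 0) * cosh (p j) * u j"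
    if "j \<in> {1..a}" "u \<in> topspace (Euclidean_space n)" for j u
    using scalar_differential_separated_on[OF separated_cosh_sinh(1)[OF that(1)] p that(2) n]
      scalar_differential_separated_on[OF separated_cosh_sinh(2)[OF that(1)] p that(2) n]
    by (simp_all add: dc)
  have "- (?C j v * ?C j w) + ?S j v * ?S j w =
      - ((deriv (\<eta> j) (p 0))\<^sup>2 * (v 0 * w 0)) + (\<eta> j (p 0))\<^sup>2 * v j * w j" if "j \<in> {1..a}" for j
  proof -
    have "- ((d * C * v0 + e * S * vj) * (d * C * w0 + e * S * wj)) +
        (d * S * v0 + e * C * vj) * (d * S * w0 + e * C * wj) =
        (C\<^sup>2 - S\<^sup>2) * (- (d\<^sup>2 * (v0 * w0)) + e\<^sup>2 * vj * wj)" for d C e S v0 w0 vj wj :: real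
      by (simp add: power2_eq_square algebra_simps)
    then show ?thesis unfolding sd[OF that v] sd[OF that w] by (simp add: cosh_square_eq)
  qed
  then have "(\<Sum>j\<in>{1..a}. - (?C j v * ?C j w) + ?S j v * ?S j w) =
      (\<Sum>j\<in>{1..a}. - ((deriv (\<eta> j) (p 0))\<^sup>2 * (v 0 * w 0)) + (\<eta> j (p 0))\<^sup>2 * v j * w j)"
    by (rule sum.cong[OF refl])
  also have "\<dots> = - (\<Sum>j\<in>{1..a}. (deriv (\<eta> j) (p 0))\<^sup>2) * v 0 * w 0 + (\<Sum>j\<in>{1..a}. (\<eta> j (p 0))\<^sup>2 * v j * w j)"
    by (simp only: sum.distrib sum_negf sum_distrib_right mult_minus_left mult.assoc)
  finally show ?thesis
    unfolding cosh_coords_def sinh_coords_def map_map o_def interv_sum_list_conv_sum_set_nat set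
    by (simp only: sum.distrib sum_negf)
qed

lemma sum_split_directions:
  "(\<Sum>j\<in>{1..a}. f j) + (\<Sum>j\<in>{a+1..<n}. f j) = (\<Sum>j\<in>{1..<n}. f j)" for f :: "nat \<Rightarrow> real"
proof -
  have "{1..<n} = {1..a} \<union> {a+1..<n}" using a by auto
  moreover have "{1..a} \<inter> {a+1..<n} = {}" by auto
  ultimately show ?thesis using sum.union_disjoint[of "{1..a}" "{a+1..<n}" f] by simp
qed

lemma antiderivative_from_base:
  assumes g: "smooth_real_on I g" and t: "t \<in> I"
  shows "((\<lambda>t. LBINT s=base I..t. g s) has_real_derivative g t) (at t)"
proof -
  have ends: "\<exists>l\<in>I. \<exists>u\<in>I. l < x \<and> x < u" if x: "x \<in> I" for x
  proof -
    obtain e where e: "e > 0" "ball x e \<subseteq> I" using open_I x open_contains_ball by blast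
    have "x - e/2 \<in> I" "x + e/2 \<in> I" using e by (auto simp: dist_real_def intro!: subsetD[OF e(2)])
    moreover have "x - e/2 < x" "x < x + e/2" using e(1) by auto
    ultimately show ?thesis by blast
  qed
  have "min (base I) t \<in> I" "max (base I) t \<in> I" using base_mem t by (auto simp: min_def max_def)
  with ends obtain l u where l: "l \<in> I" "l < min (base I) t" and u: "u \<in> I" "max (base I) t < u"
    by blast
  note lu = l u
  then have sub: "{l..u} \<subseteq> I"
    using mem_is_interval_1_I[OF interval_I lu(1,3)] by auto
  have "((\<lambda>t. LBINT s=base I..t. g s) has_vector_derivative g t) (at t within {l..u})"
    by (rule interval_integral_FTC2)
      (use lu continuous_on_subset[OF smooth_real_on_continuous_on[OF g] sub] in auto)
  moreover have "at t within {l..u} = at t" using lu by (intro at_within_Icc_at) auto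
  ultimately show ?thesis by (simp add: has_real_derivative_iff_has_vector_derivative)
qed

lemma angle_from_base:
  assumes g: "smooth_real_on I g" and \<theta>: "\<And>t. \<theta> t = (LBINT s=base I..t. g s)"
  shows "smooth_real_on I \<theta>" and "t \<in> I \<Longrightarrow> deriv \<theta> t = g t"
    and "(\<And>t. t \<in> I \<Longrightarrow> 0 < g t) \<Longrightarrow> s \<in> I \<Longrightarrow> t \<in> I \<Longrightarrow> s < t \<Longrightarrow> \<theta> s < \<theta> t"
proof -
  have \<theta>: "\<theta> = (\<lambda>t. LBINT s=base I..t. g s)" using assms(2) by auto
  show "smooth_real_on I \<theta>" unfolding \<theta>
    by (rule smooth_real_on_antideriv[OF open_I antiderivative_from_base[OF g] g])
  show "t \<in> I \<Longrightarrow> deriv \<theta> t = g t" unfolding \<theta> by (rule DERIV_imp_deriv[OF antiderivative_from_base[OF g]])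
  assume pos: "\<And>t. t \<in> I \<Longrightarrow> 0 < g t" and st: "s \<in> I" "t \<in> I" "s < t"
  show "\<theta> s < \<theta> t"
  proof (rule DERIV_pos_imp_increasing[OF st(3)])
    fix x assume "s \<le> x" "x \<le> t"
    then have "x \<in> I" using mem_is_interval_1_I[OF interval_I st(1,2)] by blast
    then show "\<exists>y. DERIV \<theta> x :> y \<and> 0 < y" unfolding \<theta> using antiderivative_from_base[OF g] pos by blast
  qed
qed

lemma smooth_amplitude_sums:
  assumes "0 \<le> \<kappa>"
  shows "smooth_real_on I (amplitude_sum n a I \<rho> \<eta> \<kappa>)"
    and "smooth_real_on I (amplitude_deriv_sum n a I \<rho> \<eta> \<kappa>)"
  unfolding amplitude_sum_def[abs_def] amplitude_deriv_sum_def[abs_def]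
  by (rule smooth_real_on_sum smooth_real_on_power smooth_real_on_deriv smooth_amplitude open_I assms
      | simp)+

lemma smooth_\<eta>_sums:
  "smooth_real_on I (\<lambda>t. \<Sum>j\<in>{1..a}. (\<eta> j t)\<^sup>2)" "smooth_real_on I (\<lambda>t. \<Sum>j\<in>{1..a}. (deriv (\<eta> j) t)\<^sup>2)"
  by (rule smooth_real_on_sum smooth_real_on_power smooth_real_on_deriv smooth_\<eta> open_I
      | (use a in simp; fail))+

lemma amplitude_sum_nonneg: "0 \<le> amplitude_sum n a I \<rho> \<eta> \<kappa> t"
  and amplitude_deriv_sum_nonneg: "0 \<le> amplitude_deriv_sum n a I \<rho> \<eta> \<kappa> t"
  by (simp_all add: amplitude_sum_def amplitude_deriv_sum_def sum_nonneg)

end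

section \<open>The maps into the flat space\<close>

context wound_data
begin

lemma length_hyperbola_coords: "length cosh_coords = a" "length sinh_coords = a"
  by (simp_all add: cosh_coords_def sinh_coords_def)

text \<open>
  Once t is recovered, so are the other coordinates: \<open>\<eta>\<^sub>j\<close> is positive, and at the limit point at least one
  of the two windings of \<open>x\<^sub>j\<close> has a nonzero amplitude, while its frequency may be frozen.
\<close>

lemma other_coordinates_tendsto:
  assumes spiral: "hs = spiral_coords" and \<kappa>: "0 \<le> \<kappa>"
    and p: "p \<in> warped_domain n I" and ev: "eventually (\<lambda>x. x \<in> warped_domain n I) F"
    and lim0: "((\<lambda>x. x 0) \<longlongrightarrow> p 0) F"
    and lim: "\<And>\<phi>. \<phi> \<in> set sinh_coords \<union> set (winding_coords \<kappa>) \<Longrightarrow> (\<phi> \<longlongrightarrow> \<phi> p) F"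
    and j: "j < n"
  shows "((\<lambda>x. x j) \<longlongrightarrow> p j) F"
proof -
  have t: "p 0 \<in> I" using p by (simp add: mem_warped_domain_iff)
  consider "j = 0" | "j \<in> {1..a}" | "j \<in> {a+1..<n}" using j by fastforce
  then show ?thesis
  proof cases
    case 1
    then show ?thesis using lim0 by simp
  next
    case 2
    then have j': "j \<in> {1..<n}" using a by auto
    have "(\<lambda>x. \<eta> j (x 0) * sinh (x j)) \<in> set sinh_coords"
      using 2 unfolding sinh_coords_def set_map by (intro image_eqI[of _ _ j] refl) auto
    from lim[OF UnI1[OF this]] have "((\<lambda>x. \<eta> j (x 0) * sinh (x j)) \<longlongrightarrow> \<eta> j (p 0) * sinh (p j)) F" .
    moreover have "((\<lambda>x. \<eta> j (x 0)) \<longlongrightarrow> \<eta> j (p 0)) F"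
      by (rule isCont_tendsto_compose[OF smooth_real_on_isCont[OF smooth_\<eta>[OF j'] t] lim0])
    ultimately have "((\<lambda>x. \<eta> j (x 0) * sinh (x j) / \<eta> j (x 0)) \<longlongrightarrow> \<eta> j (p 0) * sinh (p j) / \<eta> j (p 0)) F"
      by (rule tendsto_divide) (use \<eta>_pos[OF j' t] in simp)
    moreover have "eventually (\<lambda>x. \<eta> j (x 0) * sinh (x j) / \<eta> j (x 0) = sinh (x j)) F"
      using ev
    proof eventually_elim
      case (elim x)
      then have "\<eta> j (x 0) > 0" using \<eta>_pos[OF j'] by (simp add: mem_warped_domain_iff)
      then show ?case by simp
    qed
    moreover have "\<eta> j (p 0) * sinh (p j) / \<eta> j (p 0) = sinh (p j)" using \<eta>_pos[OF j' t] by simp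
    ultimately have "((\<lambda>x. sinh (x j)) \<longlongrightarrow> sinh (p j)) F"
      using Lim_transform_eventually[of "\<lambda>x. \<eta> j (x 0) * sinh (x j) / \<eta> j (x 0)" _ F "\<lambda>x. sinh (x j)"]
      by simp
    then show ?thesis by (rule tendsto_of_sinh)
  next
    case 3
    then have j': "j \<in> {1..<n}" by auto
    have "cutoff 0 (param I (p 0)) \<noteq> 0 \<or> cutoff (Suc 0) (param I (p 0)) \<noteq> 0"
      using cutoff_sum_squares[of "param I (p 0)"] by auto
    then have "\<exists>i\<in>{0, 1}. cutoff i (param I (p 0)) \<noteq> 0" by simp
    then obtain i where i: "i \<in> {0, 1}" and cut: "cutoff i (param I (p 0)) \<noteq> 0" by blast
    let ?A = "amplitude n I \<rho> \<eta> \<kappa> j i" and ?w = "frequency n I \<rho> \<eta> \<kappa> j i"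
    obtain J where J: "open J" "p 0 \<in> J" and frz: "\<And>s \<kappa> j h. s \<in> J \<Longrightarrow>
        amplitude n I \<rho> \<eta> \<kappa> j i s * h (frequency n I \<rho> \<eta> \<kappa> j i s) =
        amplitude n I \<rho> \<eta> \<kappa> j i s * (h (frequency n I \<rho> \<eta> \<kappa> j i (p 0)) :: real)"
      by (rule amplitude_locally[OF i t], rule that)
    have w: "?w (p 0) > 0" by (rule frequency_pos[OF j' t \<kappa>])
    have A: "?A (p 0) \<noteq> 0" using w cut \<eta>_pos[OF j' t] by (simp add: amplitude_def)
    have evJ: "eventually (\<lambda>x. x 0 \<in> J) F" by (rule topological_tendstoD[OF lim0 J])
    have "((\<lambda>x. ?w (p 0) * x j) \<longlongrightarrow> ?w (p 0) * p j) F"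
    proof (rule spiral_tendsto[OF _ A])
      fix h assume h: "h \<in> set spiral_coords"
      have "(\<lambda>x. ?A (x 0) * h (?w (x 0) * x j)) \<in> set (winding_coords \<kappa>)"
        unfolding set_winding_coords using 3 i h spiral by (intro UN_I[of j] UN_I[of i] image_eqI[of _ _ h]) auto
      from lim[OF UnI2[OF this]]
      have "((\<lambda>x. ?A (x 0) * h (?w (x 0) * x j)) \<longlongrightarrow> ?A (p 0) * h (?w (p 0) * p j)) F" .
      moreover have "eventually (\<lambda>x. ?A (x 0) * h (?w (x 0) * x j) = ?A (x 0) * h (?w (p 0) * x j)) F"
        using evJ
      proof eventually_elim
        case (elim x)
        then show ?case using frz[of "x 0" \<kappa> j "\<lambda>w. h (w * x j)"] by simp
      qed
      ultimately show "((\<lambda>x. ?A (x 0) * h (?w (p 0) * x j)) \<longlongrightarrow> ?A (p 0) * h (?w (p 0) * p j)) F"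
        by (rule Lim_transform_eventually)
    qed
    then have "((\<lambda>x. ?w (p 0) * x j / ?w (p 0)) \<longlongrightarrow> ?w (p 0) * p j / ?w (p 0)) F"
      by (rule tendsto_divide[OF _ tendsto_const]) (use w in simp)
    then show ?thesis using w by simp
  qed
qed

definition flat_coords :: "((nat \<Rightarrow> real) \<Rightarrow> real) list" where
  "flat_coords = sinh_coords @ [\<lambda>x. flat_angle n a I \<rho> \<eta> (x 0)] @ winding_coords 0"

lemma flat_map_eq: "flat_map \<sigma> n a I \<rho> \<eta> x = of_coords (map (\<lambda>\<phi>. \<phi> x) (cosh_coords @ flat_coords))"
  by (simp add: flat_map_def flat_coords_def cosh_coords_def sinh_coords_def wound_coords_eq o_def del: upt_Suc)

lemma flat_angle:
  shows smooth_flat_angle: "smooth_real_on I (flat_angle n a I \<rho> \<eta>)"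
    and flat_angle_less: "s \<in> I \<Longrightarrow> t \<in> I \<Longrightarrow> s < t \<Longrightarrow> flat_angle n a I \<rho> \<eta> s < flat_angle n a I \<rho> \<eta> t"
    and deriv_flat_angle: "t \<in> I \<Longrightarrow> (deriv (flat_angle n a I \<rho> \<eta>) t)\<^sup>2 =
      (\<rho> t)\<^sup>2 + (\<Sum>j\<in>{1..a}. (deriv (\<eta> j) t)\<^sup>2) - amplitude_deriv_sum n a I \<rho> \<eta> 0 t"
proof -
  let ?f = "\<lambda>t. (\<rho> t)\<^sup>2 + (\<Sum>j\<in>{1..a}. (deriv (\<eta> j) t)\<^sup>2) - amplitude_deriv_sum n a I \<rho> \<eta> 0 t"
  let ?g = "\<lambda>t. sqrt (?f t)"
  have pos: "0 < ?f t" if "t \<in> I" for t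
  proof -
    have "0 < (\<rho> t)\<^sup>2" using \<rho>_pos[OF that] by simp
    moreover have "0 \<le> (\<Sum>j\<in>{1..a}. (deriv (\<eta> j) t)\<^sup>2)" by (simp add: sum_nonneg)
    ultimately show ?thesis using amplitude_deriv_sum_le[OF order_refl that, of a] by linarith
  qed
  have g: "smooth_real_on I ?g"
    by (intro smooth_real_on_sqrt smooth_real_on_diff smooth_real_on_add smooth_real_on_power smooth_\<rho>
        smooth_\<eta>_sums smooth_amplitude_sums open_I pos order_refl)
  have \<theta>: "flat_angle n a I \<rho> \<eta> t = (LBINT s=base I..t. ?g s)" for t by (simp add: flat_angle_def)
  show "smooth_real_on I (flat_angle n a I \<rho> \<eta>)" by (rule angle_from_base(1)[OF g \<theta>])
  show "s \<in> I \<Longrightarrow> t \<in> I \<Longrightarrow> s < t \<Longrightarrow> flat_angle n a I \<rho> \<eta> s < flat_angle n a I \<rho> \<eta> t"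
    by (rule angle_from_base(3)[OF g \<theta>]) (use pos in simp_all)
  show "(deriv (flat_angle n a I \<rho> \<eta>) t)\<^sup>2 = ?f t" if "t \<in> I"
    using angle_from_base(2)[OF g \<theta> that] pos[OF that] by simp
qed

lemma flat_isometric_immersion:
  assumes m: "m = 2 * a + 1 + 2 * (n - (a + 1)) * length hs"
  shows "isometric_immersion n (warped_domain n I) (warped_metric n \<rho> \<eta>) (semi_Euclidean m a) (flat_map \<sigma> n a I \<rho> \<eta>)"
proof (rule isometric_immersion_coordinates[OF n flat_map_eq])
  show "length cosh_coords = amb_index (semi_Euclidean m a)"
    "length (cosh_coords @ flat_coords) = amb_dim (semi_Euclidean m a)"
    by (simp_all add: semi_Euclidean_def flat_coords_def length_hyperbola_coords length_winding_coords m)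
  then have len: "length (cosh_coords @ flat_coords) = m" by (simp add: semi_Euclidean_def)
  fix \<phi> assume "\<phi> \<in> set (cosh_coords @ flat_coords)"
  then consider "\<phi> \<in> set cosh_coords \<union> set sinh_coords" | "\<phi> = (\<lambda>x. flat_angle n a I \<rho> \<eta> (x 0))"
    | "\<phi> \<in> set (winding_coords 0)" by (auto simp: flat_coords_def)
  then show "locally_separated n I \<phi>"
  proof cases
    case 1
    then show ?thesis by (rule locally_separated_hyperbola_coords)
  next
    case 2
    show ?thesis unfolding 2
      by (rule separated_on_imp_locally[OF separated_on_unary[OF open_I smooth_flat_angle]])
  next
    case 3
    then show ?thesis by (rule locally_separated_winding_coords[OF order_refl])
  qed
next
  fix x
  show "flat_map \<sigma> n a I \<rho> \<eta> x \<in> points (semi_Euclidean m a)"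
    unfolding flat_map_eq semi_Euclidean_def target_space.simps
    by (rule of_coords_in_Euclidean) (simp add: flat_coords_def length_hyperbola_coords length_winding_coords m)
next
  fix p v w
  assume p: "p \<in> warped_domain n I" and v: "v \<in> topspace (Euclidean_space n)"
    and w: "w \<in> topspace (Euclidean_space n)"
  then have t: "p 0 \<in> I" by (simp add: mem_warped_domain_iff)
  let ?d = "scalar_differential n"
  have \<theta>: "?d (\<lambda>x. flat_angle n a I \<rho> \<eta> (x 0)) p v * ?d (\<lambda>x. flat_angle n a I \<rho> \<eta> (x 0)) p w =
      (deriv (flat_angle n a I \<rho> \<eta>) (p 0))\<^sup>2 * v 0 * w 0"
    by (simp add: scalar_differential_unary[OF open_I smooth_flat_angle p _ n] v w power2_eq_square)
  have "- (\<Sum>\<phi>\<leftarrow>cosh_coords. ?d \<phi> p v * ?d \<phi> p w) + (\<Sum>\<phi>\<leftarrow>flat_coords. ?d \<phi> p v * ?d \<phi> p w) =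
      (- (\<Sum>\<phi>\<leftarrow>cosh_coords. ?d \<phi> p v * ?d \<phi> p w) + (\<Sum>\<phi>\<leftarrow>sinh_coords. ?d \<phi> p v * ?d \<phi> p w)) +
      (deriv (flat_angle n a I \<rho> \<eta>) (p 0))\<^sup>2 * v 0 * w 0 +
      (\<Sum>\<phi>\<leftarrow>winding_coords 0. ?d \<phi> p v * ?d \<phi> p w)"
    by (simp add: flat_coords_def \<theta>)
  also have "\<dots> = (\<rho> (p 0))\<^sup>2 * v 0 * w 0 +
      ((\<Sum>j\<in>{1..a}. (\<eta> j (p 0))\<^sup>2 * v j * w j) + (\<Sum>j\<in>{a+1..<n}. (\<eta> j (p 0))\<^sup>2 * v j * w j))"
    unfolding hyperbola_metric[OF p v w] winding_metric[OF p order_refl v w] deriv_flat_angle[OF t]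
    by (simp add: algebra_simps)
  finally show "- (\<Sum>\<phi>\<leftarrow>cosh_coords. ?d \<phi> p v * ?d \<phi> p w) + (\<Sum>\<phi>\<leftarrow>flat_coords. ?d \<phi> p v * ?d \<phi> p w) =
      warped_metric n \<rho> \<eta> p v w"
    unfolding sum_split_directions warped_metric_def .
qed (fact \<rho>_pos \<eta>_pos)+

lemma flat_isometric_embedding:
  assumes m: "m = 2 * a + 1 + 2 * (n - (a + 1)) * length hs" and spiral: "hs = spiral_coords"
  shows "isometric_embedding n (warped_domain n I) (warped_metric n \<rho> \<eta>) (semi_Euclidean m a) (flat_map \<sigma> n a I \<rho> \<eta>)"
proof (rule isometric_embedding_coordinates[OF flat_isometric_immersion[OF m] warped_domain_subset _ flat_map_eq])
  show "points (semi_Euclidean m a) \<subseteq> topspace (Euclidean_space (amb_dim (semi_Euclidean m a)))"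
    by (simp add: semi_Euclidean_def)
  show "length (cosh_coords @ flat_coords) = amb_dim (semi_Euclidean m a)"
    by (simp add: semi_Euclidean_def flat_coords_def length_hyperbola_coords length_winding_coords m)
  fix p F j
  assume p: "p \<in> warped_domain n I" and ev: "eventually (\<lambda>x. x \<in> warped_domain n I) F"
    and lim: "\<And>\<phi>. \<phi> \<in> set (cosh_coords @ flat_coords) \<Longrightarrow> (\<phi> \<longlongrightarrow> \<phi> p) F" and j: "j < n"
  have lim_angle: "((\<lambda>x. flat_angle n a I \<rho> \<eta> (x 0)) \<longlongrightarrow> flat_angle n a I \<rho> \<eta> (p 0)) F"
    by (rule lim) (simp add: flat_coords_def)
  have lim0: "((\<lambda>x. x 0) \<longlongrightarrow> p 0) F"
    by (rule tendsto_of_interval[OF open_I p refl ev flat_angle_less lim_angle])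
  show "((\<lambda>x. x j) \<longlongrightarrow> p j) F"
    by (rule other_coordinates_tendsto[OF spiral order_refl p ev lim0 _ j], rule lim)
      (auto simp: flat_coords_def)
qed

end

section \<open>The maps into the sphere\<close>

text \<open>
  The Cauchy-Schwarz inequality for the concatenation of two pairs of vectors, of which p and q are
  the inner products and \<open>x, x', y, y'\<close> the squared norms.
\<close>

lemma square_diff_le_Cauchy_Schwarz:
  fixes p q x x' y y' :: real
  assumes "p\<^sup>2 \<le> x * x'" "q\<^sup>2 \<le> y * y'" "0 \<le> x" "0 \<le> x'" "0 \<le> y" "0 \<le> y'"
  shows "(p - q)\<^sup>2 \<le> (x + y) * (x' + y')"
proof -
  have "(p * q)\<^sup>2 \<le> (x * x') * (y * y')"
    unfolding power_mult_distrib using assms by (intro mult_mono) auto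
  also have "\<dots> = (x * y') * (y * x')" by simp
  also have "\<dots> \<le> ((x * y' + y * x') / 2)\<^sup>2"
    using zero_le_power2[of "x * y' - y * x'"] by (simp add: power2_eq_square field_simps)
  finally have "\<bar>p * q\<bar> \<le> \<bar>(x * y' + y * x') / 2\<bar>"
    by (simp only: abs_le_square_iff)
  moreover have "0 \<le> (x * y' + y * x') / 2" using assms by simp
  ultimately have "\<bar>p * q\<bar> \<le> (x * y' + y * x') / 2" by linarith
  then have "- (p * q) \<le> (x * y' + y * x') / 2" by linarith
  then show ?thesis using assms(1,2) by (simp add: power2_eq_square algebra_simps)
qed

context wound_data
begin

lemma smooth_curve_component:
  assumes "smooth_real_on I r" "smooth_real_on I \<theta>" "smooth_real_on UNIV h"
  shows "smooth_real_on I (\<lambda>t. r t * h (\<theta> t))"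
  by (intro smooth_real_on_mult open_I assms smooth_real_on_compose_UNIV[OF assms(3)])

lemma locally_separated_curve_component:
  assumes "smooth_real_on I r" "smooth_real_on I \<theta>" "smooth_real_on UNIV h"
  shows "locally_separated n I (\<lambda>x. r (x 0) * h (\<theta> (x 0)))"
  by (rule separated_on_imp_locally[OF separated_on_unary[OF open_I smooth_curve_component[OF assms]]])

lemma scalar_differential_curve_component:
  assumes r: "smooth_real_on I r" and \<theta>: "smooth_real_on I \<theta>" and h: "smooth_real_on UNIV h"
    and p: "p \<in> warped_domain n I" and w: "w \<in> topspace (Euclidean_space n)"
  shows "scalar_differential n (\<lambda>x. r (x 0) * h (\<theta> (x 0))) p w =
    deriv r (p 0) * w 0 * h (\<theta> (p 0)) + r (p 0) * deriv \<theta> (p 0) * w 0 * deriv h (\<theta> (p 0))"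
proof -
  have t: "p 0 \<in> I" using p by (simp add: mem_warped_domain_iff)
  have "((\<lambda>t. r t * h (\<theta> t)) has_real_derivative
      deriv r (p 0) * h (\<theta> (p 0)) + deriv h (\<theta> (p 0)) * deriv \<theta> (p 0) * r (p 0)) (at (p 0))"
    by (rule DERIV_mult[OF smooth_real_on_has_deriv[OF r t]
          DERIV_chain2[OF smooth_real_on_has_deriv[OF h UNIV_I] smooth_real_on_has_deriv[OF \<theta> t]]])
  then have "deriv (\<lambda>t. r t * h (\<theta> t)) (p 0) =
      deriv r (p 0) * h (\<theta> (p 0)) + deriv h (\<theta> (p 0)) * deriv \<theta> (p 0) * r (p 0)"
    by (rule DERIV_imp_deriv)
  then show ?thesis
    unfolding scalar_differential_unary[OF open_I smooth_curve_component[OF r \<theta> h] p w n]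
    by (simp add: algebra_simps)
qed

text \<open>
  As single sums, to which the Cauchy-Schwarz inequality and the derivative of a sum of squares apply.
\<close>

lemma amplitude_sum_eq:
  "amplitude_sum n a I \<rho> \<eta> \<kappa> t =
    (\<Sum>k\<in>{a+1..<n} \<times> {0, 1}. (amplitude n I \<rho> \<eta> \<kappa> (fst k) (snd k) t)\<^sup>2)"
  "amplitude_deriv_sum n a I \<rho> \<eta> \<kappa> t =
    (\<Sum>k\<in>{a+1..<n} \<times> {0, 1}. (deriv (amplitude n I \<rho> \<eta> \<kappa> (fst k) (snd k)) t)\<^sup>2)"
  unfolding amplitude_sum_def amplitude_deriv_sum_def sum.cartesian_product
  by (simp_all add: case_prod_beta)

context
  fixes c :: real
  assumes c: "0 < c"
begin

abbreviation radius where "radius \<equiv> sphere_radius n a I \<rho> \<eta> c"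

text \<open>
  The first inequality, stronger than positivity, is what \<open>sphere_radicand_pos\<close> needs.
\<close>

lemma sphere_radius_square_pos:
  assumes "t \<in> I"
  shows "(\<Sum>j\<in>{1..a}. (\<eta> j t)\<^sup>2) + amplitude_sum n a I \<rho> \<eta> c t <
    1 / c + (\<Sum>j\<in>{1..a}. (\<eta> j t)\<^sup>2) - amplitude_sum n a I \<rho> \<eta> c t"
    and "0 < 1 / c + (\<Sum>j\<in>{1..a}. (\<eta> j t)\<^sup>2) - amplitude_sum n a I \<rho> \<eta> c t"
proof -
  have "amplitude_sum n a I \<rho> \<eta> c t \<le> 1 / (8 * c)" by (rule amplitude_sum_le[OF c assms])
  moreover have "1 / (8 * c) = (1 / c) / 8" "0 < 1 / c" using c by simp_all
  ultimately show 1: "(\<Sum>j\<in>{1..a}. (\<eta> j t)\<^sup>2) + amplitude_sum n a I \<rho> \<eta> c t <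
    1 / c + (\<Sum>j\<in>{1..a}. (\<eta> j t)\<^sup>2) - amplitude_sum n a I \<rho> \<eta> c t" by linarith
  have "0 \<le> (\<Sum>j\<in>{1..a}. (\<eta> j t)\<^sup>2)" by (simp add: sum_nonneg)
  then show "0 < 1 / c + (\<Sum>j\<in>{1..a}. (\<eta> j t)\<^sup>2) - amplitude_sum n a I \<rho> \<eta> c t"
    using 1 amplitude_sum_nonneg[of c t] by linarith
qed

lemma sphere_radius_pos: "t \<in> I \<Longrightarrow> 0 < radius t"
  using sphere_radius_square_pos(2) by (simp add: sphere_radius_def)

lemma sphere_radius_square:
  "t \<in> I \<Longrightarrow> (radius t)\<^sup>2 = 1 / c + (\<Sum>j\<in>{1..a}. (\<eta> j t)\<^sup>2) - amplitude_sum n a I \<rho> \<eta> c t"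
  using sphere_radius_square_pos(2)[of t] by (simp add: sphere_radius_def)

lemma smooth_sphere_radius: "smooth_real_on I radius"
  unfolding sphere_radius_def[abs_def]
  by (intro smooth_real_on_sqrt smooth_real_on_diff smooth_real_on_add smooth_real_on_const
      smooth_\<eta>_sums smooth_amplitude_sums open_I sphere_radius_square_pos(2) less_imp_le[OF c])

text \<open>
  Let E and \<open>E'\<close> be the sums of the \<open>\<eta>\<^sub>j\<^sup>2\<close> and of their \<open>\<eta>\<^sub>j'\<^sup>2\<close>, and B and \<open>B'\<close> those of the amplitudes.
  By Cauchy-Schwarz \<open>(r r')\<^sup>2 \<le> (E + B) (E' + B')\<close>, and \<open>r\<^sup>2 = 1 / c + E - B > E + B\<close>, since B
  is small.  So \<open>r'\<^sup>2 \<le> E' + B'\<close>, and the radicand is at least \<open>\<rho>\<^sup>2 - 2 B'\<close>.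
\<close>

lemma sphere_radicand_pos:
  assumes t: "t \<in> I"
  shows "0 < (\<rho> t)\<^sup>2 + (\<Sum>j\<in>{1..a}. (deriv (\<eta> j) t)\<^sup>2) - amplitude_deriv_sum n a I \<rho> \<eta> c t - (deriv radius t)\<^sup>2"
proof -
  let ?K = "{a+1..<n} \<times> {0::nat, 1}" and ?A = "\<lambda>k. amplitude n I \<rho> \<eta> c (fst k) (snd k)"
  let ?E = "\<Sum>j\<in>{1..a}. (\<eta> j t)\<^sup>2" and ?E' = "\<Sum>j\<in>{1..a}. (deriv (\<eta> j) t)\<^sup>2"
    and ?P = "\<Sum>j\<in>{1..a}. \<eta> j t * deriv (\<eta> j) t"
    and ?B = "amplitude_sum n a I \<rho> \<eta> c t" and ?B' = "amplitude_deriv_sum n a I \<rho> \<eta> c t"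
    and ?Q = "\<Sum>k\<in>?K. ?A k t * deriv (?A k) t"
  have "((\<lambda>t. \<Sum>j\<in>{1..a}. (\<eta> j t)\<^sup>2) has_real_derivative 2 * ?P) (at t)"
    by (rule smooth_real_on_sum_squares(2)[OF open_I _ smooth_\<eta> t]) (use a in auto)
  moreover have "(amplitude_sum n a I \<rho> \<eta> c has_real_derivative 2 * ?Q) (at t)"
    unfolding amplitude_sum_eq[abs_def]
    by (rule smooth_real_on_sum_squares(2)[OF open_I _ smooth_amplitude t]) (use c in auto)
  ultimately have "((\<lambda>t. 1 / c + (\<Sum>j\<in>{1..a}. (\<eta> j t)\<^sup>2) - amplitude_sum n a I \<rho> \<eta> c t) has_real_derivative
      0 + 2 * ?P - 2 * ?Q) (at t)"
    by (intro DERIV_add DERIV_diff DERIV_const)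
  then have "((\<lambda>t. (radius t)\<^sup>2) has_real_derivative 0 + 2 * ?P - 2 * ?Q) (at t)"
    by (rule has_field_derivative_transform_within_open[OF _ open_I t]) (rule sphere_radius_square[symmetric])
  moreover have "((\<lambda>t. (radius t)\<^sup>2) has_real_derivative 2 * (radius t * deriv radius t)) (at t)"
    using smooth_real_on_has_deriv[OF smooth_sphere_radius t] by (auto intro!: derivative_eq_intros)
  ultimately have "radius t * deriv radius t = ?P - ?Q" using DERIV_unique by force
  then have "(radius t)\<^sup>2 * (deriv radius t)\<^sup>2 = (?P - ?Q)\<^sup>2" by (metis power_mult_distrib)
  also have "\<dots> \<le> (?E + ?B) * (?E' + ?B')"
    unfolding amplitude_sum_eq
    by (rule square_diff_le_Cauchy_Schwarz) (auto intro: Cauchy_Schwarz_ineq_sum sum_nonneg)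
  also have "\<dots> \<le> (radius t)\<^sup>2 * (?E' + ?B')"
    unfolding sphere_radius_square[OF t]
    by (intro mult_right_mono less_imp_le[OF sphere_radius_square_pos(1)[OF t]] add_nonneg_nonneg sum_nonneg
        zero_le_power2 amplitude_deriv_sum_nonneg)
  finally have "(deriv radius t)\<^sup>2 \<le> ?E' + ?B'" using sphere_radius_pos[OF t] by simp
  moreover have "?B' \<le> (\<rho> t)\<^sup>2 / 8" by (rule amplitude_deriv_sum_le[OF less_imp_le[OF c] t])
  moreover have "0 < (\<rho> t)\<^sup>2" using \<rho>_pos[OF t] by simp
  ultimately show ?thesis by linarith
qed

lemma sphere_angle:
  shows smooth_sphere_angle: "smooth_real_on I (sphere_angle n a I \<rho> \<eta> c)"
    and sphere_angle_less: "s \<in> I \<Longrightarrow> t \<in> I \<Longrightarrow> s < t \<Longrightarrow> sphere_angle n a I \<rho> \<eta> c s < sphere_angle n a I \<rho> \<eta> c t"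
    and deriv_sphere_angle: "t \<in> I \<Longrightarrow> (deriv radius t)\<^sup>2 + (radius t * deriv (sphere_angle n a I \<rho> \<eta> c) t)\<^sup>2 =
      (\<rho> t)\<^sup>2 + (\<Sum>j\<in>{1..a}. (deriv (\<eta> j) t)\<^sup>2) - amplitude_deriv_sum n a I \<rho> \<eta> c t"
proof -
  let ?f = "\<lambda>t. (\<rho> t)\<^sup>2 + (\<Sum>j\<in>{1..a}. (deriv (\<eta> j) t)\<^sup>2) - amplitude_deriv_sum n a I \<rho> \<eta> c t - (deriv radius t)\<^sup>2"
  let ?g = "\<lambda>t. sqrt (?f t) / radius t"
  have g: "smooth_real_on I ?g"
    by (intro smooth_real_on_divide smooth_real_on_sqrt smooth_real_on_diff smooth_real_on_add smooth_real_on_power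
        smooth_\<rho> smooth_\<eta>_sums smooth_amplitude_sums smooth_sphere_radius smooth_real_on_deriv open_I
        sphere_radicand_pos less_imp_neq[OF sphere_radius_pos, symmetric] less_imp_le[OF c])
  have \<theta>: "sphere_angle n a I \<rho> \<eta> c t = (LBINT s=base I..t. ?g s)" for t by (simp add: sphere_angle_def)
  show "smooth_real_on I (sphere_angle n a I \<rho> \<eta> c)" by (rule angle_from_base(1)[OF g \<theta>])
  show "s \<in> I \<Longrightarrow> t \<in> I \<Longrightarrow> s < t \<Longrightarrow> sphere_angle n a I \<rho> \<eta> c s < sphere_angle n a I \<rho> \<eta> c t"
    by (rule angle_from_base(3)[OF g \<theta>]) (use sphere_radicand_pos sphere_radius_pos in simp_all)
  show "(deriv radius t)\<^sup>2 + (radius t * deriv (sphere_angle n a I \<rho> \<eta> c) t)\<^sup>2 =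
      (\<rho> t)\<^sup>2 + (\<Sum>j\<in>{1..a}. (deriv (\<eta> j) t)\<^sup>2) - amplitude_deriv_sum n a I \<rho> \<eta> c t" if t: "t \<in> I"
    unfolding angle_from_base(2)[OF g \<theta> t] using sphere_radicand_pos[OF t] sphere_radius_pos[OF t] by simp
qed

definition sphere_curve_coords :: "((nat \<Rightarrow> real) \<Rightarrow> real) list" where
  "sphere_curve_coords = map (\<lambda>h x. radius (x 0) * h (sphere_angle n a I \<rho> \<eta> c (x 0))) hs"

definition sphere_coords :: "((nat \<Rightarrow> real) \<Rightarrow> real) list" where
  "sphere_coords = sinh_coords @ sphere_curve_coords @ winding_coords c"

lemma sphere_map_eq:
  "sphere_map \<sigma> n a I \<rho> \<eta> c x = of_coords (map (\<lambda>\<phi>. \<phi> x) (cosh_coords @ sphere_coords))"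
  by (simp add: sphere_map_def sphere_coords_def sphere_curve_coords_def cosh_coords_def sinh_coords_def
      wound_coords_eq o_def \<sigma> del: upt_Suc)

lemma length_sphere_coords:
  "length (cosh_coords @ sphere_coords) = 2 * a + length hs + 2 * (n - (a + 1)) * length hs"
  by (simp add: sphere_coords_def sphere_curve_coords_def length_hyperbola_coords length_winding_coords)

lemma sphere_curve_metric:
  assumes p: "p \<in> warped_domain n I" and v: "v \<in> topspace (Euclidean_space n)"
    and w: "w \<in> topspace (Euclidean_space n)"
  shows "(\<Sum>\<phi>\<leftarrow>sphere_curve_coords. scalar_differential n \<phi> p v * scalar_differential n \<phi> p w) =
    ((deriv radius (p 0))\<^sup>2 + (radius (p 0) * deriv (sphere_angle n a I \<rho> \<eta> c) (p 0))\<^sup>2) * v 0 * w 0"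
proof -
  let ?\<theta> = "sphere_angle n a I \<rho> \<eta> c"
  have "(\<Sum>\<phi>\<leftarrow>sphere_curve_coords. scalar_differential n \<phi> p v * scalar_differential n \<phi> p w) =
      (\<Sum>h\<leftarrow>hs. (deriv radius (p 0) * v 0 * h (?\<theta> (p 0)) + radius (p 0) * deriv ?\<theta> (p 0) * v 0 * deriv h (?\<theta> (p 0))) *
        (deriv radius (p 0) * w 0 * h (?\<theta> (p 0)) + radius (p 0) * deriv ?\<theta> (p 0) * w 0 * deriv h (?\<theta> (p 0))))"
    unfolding sphere_curve_coords_def map_map o_def
    by (intro arg_cong[where f = sum_list] map_cong refl)
      (simp only: scalar_differential_curve_component[OF smooth_sphere_radius smooth_sphere_angle hs_smooth p] v w)
  then show ?thesis
    unfolding unit_speed_spherical_inner[OF hs] by (simp add: power2_eq_square algebra_simps)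
qed

lemma sphere_isometric_immersion:
  assumes m: "m + 1 = 2 * a + length hs + 2 * (n - (a + 1)) * length hs"
  shows "isometric_immersion n (warped_domain n I) (warped_metric n \<rho> \<eta>) (semi_sphere m a c) (sphere_map \<sigma> n a I \<rho> \<eta> c)"
proof (rule isometric_immersion_coordinates[OF n sphere_map_eq])
  show "length cosh_coords = amb_index (semi_sphere m a c)"
    "length (cosh_coords @ sphere_coords) = amb_dim (semi_sphere m a c)"
    unfolding length_sphere_coords using m by (simp_all add: semi_sphere_def length_hyperbola_coords)
  fix \<phi> assume "\<phi> \<in> set (cosh_coords @ sphere_coords)"
  then consider "\<phi> \<in> set cosh_coords \<union> set sinh_coords" | "\<phi> \<in> set sphere_curve_coords"
    | "\<phi> \<in> set (winding_coords c)" by (auto simp: sphere_coords_def)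
  then show "locally_separated n I \<phi>"
  proof cases
    case 1
    then show ?thesis by (rule locally_separated_hyperbola_coords)
  next
    case 2
    then obtain h where "h \<in> set hs" "\<phi> = (\<lambda>x. radius (x 0) * h (sphere_angle n a I \<rho> \<eta> c (x 0)))"
      unfolding sphere_curve_coords_def set_map by (elim imageE)
    then show ?thesis
      using locally_separated_curve_component[OF smooth_sphere_radius smooth_sphere_angle hs_smooth] by simp
  next
    case 3
    then show ?thesis by (rule locally_separated_winding_coords[OF less_imp_le[OF c]])
  qed
next
  fix x assume x: "x \<in> warped_domain n I"
  then have t: "x 0 \<in> I" by (simp add: mem_warped_domain_iff)
  let ?\<Phi> = "cosh_coords @ sphere_coords"
  have len: "length ?\<Phi> = m + 1" unfolding length_sphere_coords m ..
  have curve: "(\<Sum>\<phi>\<leftarrow>sphere_curve_coords. \<phi> x * \<phi> x) = (radius (x 0))\<^sup>2"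
    using unit_speed_spherical_inner[OF hs, of "radius (x 0)" "sphere_angle n a I \<rho> \<eta> c (x 0)" 0 "radius (x 0)" 0]
    by (simp add: sphere_curve_coords_def o_def power2_eq_square)
  let ?y = "sphere_map \<sigma> n a I \<rho> \<eta> c x"
  have y: "?y k = (?\<Phi> ! k) x" if "k < length ?\<Phi>" for k
    unfolding sphere_map_eq of_coords_def length_map using that by (simp only: if_True nth_map)
  have "semi_inner (m + 1) a ?y ?y =
      - (\<Sum>\<phi>\<leftarrow>cosh_coords. \<phi> x * \<phi> x) + (\<Sum>\<phi>\<leftarrow>sphere_coords. \<phi> x * \<phi> x)"
    using semi_inner_append[of cosh_coords sphere_coords ?y "\<lambda>\<phi>. \<phi> x" ?y "\<lambda>\<phi>. \<phi> x", OF y y]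
    by (simp only: len length_hyperbola_coords)
  also have "\<dots> = (- (\<Sum>\<phi>\<leftarrow>cosh_coords. \<phi> x * \<phi> x) + (\<Sum>\<phi>\<leftarrow>sinh_coords. \<phi> x * \<phi> x)) +
      (\<Sum>\<phi>\<leftarrow>sphere_curve_coords. \<phi> x * \<phi> x) + (\<Sum>\<phi>\<leftarrow>winding_coords c. \<phi> x * \<phi> x)"
    by (simp add: sphere_coords_def)
  also have "\<dots> = 1 / c"
    unfolding hyperbola_norm curve winding_norm sphere_radius_square[OF t] by simp
  finally show "?y \<in> points (semi_sphere m a c)"
    using of_coords_in_Euclidean[of "m + 1" "map (\<lambda>\<phi>. \<phi> x) ?\<Phi>"] len
    by (simp add: semi_sphere_def sphere_map_eq)
next
  fix p v w
  assume p: "p \<in> warped_domain n I" and v: "v \<in> topspace (Euclidean_space n)"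
    and w: "w \<in> topspace (Euclidean_space n)"
  then have t: "p 0 \<in> I" by (simp add: mem_warped_domain_iff)
  let ?d = "scalar_differential n"
  have "- (\<Sum>\<phi>\<leftarrow>cosh_coords. ?d \<phi> p v * ?d \<phi> p w) + (\<Sum>\<phi>\<leftarrow>sphere_coords. ?d \<phi> p v * ?d \<phi> p w) =
      (- (\<Sum>\<phi>\<leftarrow>cosh_coords. ?d \<phi> p v * ?d \<phi> p w) + (\<Sum>\<phi>\<leftarrow>sinh_coords. ?d \<phi> p v * ?d \<phi> p w)) +
      (\<Sum>\<phi>\<leftarrow>sphere_curve_coords. ?d \<phi> p v * ?d \<phi> p w) +
      (\<Sum>\<phi>\<leftarrow>winding_coords c. ?d \<phi> p v * ?d \<phi> p w)"
    by (simp add: sphere_coords_def)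
  also have "\<dots> = (\<rho> (p 0))\<^sup>2 * v 0 * w 0 +
      ((\<Sum>j\<in>{1..a}. (\<eta> j (p 0))\<^sup>2 * v j * w j) + (\<Sum>j\<in>{a+1..<n}. (\<eta> j (p 0))\<^sup>2 * v j * w j))"
    unfolding hyperbola_metric[OF p v w] winding_metric[OF p less_imp_le[OF c] v w]
      sphere_curve_metric[OF p v w] deriv_sphere_angle[OF t]
    by (simp add: algebra_simps)
  finally show "- (\<Sum>\<phi>\<leftarrow>cosh_coords. ?d \<phi> p v * ?d \<phi> p w) + (\<Sum>\<phi>\<leftarrow>sphere_coords. ?d \<phi> p v * ?d \<phi> p w) =
      warped_metric n \<rho> \<eta> p v w"
    unfolding sum_split_directions warped_metric_def .
qed (fact \<rho>_pos \<eta>_pos)+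

lemma sphere_isometric_embedding:
  assumes m: "m + 1 = 2 * a + length hs + 2 * (n - (a + 1)) * length hs" and spiral: "hs = spiral_coords"
  shows "isometric_embedding n (warped_domain n I) (warped_metric n \<rho> \<eta>) (semi_sphere m a c) (sphere_map \<sigma> n a I \<rho> \<eta> c)"
proof (rule isometric_embedding_coordinates[OF sphere_isometric_immersion[OF m] warped_domain_subset _ sphere_map_eq])
  show "points (semi_sphere m a c) \<subseteq> topspace (Euclidean_space (amb_dim (semi_sphere m a c)))"
    by (auto simp: semi_sphere_def)
  show "length (cosh_coords @ sphere_coords) = amb_dim (semi_sphere m a c)"
    unfolding length_sphere_coords using m by (simp add: semi_sphere_def)
  fix p F j
  assume p: "p \<in> warped_domain n I" and ev: "eventually (\<lambda>x. x \<in> warped_domain n I) F"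
    and lim: "\<And>\<phi>. \<phi> \<in> set (cosh_coords @ sphere_coords) \<Longrightarrow> (\<phi> \<longlongrightarrow> \<phi> p) F" and j: "j < n"
  have t: "p 0 \<in> I" using p by (simp add: mem_warped_domain_iff)
  have "((\<lambda>x. sphere_angle n a I \<rho> \<eta> c (x 0)) \<longlongrightarrow> sphere_angle n a I \<rho> \<eta> c (p 0)) F"
  proof (rule spiral_tendsto)
    fix h assume "h \<in> set spiral_coords"
    then have "h \<in> set hs" by (simp only: spiral)
    then show "((\<lambda>x. radius (x 0) * h (sphere_angle n a I \<rho> \<eta> c (x 0))) \<longlongrightarrow>
        radius (p 0) * h (sphere_angle n a I \<rho> \<eta> c (p 0))) F"
      by (intro lim) (simp add: sphere_coords_def sphere_curve_coords_def)
  qed (use sphere_radius_pos[OF t] in simp)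
  then have lim0: "((\<lambda>x. x 0) \<longlongrightarrow> p 0) F"
    by (rule tendsto_of_interval[OF open_I p refl ev sphere_angle_less, rotated 3])
  show "((\<lambda>x. x j) \<longlongrightarrow> p j) F"
    by (rule other_coordinates_tendsto[OF spiral less_imp_le[OF c] p ev lim0 _ j], rule lim)
      (auto simp: sphere_coords_def)
qed

end

end

section \<open>The maps into the hyperbolic space\<close>

context wound_data
begin

context
  fixes c :: real
  assumes c: "0 < c"
begin

abbreviation hradius where "hradius \<equiv> hyperbolic_radius n a I \<rho> \<eta> c"

abbreviation hangle where "hangle \<equiv> hyperbolic_angle n a I \<rho> \<eta> c"

lemma hyperbolic_radius_square_pos: "0 < 1 / c + amplitude_sum n a I \<rho> \<eta> 0 t"
  using c amplitude_sum_nonneg[of 0 t] by (intro add_pos_nonneg) auto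

lemma hyperbolic_radius_pos: "0 < hradius t"
  using hyperbolic_radius_square_pos by (simp add: hyperbolic_radius_def)

lemma hyperbolic_radius_square: "(hradius t)\<^sup>2 = 1 / c + amplitude_sum n a I \<rho> \<eta> 0 t"
  using hyperbolic_radius_square_pos[of t] by (simp add: hyperbolic_radius_def)

lemma smooth_hyperbolic_radius: "smooth_real_on I hradius"
  unfolding hyperbolic_radius_def[abs_def]
  by (intro smooth_real_on_sqrt smooth_real_on_add smooth_real_on_const smooth_amplitude_sums open_I
      hyperbolic_radius_square_pos order_refl)

lemma hyperbolic_angle:
  shows smooth_hyperbolic_angle: "smooth_real_on I hangle"
    and hyperbolic_angle_less: "s \<in> I \<Longrightarrow> t \<in> I \<Longrightarrow> s < t \<Longrightarrow> hangle s < hangle t"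
    and deriv_hyperbolic_angle: "t \<in> I \<Longrightarrow> - (deriv hradius t)\<^sup>2 + (hradius t * deriv hangle t)\<^sup>2 =
      (\<rho> t)\<^sup>2 - amplitude_deriv_sum n a I \<rho> \<eta> 0 t"
proof -
  let ?f = "\<lambda>t. (\<rho> t)\<^sup>2 + (deriv hradius t)\<^sup>2 - amplitude_deriv_sum n a I \<rho> \<eta> 0 t"
  let ?g = "\<lambda>t. sqrt (?f t) / hradius t"
  have pos: "0 < ?f t" if "t \<in> I" for t
  proof -
    have "0 < (\<rho> t)\<^sup>2" using \<rho>_pos[OF that] by simp
    then show ?thesis
      using amplitude_deriv_sum_le[OF order_refl that, of a] zero_le_power2[of "deriv hradius t"] by linarith
  qed
  have g: "smooth_real_on I ?g"
    by (intro smooth_real_on_divide smooth_real_on_sqrt smooth_real_on_diff smooth_real_on_add smooth_real_on_power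
        smooth_\<rho> smooth_amplitude_sums smooth_hyperbolic_radius smooth_real_on_deriv open_I
        pos less_imp_neq[OF hyperbolic_radius_pos, symmetric] order_refl)
  have \<theta>: "hangle t = (LBINT s=base I..t. ?g s)" for t by (simp add: hyperbolic_angle_def)
  show "smooth_real_on I hangle" by (rule angle_from_base(1)[OF g \<theta>])
  show "s \<in> I \<Longrightarrow> t \<in> I \<Longrightarrow> s < t \<Longrightarrow> hangle s < hangle t"
    by (rule angle_from_base(3)[OF g \<theta>]) (use pos hyperbolic_radius_pos in simp_all)
  show "- (deriv hradius t)\<^sup>2 + (hradius t * deriv hangle t)\<^sup>2 =
      (\<rho> t)\<^sup>2 - amplitude_deriv_sum n a I \<rho> \<eta> 0 t" if t: "t \<in> I"
    unfolding angle_from_base(2)[OF g \<theta> t] using pos[OF t] hyperbolic_radius_pos[of t] by simp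
qed

text \<open>
  The functions \<open>base_cosh\<close> and \<open>base_sinh\<close> are the components of a curve in the Lorentzian plane.
\<close>

definition base_cosh :: "(nat \<Rightarrow> real) \<Rightarrow> real" where
  "base_cosh x = hradius (x 0) * cosh (hangle (x 0))"

definition base_sinh :: "(nat \<Rightarrow> real) \<Rightarrow> real" where
  "base_sinh x = hradius (x 0) * sinh (hangle (x 0))"

text \<open>
  These coordinates make \<open>\<eta>\<^sub>j (cosh x\<^sub>j, sinh x\<^sub>j, 1)\<close> lightlike and cancel its \<open>dt\<^sup>2\<close> term, so that
  the radius and the angle do not involve the \<open>\<eta>\<^sub>j\<close> with j up to a.
\<close>

definition \<eta>_coords :: "((nat \<Rightarrow> real) \<Rightarrow> real) list" where
  "\<eta>_coords = map (\<lambda>j x. \<eta> j (x 0)) [1..<a+1]"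

definition hyperbolic_coords :: "((nat \<Rightarrow> real) \<Rightarrow> real) list" where
  "hyperbolic_coords = sinh_coords @ \<eta>_coords @ [base_sinh] @ winding_coords 0"

lemma hyperbolic_map_eq:
  "hyperbolic_map \<sigma> n a I \<rho> \<eta> c x =
    of_coords (map (\<lambda>\<phi>. \<phi> x) ((base_cosh # cosh_coords) @ hyperbolic_coords))"
  by (simp add: hyperbolic_map_def hyperbolic_coords_def base_cosh_def base_sinh_def \<eta>_coords_def
      cosh_coords_def sinh_coords_def wound_coords_eq o_def del: upt_Suc)

lemma length_hyperbolic_coords:
  "length ((base_cosh # cosh_coords) @ hyperbolic_coords) = 3 * a + 2 + 2 * (n - (a + 1)) * length hs"
  by (simp add: hyperbolic_coords_def \<eta>_coords_def length_hyperbola_coords length_winding_coords)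

lemma base_curve_metric:
  assumes p: "p \<in> warped_domain n I" and v: "v \<in> topspace (Euclidean_space n)"
    and w: "w \<in> topspace (Euclidean_space n)"
  shows "- (scalar_differential n base_cosh p v * scalar_differential n base_cosh p w) +
      scalar_differential n base_sinh p v * scalar_differential n base_sinh p w =
    (- (deriv hradius (p 0))\<^sup>2 + (hradius (p 0) * deriv hangle (p 0))\<^sup>2) * v 0 * w 0"
proof -
  have dc: "deriv cosh y = sinh y" "deriv sinh y = cosh y" for y :: real
    by (auto intro!: DERIV_imp_deriv derivative_eq_intros)
  note sd = scalar_differential_curve_component[OF smooth_hyperbolic_radius smooth_hyperbolic_angle
      smooth_real_on_cosh[OF open_UNIV] p] scalar_differential_curve_component[OF smooth_hyperbolic_radius
      smooth_hyperbolic_angle smooth_real_on_sinh[OF open_UNIV] p]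
  have "- ((d * v0 * C + e * v0 * S) * (d * w0 * C + e * w0 * S)) +
      (d * v0 * S + e * v0 * C) * (d * w0 * S + e * w0 * C) = (C\<^sup>2 - S\<^sup>2) * ((- d\<^sup>2 + e\<^sup>2) * v0 * w0)"
    for d e C S v0 w0 :: real by (simp add: power2_eq_square algebra_simps)
  then show ?thesis
    unfolding base_cosh_def[abs_def] base_sinh_def[abs_def] sd[OF v] sd[OF w] dc
    by (simp add: cosh_square_eq)
qed

lemma \<eta>_coords_metric:
  assumes p: "p \<in> warped_domain n I" and v: "v \<in> topspace (Euclidean_space n)"
    and w: "w \<in> topspace (Euclidean_space n)"
  shows "(\<Sum>\<phi>\<leftarrow>\<eta>_coords. scalar_differential n \<phi> p v * scalar_differential n \<phi> p w) =
    (\<Sum>j\<in>{1..a}. (deriv (\<eta> j) (p 0))\<^sup>2) * v 0 * w 0"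
proof -
  have set: "set [1..<a+1] = {1..a}" by auto
  have "(\<Sum>j\<in>{1..a}. scalar_differential n (\<lambda>x. \<eta> j (x 0)) p v * scalar_differential n (\<lambda>x. \<eta> j (x 0)) p w) =
      (\<Sum>j\<in>{1..a}. (deriv (\<eta> j) (p 0))\<^sup>2 * v 0 * w 0)"
  proof (rule sum.cong[OF refl])
    fix j assume "j \<in> {1..a}"
    then have "j \<in> {1..<n}" using a by auto
    from scalar_differential_unary[OF open_I smooth_\<eta>[OF this] p _ n]
    show "scalar_differential n (\<lambda>x. \<eta> j (x 0)) p v * scalar_differential n (\<lambda>x. \<eta> j (x 0)) p w =
        (deriv (\<eta> j) (p 0))\<^sup>2 * v 0 * w 0"
      using v w by (simp add: power2_eq_square)
  qed
  then show ?thesis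
    unfolding \<eta>_coords_def map_map o_def interv_sum_list_conv_sum_set_nat set
    by (simp only: sum_distrib_right)
qed

lemma hyperbolic_isometric_immersion:
  assumes m: "m + 1 = 3 * a + 2 + 2 * (n - (a + 1)) * length hs"
  shows "isometric_immersion n (warped_domain n I) (warped_metric n \<rho> \<eta>) (semi_hyperbolic m a c)
    (hyperbolic_map \<sigma> n a I \<rho> \<eta> c)"
proof (rule isometric_immersion_coordinates[OF n hyperbolic_map_eq])
  show "length (base_cosh # cosh_coords) = amb_index (semi_hyperbolic m a c)"
    "length ((base_cosh # cosh_coords) @ hyperbolic_coords) = amb_dim (semi_hyperbolic m a c)"
    unfolding length_hyperbolic_coords using m by (simp_all add: semi_hyperbolic_def length_hyperbola_coords)
  fix \<phi> assume "\<phi> \<in> set ((base_cosh # cosh_coords) @ hyperbolic_coords)"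
  then consider "\<phi> \<in> set cosh_coords \<union> set sinh_coords" | "\<phi> \<in> {base_cosh, base_sinh}" | "\<phi> \<in> set \<eta>_coords"
    | "\<phi> \<in> set (winding_coords 0)" by (auto simp: hyperbolic_coords_def)
  then show "locally_separated n I \<phi>"
  proof cases
    case 1
    then show ?thesis by (rule locally_separated_hyperbola_coords)
  next
    case 2
    then show ?thesis
      using locally_separated_curve_component[OF smooth_hyperbolic_radius smooth_hyperbolic_angle
          smooth_real_on_cosh[OF open_UNIV]] locally_separated_curve_component[OF smooth_hyperbolic_radius
          smooth_hyperbolic_angle smooth_real_on_sinh[OF open_UNIV]]
      unfolding base_cosh_def[abs_def] base_sinh_def[abs_def] by blast
  next
    case 3
    then have "\<phi> \<in> (\<lambda>j x. \<eta> j (x 0)) ` {1..a}"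
      unfolding \<eta>_coords_def set_map by (simp add: atLeastLessThanSuc_atLeastAtMost del: upt_Suc)
    then obtain j where j: "j \<in> {1..a}" and \<phi>: "\<phi> = (\<lambda>x. \<eta> j (x 0))" by (elim imageE)
    have "j \<in> {1..<n}" using j a by auto
    then show ?thesis unfolding \<phi> by (rule separated_on_imp_locally[OF separated_on_unary[OF open_I smooth_\<eta>]])
  next
    case 4
    then show ?thesis by (rule locally_separated_winding_coords[OF order_refl])
  qed
next
  fix x assume x: "x \<in> warped_domain n I"
  let ?T = "base_cosh # cosh_coords"
  let ?\<Phi> = "?T @ hyperbolic_coords"
  have len: "length ?\<Phi> = m + 1" "length ?T = a + 1"
    unfolding length_hyperbolic_coords m by (simp_all add: length_hyperbola_coords)
  let ?y = "hyperbolic_map \<sigma> n a I \<rho> \<eta> c x"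
  have y: "?y k = (?\<Phi> ! k) x" if "k < length ?\<Phi>" for k
    unfolding hyperbolic_map_eq of_coords_def length_map using that by (simp only: if_True nth_map)
  have "- (base_cosh x * base_cosh x) + base_sinh x * base_sinh x =
      - ((cosh (hangle (x 0)))\<^sup>2 - (sinh (hangle (x 0)))\<^sup>2) * (hradius (x 0))\<^sup>2"
    by (simp add: base_cosh_def base_sinh_def power2_eq_square algebra_simps)
  also have "\<dots> = - (1 / c + amplitude_sum n a I \<rho> \<eta> 0 (x 0))"
    unfolding hyperbolic_radius_square by (simp add: cosh_square_eq)
  finally have base: "- (base_cosh x * base_cosh x) + base_sinh x * base_sinh x =
      - (1 / c + amplitude_sum n a I \<rho> \<eta> 0 (x 0))" .
  have set: "set [1..<a+1] = {1..a}" by auto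
  have \<eta>: "(\<Sum>\<phi>\<leftarrow>\<eta>_coords. \<phi> x * \<phi> x) = (\<Sum>j\<in>{1..a}. (\<eta> j (x 0))\<^sup>2)"
    unfolding \<eta>_coords_def map_map o_def interv_sum_list_conv_sum_set_nat set by (simp only: power2_eq_square)
  have "semi_inner (m + 1) (a + 1) ?y ?y =
      - (\<Sum>\<phi>\<leftarrow>?T. \<phi> x * \<phi> x) + (\<Sum>\<phi>\<leftarrow>hyperbolic_coords. \<phi> x * \<phi> x)"
    using semi_inner_append[of ?T hyperbolic_coords ?y "\<lambda>\<phi>. \<phi> x" ?y "\<lambda>\<phi>. \<phi> x", OF y y]
    by (simp only: len)
  also have "\<dots> = (- (base_cosh x * base_cosh x) + base_sinh x * base_sinh x) +
      (- (\<Sum>\<phi>\<leftarrow>cosh_coords. \<phi> x * \<phi> x) + (\<Sum>\<phi>\<leftarrow>sinh_coords. \<phi> x * \<phi> x)) +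
      (\<Sum>\<phi>\<leftarrow>\<eta>_coords. \<phi> x * \<phi> x) + (\<Sum>\<phi>\<leftarrow>winding_coords 0. \<phi> x * \<phi> x)"
    by (simp add: hyperbolic_coords_def)
  also have "\<dots> = - 1 / c"
    unfolding hyperbola_norm base winding_norm \<eta> by simp
  finally show "?y \<in> points (semi_hyperbolic m a c)"
    using of_coords_in_Euclidean[of "m + 1" "map (\<lambda>\<phi>. \<phi> x) ?\<Phi>"] len(1)
    by (simp add: semi_hyperbolic_def hyperbolic_map_eq)
next
  fix p v w
  assume p: "p \<in> warped_domain n I" and v: "v \<in> topspace (Euclidean_space n)"
    and w: "w \<in> topspace (Euclidean_space n)"
  then have t: "p 0 \<in> I" by (simp add: mem_warped_domain_iff)
  let ?d = "scalar_differential n"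
  have "- (\<Sum>\<phi>\<leftarrow>base_cosh # cosh_coords. ?d \<phi> p v * ?d \<phi> p w) + (\<Sum>\<phi>\<leftarrow>hyperbolic_coords. ?d \<phi> p v * ?d \<phi> p w) =
      (- (?d base_cosh p v * ?d base_cosh p w) + ?d base_sinh p v * ?d base_sinh p w) +
      (- (\<Sum>\<phi>\<leftarrow>cosh_coords. ?d \<phi> p v * ?d \<phi> p w) + (\<Sum>\<phi>\<leftarrow>sinh_coords. ?d \<phi> p v * ?d \<phi> p w)) +
      (\<Sum>\<phi>\<leftarrow>\<eta>_coords. ?d \<phi> p v * ?d \<phi> p w) +
      (\<Sum>\<phi>\<leftarrow>winding_coords 0. ?d \<phi> p v * ?d \<phi> p w)"
    by (simp add: hyperbolic_coords_def)
  also have "\<dots> = (\<rho> (p 0))\<^sup>2 * v 0 * w 0 +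
      ((\<Sum>j\<in>{1..a}. (\<eta> j (p 0))\<^sup>2 * v j * w j) + (\<Sum>j\<in>{a+1..<n}. (\<eta> j (p 0))\<^sup>2 * v j * w j))"
    unfolding base_curve_metric[OF p v w] hyperbola_metric[OF p v w] \<eta>_coords_metric[OF p v w]
      winding_metric[OF p order_refl v w] deriv_hyperbolic_angle[OF t]
    by (simp add: algebra_simps)
  finally show "- (\<Sum>\<phi>\<leftarrow>base_cosh # cosh_coords. ?d \<phi> p v * ?d \<phi> p w) +
      (\<Sum>\<phi>\<leftarrow>hyperbolic_coords. ?d \<phi> p v * ?d \<phi> p w) = warped_metric n \<rho> \<eta> p v w"
    unfolding sum_split_directions warped_metric_def .
qed (fact \<rho>_pos \<eta>_pos)+

lemma hyperbolic_isometric_embedding: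
  assumes m: "m + 1 = 3 * a + 2 + 2 * (n - (a + 1)) * length hs" and spiral: "hs = spiral_coords"
  shows "isometric_embedding n (warped_domain n I) (warped_metric n \<rho> \<eta>) (semi_hyperbolic m a c)
    (hyperbolic_map \<sigma> n a I \<rho> \<eta> c)"
proof (rule isometric_embedding_coordinates[OF hyperbolic_isometric_immersion[OF m] warped_domain_subset _ hyperbolic_map_eq])
  show "points (semi_hyperbolic m a c) \<subseteq> topspace (Euclidean_space (amb_dim (semi_hyperbolic m a c)))"
    by (auto simp: semi_hyperbolic_def)
  show "length ((base_cosh # cosh_coords) @ hyperbolic_coords) = amb_dim (semi_hyperbolic m a c)"
    unfolding length_hyperbolic_coords using m by (simp add: semi_hyperbolic_def)
  fix p F j
  assume p: "p \<in> warped_domain n I" and ev: "eventually (\<lambda>x. x \<in> warped_domain n I) F"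
    and lim: "\<And>\<phi>. \<phi> \<in> set ((base_cosh # cosh_coords) @ hyperbolic_coords) \<Longrightarrow> (\<phi> \<longlongrightarrow> \<phi> p) F" and j: "j < n"
  have tanh: "base_sinh x / base_cosh x = tanh (hangle (x 0))" and ne: "base_cosh x \<noteq> 0" for x
    using hyperbolic_radius_pos[of "x 0"] by (simp_all add: base_cosh_def base_sinh_def tanh_def)
  have "((\<lambda>x. base_sinh x / base_cosh x) \<longlongrightarrow> base_sinh p / base_cosh p) F"
    by (intro tendsto_divide lim ne) (simp_all add: hyperbolic_coords_def)
  then have lim_tanh: "((\<lambda>x. tanh (hangle (x 0))) \<longlongrightarrow> tanh (hangle (p 0))) F"
    by (simp only: tanh)
  have less: "tanh (hangle s) < tanh (hangle t)" if "s \<in> I" "t \<in> I" "s < t" for s t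
    using hyperbolic_angle_less[OF that] by simp
  have lim0: "((\<lambda>x. x 0) \<longlongrightarrow> p 0) F"
    by (rule tendsto_of_interval[OF open_I p refl ev less lim_tanh])
  show "((\<lambda>x. x j) \<longlongrightarrow> p j) F"
    by (rule other_coordinates_tendsto[OF spiral order_refl p ev lim0 _ j], rule lim)
      (auto simp: hyperbolic_coords_def)
qed

end

end

section \<open>The six maps together\<close>

theorem theorem1p1:
  fixes n a :: nat and I :: "real set" and \<rho> :: "real \<Rightarrow> real" and \<eta> :: "nat \<Rightarrow> real \<Rightarrow> real"
    and c :: real
  assumes "1 \<le> n"
    and "open I" and "is_interval I" and "I \<noteq> {}"
    and "smooth_real_on I \<rho>" and "\<forall>t\<in>I. 0 < \<rho> t"
    and "\<forall>j\<in>{1..n-1}. smooth_real_on I (\<eta> j) \<and> (\<forall>t\<in>I. 0 < \<eta> j t)"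
    and "0 < c" and "a \<in> {0..n-1}"
  defines "M \<equiv> warped_domain n I" and "d\<sigma> \<equiv> warped_metric n \<rho> \<eta>"
  shows
    "isometric_immersion n M d\<sigma> (semi_Euclidean (4*n-3-2*a) a) (flat_map circle_curve n a I \<rho> \<eta>) \<and>
     isometric_immersion n M d\<sigma> (semi_sphere (4*n-3-2*a) a c) (sphere_map circle_curve n a I \<rho> \<eta> c) \<and>
     isometric_immersion n M d\<sigma> (semi_hyperbolic (4*n-3-a) a c) (hyperbolic_map circle_curve n a I \<rho> \<eta> c) \<and>
     isometric_embedding n M d\<sigma> (semi_Euclidean (8*n-7-6*a) a) (flat_map spiral_curve n a I \<rho> \<eta>) \<and>
     isometric_embedding n M d\<sigma> (semi_sphere (8*n-5-6*a) a c) (sphere_map spiral_curve n a I \<rho> \<eta> c) \<and>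
     isometric_embedding n M d\<sigma> (semi_hyperbolic (8*n-7-5*a) a c) (hyperbolic_map spiral_curve n a I \<rho> \<eta> c)"
proof -
  have j: "j \<in> {1..n-1}" if "j \<in> {1..<n}" for j using that by auto
  have a: "a < n" using assms(1,9) by auto
  have warped: "warped_data n I \<rho> \<eta>"
    by unfold_locales (use assms(1-7) j in auto)
  interpret circle: wound_data n I \<rho> \<eta> a circle_curve circle_coords
    by (intro wound_data.intro warped wound_data_axioms.intro a unit_speed_circle)
      (simp add: circle_curve_def circle_coords_def)
  interpret spiral: wound_data n I \<rho> \<eta> a spiral_curve spiral_coords
    by (intro wound_data.intro warped wound_data_axioms.intro a unit_speed_spiral)
      (simp add: spiral_curve_def spiral_coords_def)
  have len: "length circle_coords = 2" "length spiral_coords = 4"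
    by (simp_all add: circle_coords_def spiral_coords_def)
  obtain d where d: "n = a + 1 + d" using a by (metis add.commute less_iff_Suc_add Suc_eq_plus1 add.assoc)
  show ?thesis
    unfolding M_def d\<sigma>_def
    by (intro conjI circle.flat_isometric_immersion circle.sphere_isometric_immersion[OF \<open>0 < c\<close>]
        circle.hyperbolic_isometric_immersion[OF \<open>0 < c\<close>] spiral.flat_isometric_embedding
        spiral.sphere_isometric_embedding[OF \<open>0 < c\<close>] spiral.hyperbolic_isometric_embedding[OF \<open>0 < c\<close>] refl)
      (simp_all add: d len)
qed

end
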